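(* Let $J\colon\mathcal A\hookrightarrow\mathcal K$ be a fully faithful functor between (ordinary) accessible categories. The following are equivalent: (1) $\mathcal A$ is accessibly embedded in $\mathcal K$; (2) $\mathcal A$ is cone-reflective in $\mathcal K$; (3) $\mathcal A$ is virtually reflective in $\mathcal K$.
   Context: Here $\mathcal V=\mathbf{Set}$. $\mathcal A$ is accessibly embedded in $\mathcal K$ if, for some regular cardinal $\alpha$, $\mathcal A$ has $\alpha$-filtered colimits and $J$ preserves them. $\mathcal A$ is cone-reflective in $\mathcal K$ if $J$ satisfies the solution-set condition: for each $X\in\mathcal K$ there is a small family $(h_i\colon X\to JA_i)_{i\in I}$ with $A_i\in\mathcal A$ such that every $h\colon X\to JA$ with $A\in\mathcal A$ factors as $h=J(f)\circ h_i$ for some $i\in I$ and some $f\colon A_i\to A$ in $\mathcal A$. $\mathcal A$ is virtually reflective in $\mathcal K$ if for each $X\in\mathcal K$ the functor $\mathcal K(X,J-)\colon\mathcal A\to\mathbf{Set}$ is small, i.e. a small colimit of representable functors $\mathcal A(A,-)$. *)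

theory Defs
  imports "HOL-Library.FuncSet"
begin

unbundle cardinal_syntax

section \<open>Size\<close>

text \<open>
  The small sets are the sets of a Grothendieck universe, given by a type \<open>'u\<close> whose cardinality
  is strongly inaccessible.  Up to bijection, the small sets are the subsets of \<open>'u\<close> of smaller
  cardinality than \<open>'u\<close>.
\<close>

definition universe :: "'u itself \<Rightarrow> bool" where
  "universe _ \<longleftrightarrow>
     natLeq <o |UNIV :: 'u set| \<and>
     regularCard |UNIV :: 'u set| \<and>
     (\<forall>X :: 'u set. |X| <o |UNIV :: 'u set| \<longrightarrow> |Pow X| <o |UNIV :: 'u set| )"

definition small :: "'u set \<Rightarrow> bool" where
  "small X \<longleftrightarrow> |X| <o |UNIV :: 'u set|"

text \<open>Infinite regular cardinals belonging to the universe.\<close>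

definition regular_cardinal :: "'u rel \<Rightarrow> bool" where
  "regular_cardinal \<alpha> \<longleftrightarrow>
     Card_order \<alpha> \<and> cinfinite \<alpha> \<and> regularCard \<alpha> \<and> \<alpha> <o |UNIV :: 'u set|"


section \<open>Categories and functors\<close>

text \<open>
  Hom-sets need not be disjoint, so composition takes the three objects as arguments:
  \<open>cmp C X Y Z g f\<close> is the composite of \<open>f : X \<rightarrow> Y\<close> and \<open>g : Y \<rightarrow> Z\<close>.  In this way the hom-sets of a
  locally small category can be taken to be small subsets of \<open>'u\<close>, while its objects
  may form a large set.
\<close>

record ('o, 'm) category =
  obj :: "'o set"
  hom :: "'o \<Rightarrow> 'o \<Rightarrow> 'm set"
  idt :: "'o \<Rightarrow> 'm"
  cmp :: "'o \<Rightarrow> 'o \<Rightarrow> 'o \<Rightarrow> 'm \<Rightarrow> 'm \<Rightarrow> 'm"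

definition is_category :: "('o, 'm) category \<Rightarrow> bool" where
  "is_category C \<longleftrightarrow>
     (\<forall>X \<in> obj C. idt C X \<in> hom C X X) \<and>
     (\<forall>X \<in> obj C. \<forall>Y \<in> obj C. \<forall>Z \<in> obj C. \<forall>f \<in> hom C X Y. \<forall>g \<in> hom C Y Z.
        cmp C X Y Z g f \<in> hom C X Z) \<and>
     (\<forall>X \<in> obj C. \<forall>Y \<in> obj C. \<forall>f \<in> hom C X Y.
        cmp C X X Y f (idt C X) = f \<and> cmp C X Y Y (idt C Y) f = f) \<and>
     (\<forall>W \<in> obj C. \<forall>X \<in> obj C. \<forall>Y \<in> obj C. \<forall>Z \<in> obj C.
        \<forall>f \<in> hom C W X. \<forall>g \<in> hom C X Y. \<forall>h \<in> hom C Y Z.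
          cmp C W Y Z h (cmp C W X Y g f) = cmp C W X Z (cmp C X Y Z h g) f)"

definition locally_small :: "('o, 'u) category \<Rightarrow> bool" where
  "locally_small C \<longleftrightarrow> (\<forall>X \<in> obj C. \<forall>Y \<in> obj C. small (hom C X Y))"

text \<open>Up to isomorphism, every small category has its objects and arrows in \<open>'u\<close>.\<close>

definition small_category :: "('u, 'u) category \<Rightarrow> bool" where
  "small_category D \<longleftrightarrow> is_category D \<and> small (obj D) \<and> locally_small D"

definition arrows :: "('o, 'm) category \<Rightarrow> ('o \<times> 'o \<times> 'm) set" where
  "arrows C = {(X, Y, f). X \<in> obj C \<and> Y \<in> obj C \<and> f \<in> hom C X Y}"

definition isomorphic :: "('o, 'm) category \<Rightarrow> 'o \<Rightarrow> 'o \<Rightarrow> bool" where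
  "isomorphic C X Y \<longleftrightarrow>
     X \<in> obj C \<and> Y \<in> obj C \<and>
     (\<exists>f \<in> hom C X Y. \<exists>g \<in> hom C Y X.
        cmp C X Y X g f = idt C X \<and> cmp C Y X Y f g = idt C Y)"

record ('o, 'm, 'p, 'n) funct =
  fobj :: "'o \<Rightarrow> 'p"
  fmap :: "'o \<Rightarrow> 'o \<Rightarrow> 'm \<Rightarrow> 'n"

definition is_functor ::
  "('o, 'm) category \<Rightarrow> ('p, 'n) category \<Rightarrow> ('o, 'm, 'p, 'n) funct \<Rightarrow> bool" where
  "is_functor C D F \<longleftrightarrow>
     (\<forall>X \<in> obj C. fobj F X \<in> obj D) \<and>
     (\<forall>X \<in> obj C. \<forall>Y \<in> obj C. \<forall>f \<in> hom C X Y. fmap F X Y f \<in> hom D (fobj F X) (fobj F Y)) \<and>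
     (\<forall>X \<in> obj C. fmap F X X (idt C X) = idt D (fobj F X)) \<and>
     (\<forall>X \<in> obj C. \<forall>Y \<in> obj C. \<forall>Z \<in> obj C. \<forall>f \<in> hom C X Y. \<forall>g \<in> hom C Y Z.
        fmap F X Z (cmp C X Y Z g f) =
        cmp D (fobj F X) (fobj F Y) (fobj F Z) (fmap F Y Z g) (fmap F X Y f))"

definition comp_functor ::
  "('p, 'n, 'q, 'l) funct \<Rightarrow> ('o, 'm, 'p, 'n) funct \<Rightarrow> ('o, 'm, 'q, 'l) funct" where
  "comp_functor G F =
     \<lparr>fobj = (\<lambda>X. fobj G (fobj F X)),
      fmap = (\<lambda>X Y f. fmap G (fobj F X) (fobj F Y) (fmap F X Y f))\<rparr>"

definition fully_faithful ::
  "('o, 'm) category \<Rightarrow> ('p, 'n) category \<Rightarrow> ('o, 'm, 'p, 'n) funct \<Rightarrow> bool" where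
  "fully_faithful C D F \<longleftrightarrow>
     (\<forall>X \<in> obj C. \<forall>Y \<in> obj C.
        bij_betw (fmap F X Y) (hom C X Y) (hom D (fobj F X) (fobj F Y)))"

text \<open>Natural transformations are made extensional, so that equal components give equal arrows.\<close>

definition functor_category ::
  "('o, 'm) category \<Rightarrow> ('p, 'n) category \<Rightarrow>
   (('o, 'm, 'p, 'n) funct, 'o \<Rightarrow> 'n) category" where
  "functor_category C D =
     \<lparr>obj = {F. is_functor C D F},
      hom = (\<lambda>F G. {\<eta> \<in> (\<Pi>\<^sub>E X \<in> obj C. hom D (fobj F X) (fobj G X)).
               \<forall>X \<in> obj C. \<forall>Y \<in> obj C. \<forall>f \<in> hom C X Y.
                 cmp D (fobj F X) (fobj G X) (fobj G Y) (fmap G X Y f) (\<eta> X) =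
                 cmp D (fobj F X) (fobj F Y) (fobj G Y) (\<eta> Y) (fmap F X Y f)}),
      idt = (\<lambda>F. \<lambda>X \<in> obj C. idt D (fobj F X)),
      cmp = (\<lambda>F G H \<theta> \<eta>. \<lambda>X \<in> obj C. cmp D (fobj F X) (fobj G X) (fobj H X) (\<theta> X) (\<eta> X))\<rparr>"

text \<open>The category of small sets and functions.\<close>

definition Set :: "('u set, 'u \<Rightarrow> 'u) category" where
  "Set =
     \<lparr>obj = {X. small X},
      hom = (\<lambda>X Y. X \<rightarrow>\<^sub>E Y),
      idt = (\<lambda>X. \<lambda>x \<in> X. x),
      cmp = (\<lambda>X Y Z g f. compose X g f)\<rparr>"

text \<open>The covariant representable functor \<open>C(X, -)\<close>.\<close>

definition hom_functor ::
  "('o, 'u) category \<Rightarrow> 'o \<Rightarrow> ('o, 'u, 'u set, 'u \<Rightarrow> 'u) funct" where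
  "hom_functor C X =
     \<lparr>fobj = (\<lambda>Y. hom C X Y),
      fmap = (\<lambda>Y Z g. \<lambda>f \<in> hom C X Y. cmp C X Y Z g f)\<rparr>"


section \<open>Colimits\<close>

definition is_cocone ::
  "('i, 'j) category \<Rightarrow> ('o, 'm) category \<Rightarrow> ('i, 'j, 'o, 'm) funct \<Rightarrow>
   'o \<Rightarrow> ('i \<Rightarrow> 'm) \<Rightarrow> bool" where
  "is_cocone D C F Z c \<longleftrightarrow>
     Z \<in> obj C \<and>
     (\<forall>i \<in> obj D. c i \<in> hom C (fobj F i) Z) \<and>
     (\<forall>i \<in> obj D. \<forall>j \<in> obj D. \<forall>u \<in> hom D i j.
        cmp C (fobj F i) (fobj F j) Z (c j) (fmap F i j u) = c i)"

definition is_colimit ::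
  "('i, 'j) category \<Rightarrow> ('o, 'm) category \<Rightarrow> ('i, 'j, 'o, 'm) funct \<Rightarrow>
   'o \<Rightarrow> ('i \<Rightarrow> 'm) \<Rightarrow> bool" where
  "is_colimit D C F Z c \<longleftrightarrow>
     is_cocone D C F Z c \<and>
     (\<forall>W e. is_cocone D C F W e \<longrightarrow>
        (\<exists>!u. u \<in> hom C Z W \<and> (\<forall>i \<in> obj D. cmp C (fobj F i) Z W u (c i) = e i)))"

text \<open>
  A category is \<open>\<alpha>\<close>-filtered if every diagram in it with fewer than \<open>\<alpha>\<close> arrows has a cocone.
\<close>

definition filtered :: "'u rel \<Rightarrow> ('u, 'u) category \<Rightarrow> bool" where
  "filtered \<alpha> D \<longleftrightarrow>
     (\<forall>(S :: ('u, 'u) category) F.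
        is_category S \<and> |arrows S| <o \<alpha> \<and> is_functor S D F \<longrightarrow>
        (\<exists>Z c. is_cocone S D F Z c))"

definition has_filtered_colimits :: "'u rel \<Rightarrow> ('o, 'm) category \<Rightarrow> bool" where
  "has_filtered_colimits \<alpha> C \<longleftrightarrow>
     (\<forall>(D :: ('u, 'u) category) F.
        small_category D \<and> filtered \<alpha> D \<and> is_functor D C F \<longrightarrow>
        (\<exists>Z c. is_colimit D C F Z c))"

definition preserves_filtered_colimits ::
  "'u rel \<Rightarrow> ('o, 'm) category \<Rightarrow> ('p, 'n) category \<Rightarrow> ('o, 'm, 'p, 'n) funct \<Rightarrow> bool" where
  "preserves_filtered_colimits \<alpha> C C' G \<longleftrightarrow>
     (\<forall>(D :: ('u, 'u) category) F Z c.
        small_category D \<and> filtered \<alpha> D \<and> is_functor D C F \<and> is_colimit D C F Z c \<longrightarrow>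
        is_colimit D C' (comp_functor G F) (fobj G Z) (\<lambda>i. fmap G (fobj F i) Z (c i)))"


section \<open>Accessible categories\<close>

definition presentable :: "'u rel \<Rightarrow> ('o, 'u) category \<Rightarrow> 'o \<Rightarrow> bool" where
  "presentable \<alpha> C X \<longleftrightarrow>
     X \<in> obj C \<and> preserves_filtered_colimits \<alpha> C Set (hom_functor C X)"

text \<open>
  The family \<open>P\<close> enumerates the small set of \<open>\<alpha>\<close>-presentable objects that generates \<open>C\<close> under
  \<open>\<alpha>\<close>-filtered colimits.
\<close>

definition accessible_for :: "'u rel \<Rightarrow> ('o, 'u) category \<Rightarrow> bool" where
  "accessible_for \<alpha> C \<longleftrightarrow>
     has_filtered_colimits \<alpha> C \<and>
     (\<exists>(I :: 'u set) (P :: 'u \<Rightarrow> 'o).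
        small I \<and> (\<forall>i \<in> I. presentable \<alpha> C (P i)) \<and>
        (\<forall>X \<in> obj C. \<exists>(D :: ('u, 'u) category) F c.
           small_category D \<and> filtered \<alpha> D \<and> is_functor D C F \<and>
           (\<forall>d \<in> obj D. fobj F d \<in> P ` I) \<and> is_colimit D C F X c))"

definition accessible :: "('o, 'u) category \<Rightarrow> bool" where
  "accessible C \<longleftrightarrow>
     is_category C \<and> locally_small C \<and>
     (\<exists>\<alpha> :: 'u rel. regular_cardinal \<alpha> \<and> accessible_for \<alpha> C)"


section \<open>Small functors and conditions on an embedding\<close>

definition representable ::
  "('o, 'u) category \<Rightarrow> ('o, 'u, 'u set, 'u \<Rightarrow> 'u) funct \<Rightarrow> bool" where
  "representable C F \<longleftrightarrow>
     (\<exists>X \<in> obj C. isomorphic (functor_category C Set) (hom_functor C X) F)"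

definition small_functor ::
  "('o, 'u) category \<Rightarrow> ('o, 'u, 'u set, 'u \<Rightarrow> 'u) funct \<Rightarrow> bool" where
  "small_functor C F \<longleftrightarrow>
     (\<exists>(D :: ('u, 'u) category) H c.
        small_category D \<and> is_functor D (functor_category C Set) H \<and>
        (\<forall>d \<in> obj D. representable C (fobj H d)) \<and>
        is_colimit D (functor_category C Set) H F c)"

definition accessibly_embedded ::
  "('a, 'u) category \<Rightarrow> ('k, 'u) category \<Rightarrow> ('a, 'u, 'k, 'u) funct \<Rightarrow> bool" where
  "accessibly_embedded A K J \<longleftrightarrow>
     (\<exists>\<alpha> :: 'u rel. regular_cardinal \<alpha> \<and>
        has_filtered_colimits \<alpha> A \<and> preserves_filtered_colimits \<alpha> A K J)"

definition cone_reflective ::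
  "('a, 'u) category \<Rightarrow> ('k, 'u) category \<Rightarrow> ('a, 'u, 'k, 'u) funct \<Rightarrow> bool" where
  "cone_reflective A K J \<longleftrightarrow>
     (\<forall>X \<in> obj K. \<exists>(I :: 'u set) (B :: 'u \<Rightarrow> 'a) (h :: 'u \<Rightarrow> 'u).
        small I \<and>
        (\<forall>i \<in> I. B i \<in> obj A \<and> h i \<in> hom K X (fobj J (B i))) \<and>
        (\<forall>A' \<in> obj A. \<forall>k \<in> hom K X (fobj J A').
           \<exists>i \<in> I. \<exists>f \<in> hom A (B i) A'.
             k = cmp K X (fobj J (B i)) (fobj J A') (fmap J (B i) A' f) (h i)))"

definition virtually_reflective ::
  "('a, 'u) category \<Rightarrow> ('k, 'u) category \<Rightarrow> ('a, 'u, 'k, 'u) funct \<Rightarrow> bool" where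
  "virtually_reflective A K J \<longleftrightarrow>
     (\<forall>X \<in> obj K. small_functor A (comp_functor (hom_functor K X) J))"

end

theory Submission
  imports Defs
begin

text \<open>
  Raising the index of accessibility writes every object of an accessible category as a highly
  filtered colimit of objects from a fixed small set, while each single object is presentable for
  all large indices.  Hence an accessible \<open>J\<close> satisfies the solution-set condition: a map
  \<open>X \<rightarrow> J A'\<close> factors through \<open>J\<close> of one of these objects.

  The converse directions rest on a presentation of \<open>K(X, J-)\<close>.  A solution set for \<open>X\<close> covers
  \<open>K(X, J-)\<close> by a small sum of representables.  The relations between two of its members are cocones
  with vertex in the image of \<open>J\<close> on a span in \<open>K\<close>.  An accessible category has small weak
  multi-pushouts, so these relations are covered by a small set as well.  This makes \<open>K(X, J-)\<close> a
  small functor.  It also makes \<open>K(X, J-)\<close> preserve \<open>\<mu>\<close>-filtered colimits for large \<open>\<mu>\<close>; letting \<open>X\<close> run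
  through the small set of generators of \<open>K\<close>, so does \<open>J\<close>.
\<close>

section \<open>Small sets\<close>

text \<open>The obstacle behind the shape of the proof is that the index of an accessible category
  cannot be raised to an arbitrary larger regular cardinal. It is raised only to the successor of
  \<open>|N|\<close> with \<open>|N| ^c \<alpha> \<le>o |N|\<close>, a condition that power sets
  supply. A set of size at most \<open>|N|\<close> then has at most \<open>|N|\<close> subsets of
  size below \<alpha>, so a part of that size of an \<alpha>-filtered diagram closes up to an
  \<alpha>-filtered part without growing. Presentability is used only through its elementary
  content, \<open>hom_preserves\<close>: a map into the colimit factors through a stage, and two
  maps that agree in the colimit agree at a later stage. The order of the choices matters: ranks of
  presentability vary with the object. An index is therefore fixed only after the finitely many
  objects, or the small set of objects, to which it has to apply. For the preservation of colimits
  this means that solution sets and relations come first and the index last.\<close>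

definition usmall :: "'u itself \<Rightarrow> 'x set \<Rightarrow> bool" where
  "usmall _ X \<longleftrightarrow> |X| <o |UNIV :: 'u set|"

lemma small_iff_usmall: "small (X :: 'u set) \<longleftrightarrow> usmall (U :: 'u itself) X"
  by (simp add: small_def usmall_def)

lemma usmall_ordLeq: "usmall U X \<Longrightarrow> |Y| \<le>o |X| \<Longrightarrow> usmall U Y"
  unfolding usmall_def using ordLeq_ordLess_trans by blast

lemma usmall_subset: "usmall U X \<Longrightarrow> Y \<subseteq> X \<Longrightarrow> usmall U Y"
  by (rule usmall_ordLeq[OF _ card_of_mono1])

lemma usmall_image: "usmall U X \<Longrightarrow> usmall U (f ` X)"
  by (rule usmall_ordLeq[OF _ card_of_image])

text \<open>The definitions index small families by subsets of \<open>'u\<close>. This is the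
  passage from a small set of arbitrary type to such an index set.\<close>

lemma usmall_enum:
  fixes U :: "'u itself" and X :: "'x set"
  assumes "usmall U X"
  obtains I :: "'u set" and e where "small I" "bij_betw e I X"
proof -
  have "|X| \<le>o |UNIV :: 'u set|"
    using assms unfolding usmall_def by (rule ordLess_imp_ordLeq)
  then obtain f :: "'x \<Rightarrow> 'u" where f: "inj_on f X"
    using card_of_ordLeq[of X "UNIV :: 'u set"] by blast
  have "small (f ` X)"
    unfolding small_iff_usmall[where U = U] by (rule usmall_image[OF assms])
  moreover have "bij_betw (inv_into X f) (f ` X) X"
    using f by (simp add: bij_betw_inv_into inj_on_imp_bij_betw)
  ultimately show ?thesis using that by blast
qed

lemma usmall_embed:
  fixes U :: "'u itself" and X :: "'x set"
  assumes "usmall U X"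
  obtains e :: "'x \<Rightarrow> 'u" where "inj_on e X"
proof -
  have "|X| \<le>o |UNIV :: 'u set|"
    using assms unfolding usmall_def by (rule ordLess_imp_ordLeq)
  then show ?thesis
    using card_of_ordLeq[of X "UNIV :: 'u set"] that by blast
qed

lemma Cinfinite_card_of: "infinite N \<Longrightarrow> Cinfinite |N|"
  by (simp add: cinfinite_def Field_card_of card_of_card_order_on)

lemma finite_ordLess_Cinfinite: "finite Y \<Longrightarrow> Cinfinite r \<Longrightarrow> |Y| <o r"
  by (rule Cfinite_ordLess_Cinfinite) (simp_all add: cfinite_def Field_card_of card_of_card_order_on)

locale grothendieck =
  fixes U :: "'u itself"
  assumes universe: "universe U"
begin

lemmas small_usmall = small_iff_usmall[where U = U]

lemma Cinfinite_UNIV: "Cinfinite |UNIV :: 'u set|"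
proof -
  have "natLeq <o |UNIV :: 'u set|" using universe by (simp add: universe_def)
  then have "cinfinite |UNIV :: 'u set|"
    using cinfinite_mono[OF ordLess_imp_ordLeq] natLeq_cinfinite by blast
  then show ?thesis using card_of_Card_order by blast
qed

lemma usmall_finite: "finite X \<Longrightarrow> usmall U X"
  unfolding usmall_def by (rule finite_ordLess_Cinfinite[OF _ Cinfinite_UNIV])

lemma stable_UNIV: "stable |UNIV :: 'u set|"
proof (rule regularCard_stable)
  show "Card_order |UNIV :: 'u set|" by (rule card_of_Card_order)
  show "infinite (Field |UNIV :: 'u set| )" using Cinfinite_UNIV by (simp add: cinfinite_def)
  show "regularCard |UNIV :: 'u set|" using universe by (simp add: universe_def)
qed

lemma usmall_UN: "usmall U I \<Longrightarrow> (\<And>i. i \<in> I \<Longrightarrow> usmall U (A i)) \<Longrightarrow> usmall U (\<Union>i\<in>I. A i)"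
  unfolding usmall_def by (rule stable_UNION[OF stable_UNIV])

lemma usmall_Sigma: "usmall U I \<Longrightarrow> (\<And>i. i \<in> I \<Longrightarrow> usmall U (A i)) \<Longrightarrow> usmall U (Sigma I A)"
  unfolding usmall_def by (rule stable_elim[OF stable_UNIV])

lemma usmall_Un: "usmall U A \<Longrightarrow> usmall U B \<Longrightarrow> usmall U (A \<union> B)"
  unfolding usmall_def using Un_Cinfinite_bound_strict[OF _ _ Cinfinite_UNIV] by blast

lemma usmall_Plus:
  assumes "usmall U A" "usmall U B"
  shows "usmall U (A <+> B)"
  unfolding Plus_def using assms by (simp add: usmall_Un usmall_image)

lemma usmall_Pow:
  assumes "usmall U X"
  shows "usmall U (Pow X)"
proof -
  obtain I :: "'u set" and e where I: "small I" and e: "bij_betw e I X"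
    using usmall_enum[OF assms] by blast
  have "Pow X = image e ` Pow I"
    using e by (metis bij_betw_imp_surj_on image_Pow_surj)
  moreover have "usmall U (Pow I)"
    using I universe unfolding usmall_def small_def universe_def by blast
  ultimately show ?thesis by (simp add: usmall_image)
qed

lemma usmall_same_card:
  assumes "usmall U X"
  obtains Y :: "'u set" where "small Y" "|Y| =o |X|"
  using usmall_enum[OF assms] card_of_ordIsoI by metis

text \<open>The summand of natural numbers makes \<open>N\<close> infinite, as the cardinal
  arithmetic with \<open>|N|\<close> requires; it is small because the universe is uncountable.
  Several bounds are met at once by applying this to their disjoint sum.\<close>

lemma usmall_bound:
  assumes "usmall U X"
  obtains N :: "'u set" where "small N" "infinite N" "|X| \<le>o |N|"
proof -
  have "natLeq <o |UNIV :: 'u set|" using universe by (simp add: universe_def)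
  then have "usmall U (UNIV :: nat set)"
    unfolding usmall_def using card_of_nat ordIso_ordLess_trans by blast
  then have "usmall U ((UNIV :: nat set) <+> X)" using assms by (rule usmall_Plus)
  then obtain N :: "'u set" where N: "small N" "|N| =o |(UNIV :: nat set) <+> X|"
    by (rule usmall_same_card)
  have "infinite ((UNIV :: nat set) <+> X)" by simp
  then have "infinite N" using N(2) card_of_ordIso_finite by blast
  moreover have "|X| \<le>o |N|"
    using card_of_Plus2 ordIso_symmetric[OF N(2)] ordLeq_ordIso_trans by blast
  ultimately show ?thesis using that N(1) by blast
qed

end

lemma choice_on1:
  assumes "\<And>x. P x \<Longrightarrow> \<exists>y. R x y"
  obtains f where "\<forall>x. P x \<longrightarrow> R x (f x)"
  using assms by metis

lemma choice_on2:
  assumes "\<And>x. P x \<Longrightarrow> \<exists>y z. R x y z"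
  obtains f g where "\<forall>x. P x \<longrightarrow> R x (f x) (g x)"
  using assms by metis

lemma choice_on3:
  assumes "\<And>x. P x \<Longrightarrow> \<exists>y z w. R x y z w"
  obtains f g h where "\<forall>x. P x \<longrightarrow> R x (f x) (g x) (h x)"
  using assms by metis

section \<open>Categories\<close>

lemma idt_in: "is_category C \<Longrightarrow> X \<in> obj C \<Longrightarrow> idt C X \<in> hom C X X"
  by (simp add: is_category_def)

lemma cmp_in:
  "is_category C \<Longrightarrow> f \<in> hom C X Y \<Longrightarrow> g \<in> hom C Y Z \<Longrightarrow>
    X \<in> obj C \<Longrightarrow> Y \<in> obj C \<Longrightarrow> Z \<in> obj C \<Longrightarrow> cmp C X Y Z g f \<in> hom C X Z"
  by (simp add: is_category_def)

lemma cmp_idt: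
  "is_category C \<Longrightarrow> f \<in> hom C X Y \<Longrightarrow> X \<in> obj C \<Longrightarrow> Y \<in> obj C \<Longrightarrow> cmp C X X Y f (idt C X) = f"
  by (simp add: is_category_def)

lemma idt_cmp:
  "is_category C \<Longrightarrow> f \<in> hom C X Y \<Longrightarrow> X \<in> obj C \<Longrightarrow> Y \<in> obj C \<Longrightarrow> cmp C X Y Y (idt C Y) f = f"
  by (simp add: is_category_def)

lemma cmp_assoc:
  "is_category C \<Longrightarrow> f \<in> hom C W X \<Longrightarrow> g \<in> hom C X Y \<Longrightarrow> h \<in> hom C Y Z \<Longrightarrow>
    W \<in> obj C \<Longrightarrow> X \<in> obj C \<Longrightarrow> Y \<in> obj C \<Longrightarrow> Z \<in> obj C \<Longrightarrow>
    cmp C W X Z (cmp C X Y Z h g) f = cmp C W Y Z h (cmp C W X Y g f)"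
  by (simp add: is_category_def)

text \<open>Transport of a map \<open>X \<rightarrow> F d\<close> along an arrow of the index
  category. With \<open>J\<close> in place of \<open>F\<close> it is the action of an arrow of
  \<open>A\<close> on the elements of \<open>K(X, J-)\<close>.\<close>

abbreviation act ::
  "('p, 'n) category \<Rightarrow> ('o, 'm, 'p, 'n) funct \<Rightarrow> 'p \<Rightarrow> 'o \<Rightarrow> 'o \<Rightarrow> 'm \<Rightarrow> 'n \<Rightarrow> 'n" where
  "act C F X d e p \<equiv> cmp C X (fobj F d) (fobj F e) (fmap F d e p)"

lemma fobj_in: "is_functor C D F \<Longrightarrow> X \<in> obj C \<Longrightarrow> fobj F X \<in> obj D"
  by (simp add: is_functor_def)

lemma fmap_in:
  "is_functor C D F \<Longrightarrow> f \<in> hom C X Y \<Longrightarrow> X \<in> obj C \<Longrightarrow> Y \<in> obj C \<Longrightarrow>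
    fmap F X Y f \<in> hom D (fobj F X) (fobj F Y)"
  by (simp add: is_functor_def)

lemma fmap_idt:
  "is_functor C D F \<Longrightarrow> X \<in> obj C \<Longrightarrow> fmap F X X (idt C X) = idt D (fobj F X)"
  by (simp add: is_functor_def)

lemma fmap_cmp:
  "is_functor C D F \<Longrightarrow> f \<in> hom C X Y \<Longrightarrow> g \<in> hom C Y Z \<Longrightarrow>
    X \<in> obj C \<Longrightarrow> Y \<in> obj C \<Longrightarrow> Z \<in> obj C \<Longrightarrow>
    fmap F X Z (cmp C X Y Z g f) =
      act D F (fobj F X) Y Z g (fmap F X Y f)"
  by (simp add: is_functor_def)

lemma comp_functor_simps [simp]:
  "fobj (comp_functor G F) X = fobj G (fobj F X)"
  "fmap (comp_functor G F) X Y f = fmap G (fobj F X) (fobj F Y) (fmap F X Y f)"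
  by (simp_all add: comp_functor_def)

lemma is_functor_comp:
  assumes "is_functor C D F" "is_functor D E G"
  shows "is_functor C E (comp_functor G F)"
  using assms unfolding is_functor_def by simp

lemma small_categoryD:
  assumes "small_category D"
  shows "is_category D" "small (obj D)" "X \<in> obj D \<Longrightarrow> Y \<in> obj D \<Longrightarrow> small (hom D X Y)"
  using assms by (simp_all add: small_category_def locally_small_def)

lemma colimit_objD: "is_colimit D C F Z c \<Longrightarrow> Z \<in> obj C"
  by (simp add: is_colimit_def is_cocone_def)

lemma cocone_inD: "is_cocone D C F Z c \<Longrightarrow> d \<in> obj D \<Longrightarrow> c d \<in> hom C (fobj F d) Z"
  by (simp add: is_cocone_def)

lemma cocone_natD:
  "is_cocone D C F Z c \<Longrightarrow> u \<in> hom D d d' \<Longrightarrow> d \<in> obj D \<Longrightarrow> d' \<in> obj D \<Longrightarrow>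
    cmp C (fobj F d) (fobj F d') Z (c d') (fmap F d d' u) = c d"
  by (simp add: is_cocone_def)

lemma colimit_coconeD: "is_colimit D C F Z c \<Longrightarrow> is_cocone D C F Z c"
  by (simp add: is_colimit_def)

lemma colimit_map:
  assumes "is_colimit D C F Z c" "is_cocone D C F W e"
  obtains u where "u \<in> hom C Z W" "\<And>d. d \<in> obj D \<Longrightarrow> cmp C (fobj F d) Z W u (c d) = e d"
  using assms unfolding is_colimit_def by blast

lemma colimit_eqI:
  assumes C: "is_category C" and F: "is_functor D C F"
    and Z: "is_colimit D C F Z c" and W: "W \<in> obj C"
    and u: "u \<in> hom C Z W" and v: "v \<in> hom C Z W"
    and eq: "\<And>d. d \<in> obj D \<Longrightarrow> cmp C (fobj F d) Z W u (c d) = cmp C (fobj F d) Z W v (c d)"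
  shows "u = v"
proof -
  let ?e = "\<lambda>d. cmp C (fobj F d) Z W v (c d)"
  note c = colimit_coconeD[OF Z] and ZC = colimit_objD[OF Z]
  have "is_cocone D C F W ?e"
    unfolding is_cocone_def
  proof (intro conjI ballI)
    show "W \<in> obj C" by (rule W)
    fix d assume d: "d \<in> obj D"
    note Fd = fobj_in[OF F d]
    show "?e d \<in> hom C (fobj F d) W"
      by (rule cmp_in[OF C cocone_inD[OF c d] v Fd ZC W])
    fix d' h assume d': "d' \<in> obj D" and h: "h \<in> hom D d d'"
    note Fd' = fobj_in[OF F d']
    have "cmp C (fobj F d) (fobj F d') W (?e d') (fmap F d d' h) =
      cmp C (fobj F d) Z W v (cmp C (fobj F d) (fobj F d') Z (c d') (fmap F d d' h))"
      by (rule cmp_assoc[OF C fmap_in[OF F h d d'] cocone_inD[OF c d'] v Fd Fd' ZC W])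
    then show "cmp C (fobj F d) (fobj F d') W (?e d') (fmap F d d' h) = ?e d"
      by (simp add: cocone_natD[OF c h d d'])
  qed
  then have "\<exists>!u. u \<in> hom C Z W \<and> (\<forall>d \<in> obj D. cmp C (fobj F d) Z W u (c d) = ?e d)"
    using Z unfolding is_colimit_def by blast
  then show ?thesis using u v eq by blast
qed

section \<open>Filtered categories\<close>

text \<open>A mere set of arrows, closed neither under composition nor under identities, is easier
  to count and to enlarge than a diagram. An object counts only as an end of an arrow; to force a
  leg at an object, its identity is put into \<open>Y\<close>.\<close>

definition graph_cocone ::
  "('i, 'j) category \<Rightarrow> ('i \<times> 'i \<times> 'j) set \<Rightarrow> 'i \<Rightarrow> ('i \<Rightarrow> 'j) \<Rightarrow> bool" where
  "graph_cocone D Y z c \<longleftrightarrow> z \<in> obj D \<and>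
     (\<forall>(s, t, f) \<in> Y. c s \<in> hom D s z \<and> c t \<in> hom D t z \<and> cmp D s t z (c t) f = c s)"

text \<open>For infinite \<open>N\<close> this is filteredness for the successor of
  \<open>|N|\<close>. Stated with \<le> and a bounding set, it does not mention the successor, and
  bounds can be combined as sets.\<close>

definition le_filtered :: "'n set \<Rightarrow> ('i, 'j) category \<Rightarrow> bool" where
  "le_filtered N D \<longleftrightarrow> (\<forall>Y \<subseteq> arrows D. |Y| \<le>o |N| \<longrightarrow> (\<exists>z c. graph_cocone D Y z c))"

lemma graph_coconeD:
  assumes "graph_cocone D Y z c" "(s, t, f) \<in> Y"
  shows "c s \<in> hom D s z" "c t \<in> hom D t z" "cmp D s t z (c t) f = c s"
  using assms by (auto simp: graph_cocone_def)

abbreviation colimit_from ::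
  "(('u, 'u) category \<Rightarrow> bool) \<Rightarrow> ('o, 'u) category \<Rightarrow> 'o set \<Rightarrow> 'o \<Rightarrow> bool" where
  "colimit_from \<Phi> C Q X \<equiv> \<exists>(D :: ('u, 'u) category) F c. small_category D \<and> \<Phi> D \<and>
     is_functor D C F \<and> (\<forall>d \<in> obj D. fobj F d \<in> Q) \<and> is_colimit D C F X c"

text \<open>The arrows in the image of a diagram form a graph with no more arrows than the diagram,
  and a cocone on that graph pulls back along \<open>F\<close>.\<close>

lemma filteredI:
  fixes D :: "('u, 'u) category"
  assumes "\<And>Y. Y \<subseteq> arrows D \<Longrightarrow> |Y| <o \<alpha> \<Longrightarrow> \<exists>z c. graph_cocone D Y z c"
  shows "filtered \<alpha> D"
  unfolding filtered_def
proof (intro allI impI, elim conjE)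
  fix S :: "('u, 'u) category" and F
  assume S: "is_category S" and card: "|arrows S| <o \<alpha>" and F: "is_functor S D F"
  let ?Y = "(\<lambda>(s, t, f). (fobj F s, fobj F t, fmap F s t f)) ` arrows S"
  have "?Y \<subseteq> arrows D"
    using F by (auto simp: arrows_def is_functor_def)
  moreover have "|?Y| <o \<alpha>"
    using card card_of_image ordLeq_ordLess_trans by blast
  ultimately obtain z c where zc: "graph_cocone D ?Y z c" using assms by blast
  have "is_cocone S D F z (\<lambda>s. c (fobj F s))"
    unfolding is_cocone_def
  proof (intro conjI ballI)
    show "z \<in> obj D" using zc by (simp add: graph_cocone_def)
    fix s assume s: "s \<in> obj S"
    then have "(s, s, idt S s) \<in> arrows S" using idt_in[OF S] by (simp add: arrows_def)
    then have "(fobj F s, fobj F s, fmap F s s (idt S s)) \<in> ?Y" by force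
    then show "c (fobj F s) \<in> hom D (fobj F s) z" by (rule graph_coconeD[OF zc])
    fix t f assume "t \<in> obj S" "f \<in> hom S s t"
    then have "(s, t, f) \<in> arrows S" using s by (simp add: arrows_def)
    then have "(fobj F s, fobj F t, fmap F s t f) \<in> ?Y" by force
    then show "cmp D (fobj F s) (fobj F t) z (c (fobj F t)) (fmap F s t f) = c (fobj F s)"
      by (rule graph_coconeD[OF zc])
  qed
  then show "\<exists>z c. is_cocone S D F z c" by blast
qed

lemma filtered_mono:
  "filtered \<beta> D \<Longrightarrow> \<alpha> \<le>o \<beta> \<Longrightarrow> filtered \<alpha> D"
  unfolding filtered_def using ordLess_ordLeq_trans by blast

lemma le_filtered_filtered:
  fixes D :: "('u, 'u) category"
  assumes "le_filtered N D" "\<alpha> \<le>o |N|"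
  shows "filtered \<alpha> D"
proof (rule filteredI)
  fix Y assume "Y \<subseteq> arrows D" "|Y| <o \<alpha>"
  then show "\<exists>z c. graph_cocone D Y z c"
    using assms ordLess_imp_ordLeq ordLess_ordLeq_trans unfolding le_filtered_def by blast
qed

text \<open>
  The diagram \<open>S\<close> of the proof is the subdivision of the graph \<open>Y\<close>: every edge becomes a span, so that
  no new composites arise and \<open>S\<close> has fewer than \<open>\<alpha>\<close> arrows.
\<close>

lemma (in grothendieck) filtered_graph_cocone:
  fixes D :: "('u, 'u) category"
  assumes D: "is_category D" and filt: "filtered \<alpha> D" and \<alpha>: "regular_cardinal \<alpha>"
    and Y: "Y \<subseteq> arrows D" "|Y| <o \<alpha>"
  shows "\<exists>z c. graph_cocone D Y z c"
proof -
  have C\<alpha>: "Cinfinite \<alpha>" using \<alpha> by (simp add: regular_cardinal_def)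
  have Y_img: "|f ` Y| <o \<alpha>" for f :: "'u \<times> 'u \<times> 'u \<Rightarrow> 'x"
    using Y(2) card_of_image ordLeq_ordLess_trans by blast
  define V where "V = fst ` Y \<union> (fst \<circ> snd) ` Y"
  have V: "|V| <o \<alpha>"
    unfolding V_def by (rule Un_Cinfinite_bound_strict[OF Y_img Y_img C\<alpha>])
  have YD: "s \<in> obj D" "t \<in> obj D" "f \<in> hom D s t" if "(s, t, f) \<in> Y" for s t f
    using that Y(1) by (auto simp: arrows_def)
  have VD: "V \<subseteq> obj D" using Y(1) by (auto simp: V_def arrows_def)
  have "usmall U V" "usmall U Y"
    using V Y(2) \<alpha> ordLess_transitive unfolding usmall_def regular_cardinal_def by blast+
  then have "usmall U (V <+> Y)" by (rule usmall_Plus)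
  then obtain e :: "'u + 'u \<times> 'u \<times> 'u \<Rightarrow> 'u" where e: "inj_on e (V <+> Y)"
    using usmall_embed by metis
  define dec where "dec = inv_into (V <+> Y) e"
  have dec [simp]: "v \<in> V \<Longrightarrow> dec (e (Inl v)) = Inl v" "y \<in> Y \<Longrightarrow> dec (e (Inr y)) = Inr y" for v y
    using inv_into_f_f[OF e InlI] inv_into_f_f[OF e InrI] by (simp_all add: dec_def)
  define ob where "ob x = (case x of Inl v \<Rightarrow> v | Inr y \<Rightarrow> fst y)" for x :: "'u + 'u \<times> 'u \<times> 'u"
  \<comment> \<open>Besides identities there are only the two legs of the span at an edge
    \<open>(s, t, f)\<close>: \<open>idt D s\<close> to the vertex \<open>s\<close> and
    \<open>f\<close> to the vertex \<open>t\<close>. The edge object lies over \<open>s\<close>. For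
    a loop both legs have the same target, hence a set described by a disjunction.\<close>
  define hm where "hm x x' =
      (if x = x' then {idt D (ob x)} else
        case x of Inl v \<Rightarrow> {} | Inr (s, t, f) \<Rightarrow>
          (case x' of Inr _ \<Rightarrow> {} | Inl v \<Rightarrow> {g. (v = s \<and> g = idt D s) \<or> (v = t \<and> g = f)}))"
    for x x' :: "'u + 'u \<times> 'u \<times> 'u"
  define S :: "('u, 'u) category" where
    "S = \<lparr>obj = e ` (V <+> Y), hom = (\<lambda>x x'. hm (dec x) (dec x')),
          idt = (\<lambda>x. idt D (ob (dec x))),
          cmp = (\<lambda>x y z. cmp D (ob (dec x)) (ob (dec y)) (ob (dec z)))\<rparr>"
  have S_simps: "obj S = e ` (V <+> Y)" "hom S x x' = hm (dec x) (dec x')"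
    "idt S x = idt D (ob (dec x))"
    "cmp S x y z = cmp D (ob (dec x)) (ob (dec y)) (ob (dec z))" for x x' y z
    by (simp_all add: S_def)
  have dec_in: "dec x \<in> V <+> Y" if "x \<in> obj S" for x
    using that by (auto simp: S_simps)
  have ob_in: "ob x \<in> obj D" if "x \<in> V <+> Y" for x
    using that VD Y(1) by (auto simp: ob_def arrows_def)
  have hm_in: "f \<in> hom D (ob x) (ob x')" if "f \<in> hm x x'" "x \<in> V <+> Y" "x' \<in> V <+> Y" for f x x'
    using that VD YD idt_in[OF D]
    by (auto simp: hm_def ob_def split: if_splits sum.splits)
  have hm_cmp: "cmp D (ob x) (ob y) (ob z) g f \<in> hm x z"
    if "f \<in> hm x y" "g \<in> hm y z" "x \<in> V <+> Y" "y \<in> V <+> Y" "z \<in> V <+> Y" for f g x y z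
  proof (cases "x = y")
    case True
    then have "f = idt D (ob y)" using that(1) by (simp add: hm_def)
    then show ?thesis using that True cmp_idt[OF D hm_in[OF that(2,4,5)]] ob_in by simp
  next
    case False
    \<comment> \<open>A leg ends in a vertex, and only the identity leaves a vertex, so two legs
      never compose.\<close>
    have "\<exists>v. y = Inl v" using that(1) False by (cases x; cases y) (auto simp: hm_def)
    then obtain v where "y = Inl v" ..
    then have "y = z" "g = idt D (ob y)"
      using that(2) by (auto simp: hm_def split: if_splits)
    then show ?thesis using that idt_cmp[OF D hm_in[OF that(1,3,4)]] ob_in by simp
  qed
  have S: "is_category S"
    unfolding is_category_def
  proof (intro conjI ballI)
    show "idt S x \<in> hom S x x" for x by (simp add: S_simps hm_def)
    show "cmp S x y z g f \<in> hom S x z"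
      if "x \<in> obj S" "y \<in> obj S" "z \<in> obj S" "f \<in> hom S x y" "g \<in> hom S y z" for x y z f g
      using that hm_cmp dec_in by (simp add: S_simps(2-))
    show "cmp S x x y f (idt S x) = f" "cmp S x y y (idt S y) f = f"
      if "x \<in> obj S" "y \<in> obj S" "f \<in> hom S x y" for x y f
      using that hm_in dec_in ob_in cmp_idt[OF D] idt_cmp[OF D] by (simp_all add: S_simps(2-))
    show "cmp S w y z h (cmp S w x y g f) = cmp S w x z (cmp S x y z h g) f"
      if "w \<in> obj S" "x \<in> obj S" "y \<in> obj S" "z \<in> obj S"
        "f \<in> hom S w x" "g \<in> hom S x y" "h \<in> hom S y z" for w x y z f g h
      using that hm_in dec_in ob_in cmp_assoc[OF D] by (simp add: S_simps(2-))
  qed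
  define F :: "('u, 'u, 'u, 'u) funct" where "F = \<lparr>fobj = (\<lambda>x. ob (dec x)), fmap = (\<lambda>x y f. f)\<rparr>"
  have F_simps: "fobj F x = ob (dec x)" "fmap F x y f = f" for x y f by (simp_all add: F_def)
  have F: "is_functor S D F"
    unfolding is_functor_def
    using ob_in dec_in hm_in by (simp add: F_simps S_simps(2-))
  have "arrows S \<subseteq>
      (\<lambda>v. (e (Inl v), e (Inl v), idt D v)) ` V \<union>
      ((\<lambda>y. (e (Inr y), e (Inr y), idt D (fst y))) ` Y \<union>
      ((\<lambda>y. (e (Inr y), e (Inl (fst y)), idt D (fst y))) ` Y \<union>
       (\<lambda>y. (e (Inr y), e (Inl (fst (snd y))), snd (snd y))) ` Y))"
    (is "_ \<subseteq> ?B")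
  proof
    fix a assume "a \<in> arrows S"
    then obtain y y' f where y: "a = (y, y', f)" "y \<in> obj S" "y' \<in> obj S" "f \<in> hm (dec y) (dec y')"
      by (auto simp: arrows_def S_simps(2))
    define x x' where "x = dec y" and "x' = dec y'"
    have a: "a = (e x, e x', f)" and x: "x \<in> V <+> Y" "x' \<in> V <+> Y" and f: "f \<in> hm x x'"
      using y dec_in f_inv_into_f[of _ e "V <+> Y"] by (simp_all add: x_def x'_def dec_def S_simps(1))
    show "a \<in> ?B"
    proof (cases "x = x'")
      case True
      then show ?thesis using a x f by (auto simp: hm_def ob_def image_iff)
    next
      case False
      with f obtain s t g v where xx: "x = Inr (s, t, g)" "x' = Inl v"
        and v: "v = s \<and> f = idt D s \<or> v = t \<and> f = g"
        by (cases x; cases x') (auto simp: hm_def)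
      have y: "(s, t, g) \<in> Y" using x(1) xx(1) by auto
      show ?thesis using v
      proof
        assume v': "v = s \<and> f = idt D s"
        show ?thesis
          by (rule UnI2, rule UnI2, rule UnI1, rule image_eqI[OF _ y]) (simp add: xx a v')
      next
        assume v': "v = t \<and> f = g"
        show ?thesis
          by (rule UnI2, rule UnI2, rule UnI2, rule image_eqI[OF _ y]) (simp add: xx a v')
      qed
    qed
  qed
  moreover have "|?B| <o \<alpha>"
    by (intro Un_Cinfinite_bound_strict[OF _ _ C\<alpha>] Y_img ordLeq_ordLess_trans[OF card_of_image V])
  ultimately have "|arrows S| <o \<alpha>"
    using card_of_mono1 ordLeq_ordLess_trans by blast
  then obtain z c where zc: "is_cocone S D F z c"
    using filt S F unfolding filtered_def by blast
  have "graph_cocone D Y z (\<lambda>v. c (e (Inl v)))"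
    unfolding graph_cocone_def
  proof (intro conjI ballI, safe)
    show "z \<in> obj D" using zc by (simp add: is_cocone_def)
    fix s t f assume y: "(s, t, f) \<in> Y"
    have st: "s \<in> V" "t \<in> V" using y by (force simp: V_def)+
    have obS: "e (Inl s) \<in> obj S" "e (Inl t) \<in> obj S" "e (Inr (s, t, f)) \<in> obj S"
      using y st by (auto simp: S_simps)
    show s: "c (e (Inl s)) \<in> hom D s z" and "c (e (Inl t)) \<in> hom D t z"
      using cocone_inD[OF zc obS(1)] cocone_inD[OF zc obS(2)] st by (simp_all add: F_simps ob_def)
    have "idt D s \<in> hom S (e (Inr (s, t, f))) (e (Inl s))" "f \<in> hom S (e (Inr (s, t, f))) (e (Inl t))"
      using y st by (auto simp: S_simps hm_def)
    \<comment> \<open>Both legs of the span give the component at the edge object. Comparing them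
      gives the triangle required of a cocone on the graph.\<close>
    from cocone_natD[OF zc this(1) obS(3,1)] cocone_natD[OF zc this(2) obS(3,2)]
    have "cmp D s s z (c (e (Inl s))) (idt D s) = cmp D s t z (c (e (Inl t))) f"
      using y st by (simp add: F_simps ob_def)
    then show "cmp D s t z (c (e (Inl t))) f = c (e (Inl s))"
      using cmp_idt[OF D s] st VD \<open>z \<in> obj D\<close> by auto
  qed
  then show ?thesis by blast
qed

definition fin_filtered :: "('i, 'j) category \<Rightarrow> bool" where
  "fin_filtered D \<longleftrightarrow> (\<forall>Y \<subseteq> arrows D. finite Y \<longrightarrow> (\<exists>z c. graph_cocone D Y z c))"

lemma le_filtered_fin_filtered:
  assumes "le_filtered N D" "infinite N"
  shows "fin_filtered D"
  unfolding fin_filtered_def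
proof (intro allI impI)
  fix Y assume "Y \<subseteq> arrows D" "finite Y"
  moreover from this have "|Y| \<le>o |N|"
    using finite_ordLess_Cinfinite[OF _ Cinfinite_card_of[OF assms(2)]] ordLess_imp_ordLeq by blast
  ultimately show "\<exists>z c. graph_cocone D Y z c"
    using assms(1) unfolding le_filtered_def by blast
qed

context grothendieck
begin

lemma filtered_fin_filtered:
  fixes D :: "('u, 'u) category"
  assumes "is_category D" "filtered \<alpha> D" "regular_cardinal \<alpha>"
  shows "fin_filtered D"
  unfolding fin_filtered_def
proof (intro allI impI)
  fix Y assume Y: "Y \<subseteq> arrows D" "finite Y"
  have "Cinfinite \<alpha>" using assms(3) by (simp add: regular_cardinal_def)
  with Y(2) have "|Y| <o \<alpha>" by (rule finite_ordLess_Cinfinite)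
  then show "\<exists>z c. graph_cocone D Y z c"
    by (rule filtered_graph_cocone[OF assms Y(1)])
qed

lemma filtered_le_filtered:
  fixes D :: "('u, 'u) category"
  assumes "is_category D" "filtered \<alpha> D" "regular_cardinal \<alpha>" "|N| <o \<alpha>"
  shows "le_filtered N D"
  unfolding le_filtered_def
proof (intro allI impI)
  fix Y assume Y: "Y \<subseteq> arrows D" and "|Y| \<le>o |N|"
  then have "|Y| <o \<alpha>" using assms(4) ordLeq_ordLess_trans by blast
  then show "\<exists>z c. graph_cocone D Y z c"
    by (rule filtered_graph_cocone[OF assms(1-3) Y])
qed

lemma two_elements: obtains a b :: 'u where "a \<noteq> b"
proof -
  have "infinite (UNIV :: 'u set)"
    using Cinfinite_UNIV by (simp add: cinfinite_def Field_card_of)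
  then have "\<not> (UNIV :: 'u set) \<subseteq> {undefined}" using finite_subset by blast
  then show ?thesis using that by auto
qed

end

section \<open>Filtered colimits of sets\<close>

lemma Set_simps [simp]:
  "obj Set = {X. small X}" "hom Set X Y = X \<rightarrow>\<^sub>E Y"
  "idt Set X = (\<lambda>x \<in> X. x)" "cmp Set X Y Z g f = compose X g f"
  by (simp_all add: Set_def)

lemma set_fmap_in:
  assumes "is_functor D Set G" "d \<in> obj D" "e \<in> obj D" "u \<in> hom D d e" "x \<in> fobj G d"
  shows "fmap G d e u x \<in> fobj G e"
  using fmap_in[OF assms(1,4,2,3)] assms(5) by auto

lemma set_fmap_cmp:
  assumes "is_functor D Set G" "d \<in> obj D" "e \<in> obj D" "e' \<in> obj D"
    and "u \<in> hom D d e" "v \<in> hom D e e'" "x \<in> fobj G d"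
  shows "fmap G d e' (cmp D d e e' v u) x = fmap G e e' v (fmap G d e u x)"
  using fmap_cmp[OF assms(1,5,6,2,3,4)] assms(7) by (simp add: compose_def)

lemma set_coconeI:
  assumes "small Z" "\<And>d. d \<in> obj D \<Longrightarrow> c d \<in> fobj G d \<rightarrow>\<^sub>E Z" and G: "is_functor D Set G"
    and "\<And>d e u x. d \<in> obj D \<Longrightarrow> e \<in> obj D \<Longrightarrow> u \<in> hom D d e \<Longrightarrow> x \<in> fobj G d \<Longrightarrow>
      c e (fmap G d e u x) = c d x"
  shows "is_cocone D Set G Z c"
  unfolding is_cocone_def
proof (intro conjI ballI)
  show "Z \<in> obj Set" using assms(1) by simp
  show "c d \<in> hom Set (fobj G d) Z" if "d \<in> obj D" for d
    using assms(2)[OF that] by simp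
  show "cmp Set (fobj G d) (fobj G e) Z (c e) (fmap G d e u) = c d"
    if "d \<in> obj D" "e \<in> obj D" "u \<in> hom D d e" for d e u
  proof -
    have "compose (fobj G d) (c e) (fmap G d e u) x = c d x" for x
      using assms(4)[OF that, of x] assms(2)[OF that(1)] by (auto simp: compose_def extensional_def PiE_def)
    then show ?thesis by auto
  qed
qed

context grothendieck
begin

text \<open>If \<open>z\<close> were not in the joint image, the value at \<open>z\<close> of a map
  into a two-element set could be changed without affecting its composites with the cocone, against
  uniqueness of mediating maps.\<close>

lemma set_colimit_surj:
  fixes G :: "('i, 'j, 'u set, 'u \<Rightarrow> 'u) funct"
  assumes G: "is_functor D Set G" and Z: "is_colimit D Set G Z c" and z: "z \<in> Z"
  obtains d x where "d \<in> obj D" "x \<in> fobj G d" "c d x = z"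
proof (rule ccontr)
  assume contr: "\<not> thesis"
  obtain a b :: 'u where ab: "a \<noteq> b" by (rule two_elements)
  have smab: "small {a, b}" unfolding small_usmall by (rule usmall_finite) simp
  define e where "e d = (\<lambda>x \<in> fobj G d. a)" for d
  define u where "u y = (\<lambda>x \<in> Z. if x = z then y else a)" for y
  have "is_cocone D Set G {a, b} e"
    by (rule set_coconeI[OF smab _ G]) (auto simp: e_def set_fmap_in[OF G])
  then have ex1: "\<exists>!u. u \<in> hom Set Z {a, b} \<and> (\<forall>d \<in> obj D. cmp Set (fobj G d) Z {a, b} u (c d) = e d)"
    using Z unfolding is_colimit_def by blast
  have "u y \<in> hom Set Z {a, b} \<and> (\<forall>d \<in> obj D. cmp Set (fobj G d) Z {a, b} (u y) (c d) = e d)"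
    if y: "y \<in> {a, b}" for y
  proof (intro conjI ballI)
    show "u y \<in> hom Set Z {a, b}" using y by (auto simp: u_def)
    fix d assume d: "d \<in> obj D"
    have "c d \<in> fobj G d \<rightarrow>\<^sub>E Z" using cocone_inD[OF colimit_coconeD[OF Z] d] by simp
    moreover have "c d x \<noteq> z" if "x \<in> fobj G d" for x
      using that d contr \<open>\<And>d x. d \<in> obj D \<Longrightarrow> x \<in> fobj G d \<Longrightarrow> c d x = z \<Longrightarrow> thesis\<close> by blast
    ultimately show "cmp Set (fobj G d) Z {a, b} (u y) (c d) = e d"
      by (auto simp: compose_def u_def e_def fun_eq_iff)
  qed
  from this[of a] this[of b] ex1 have "u a = u b" by blast
  then have "u a z = u b z" by simp
  then show False using z ab by (simp add: u_def)
qed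

text \<open>
  The elements that become equal to \<open>x\<close> along \<open>D\<close> are the fibre of a cocone on a two-element set,
  so the quotient describing the colimit need not be constructed.
\<close>

lemma set_colimit_merge:
  fixes G :: "('i, 'j, 'u set, 'u \<Rightarrow> 'u) funct"
  assumes D: "is_category D" "fin_filtered D"
    and G: "is_functor D Set G" and Z: "is_colimit D Set G Z c"
    and d: "d \<in> obj D" and xy: "x \<in> fobj G d" "y \<in> fobj G d" "c d x = c d y"
  obtains e w where "e \<in> obj D" "w \<in> hom D d e" "fmap G d e w x = fmap G d e w y"
proof -
  obtain a b :: 'u where ab: "a \<noteq> b" by (rule two_elements)
  have smab: "small {a, b}" unfolding small_usmall by (rule usmall_finite) simp
  \<comment> \<open>\<open>R e z\<close> says that \<open>z\<close> and \<open>x\<close> have a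
    common image at some stage. By filteredness this does not change along transition maps, so its
    truth value is a cocone on \<open>{a, b}\<close>.\<close>
  define R where "R e z \<longleftrightarrow> (\<exists>e' v u. e' \<in> obj D \<and> v \<in> hom D e e' \<and> u \<in> hom D d e' \<and>
    fmap G e e' v z = fmap G d e' u x)" for e z
  define \<epsilon> where "\<epsilon> e = (\<lambda>z \<in> fobj G e. if R e z then a else b)" for e
  have R: "R e1 (fmap G e e1 w z) \<longleftrightarrow> R e z"
    if e: "e \<in> obj D" "e1 \<in> obj D" "w \<in> hom D e e1" and z: "z \<in> fobj G e" for e e1 w z
  proof
    assume "R e1 (fmap G e e1 w z)"
    then obtain e' v u where *: "e' \<in> obj D" "v \<in> hom D e1 e'" "u \<in> hom D d e'"
      "fmap G e1 e' v (fmap G e e1 w z) = fmap G d e' u x" unfolding R_def by blast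
    then have "fmap G e e' (cmp D e e1 e' v w) z = fmap G d e' u x"
      using set_fmap_cmp[OF G e(1,2) *(1) e(3) *(2) z] by simp
    moreover have "cmp D e e1 e' v w \<in> hom D e e'"
      by (rule cmp_in[OF D(1) e(3) *(2) e(1,2) *(1)])
    ultimately show "R e z" using * unfolding R_def by blast
  next
    assume "R e z"
    then obtain e' v u where *: "e' \<in> obj D" "v \<in> hom D e e'" "u \<in> hom D d e'"
      "fmap G e e' v z = fmap G d e' u x" unfolding R_def by blast
    \<comment> \<open>A cocone on these three arrows supplies a stage beyond both \<open>e'\<close>
      and \<open>e1\<close> at which the two paths from \<open>e\<close> agree.\<close>
    let ?Y = "{(e, e', v), (e, e1, w), (d, e', u)}"
    have "?Y \<subseteq> arrows D" using * e d by (auto simp: arrows_def)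
    then obtain q \<kappa> where q: "graph_cocone D ?Y q \<kappa>"
      using D(2) unfolding fin_filtered_def by blast
    then have qD: "q \<in> obj D" by (simp add: graph_cocone_def)
    have 1: "\<kappa> e \<in> hom D e q" "\<kappa> e' \<in> hom D e' q" "\<kappa> e1 \<in> hom D e1 q" "\<kappa> d \<in> hom D d q"
      "cmp D e e' q (\<kappa> e') v = \<kappa> e" "cmp D e e1 q (\<kappa> e1) w = \<kappa> e" "cmp D d e' q (\<kappa> e') u = \<kappa> d"
      using q by (simp_all add: graph_cocone_def)
    have "fmap G e1 q (\<kappa> e1) (fmap G e e1 w z) = fmap G e q (\<kappa> e) z"
      using set_fmap_cmp[OF G e(1,2) qD e(3) 1(3) z] 1(6) by simp
    also have "\<dots> = fmap G e' q (\<kappa> e') (fmap G e e' v z)"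
      using set_fmap_cmp[OF G e(1) *(1) qD *(2) 1(2) z] 1(5) by simp
    also have "\<dots> = fmap G d q (\<kappa> d) x"
      using set_fmap_cmp[OF G d *(1) qD *(3) 1(2) xy(1)] 1(7) *(4) by simp
    finally show "R e1 (fmap G e e1 w z)" using qD 1 unfolding R_def by blast
  qed
  have "is_cocone D Set G {a, b} \<epsilon>"
    by (rule set_coconeI[OF smab _ G]) (auto simp: \<epsilon>_def set_fmap_in[OF G] R)
  then obtain u where u: "\<And>e. e \<in> obj D \<Longrightarrow> cmp Set (fobj G e) Z {a, b} u (c e) = \<epsilon> e"
    using colimit_map[OF Z] by metis
  have "\<epsilon> d x = \<epsilon> d y"
    using u[OF d, THEN fun_cong, of x] u[OF d, THEN fun_cong, of y] xy by (simp add: compose_def)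
  moreover have "R d x" unfolding R_def using d idt_in[OF D(1) d] by blast
  ultimately have "R d y" using xy ab by (auto simp: \<epsilon>_def split: if_splits)
  then obtain e' v u where *: "e' \<in> obj D" "v \<in> hom D d e'" "u \<in> hom D d e'"
    "fmap G d e' v y = fmap G d e' u x" unfolding R_def by blast
  \<comment> \<open>So far \<open>x\<close> and \<open>y\<close> meet along arrows \<open>u\<close>
    and \<open>v\<close> that may differ. A cocone on the parallel pair makes them equal.\<close>
  let ?Y = "{(d, e', v), (d, e', u)}"
  have "?Y \<subseteq> arrows D" using * d by (auto simp: arrows_def)
  then obtain q \<kappa> where q: "graph_cocone D ?Y q \<kappa>"
    using D(2) unfolding fin_filtered_def by blast
  then have qD: "q \<in> obj D" by (simp add: graph_cocone_def)
  have 1: "\<kappa> d \<in> hom D d q" "\<kappa> e' \<in> hom D e' q"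
    "cmp D d e' q (\<kappa> e') v = \<kappa> d" "cmp D d e' q (\<kappa> e') u = \<kappa> d"
    using q by (simp_all add: graph_cocone_def)
  have "fmap G d q (\<kappa> d) x = fmap G d q (\<kappa> d) y"
    using set_fmap_cmp[OF G d *(1) qD *(2) 1(2) xy(2)] set_fmap_cmp[OF G d *(1) qD *(3) 1(2) xy(1)]
      1 *(4) by simp
  then show ?thesis using that qD 1(1) by blast
qed

end

section \<open>Presentability\<close>

lemma is_functor_hom_functor:
  assumes C: "is_category C" "locally_small C" and X: "X \<in> obj C"
  shows "is_functor C Set (hom_functor C X)"
  unfolding is_functor_def
proof (intro conjI ballI)
  fix Y assume Y: "Y \<in> obj C"
  then show "fobj (hom_functor C X) Y \<in> obj Set"
    using C(2) X by (simp add: hom_functor_def locally_small_def)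
  show "fmap (hom_functor C X) Y Y (idt C Y) = idt Set (fobj (hom_functor C X) Y)"
    using idt_cmp[OF C(1)] X Y by (auto simp: hom_functor_def)
  fix Z f assume Z: "Z \<in> obj C" and f: "f \<in> hom C Y Z"
  show "fmap (hom_functor C X) Y Z f \<in> hom Set (fobj (hom_functor C X) Y) (fobj (hom_functor C X) Z)"
    using cmp_in[OF C(1) _ f X Y Z] by (auto simp: hom_functor_def)
  fix W g assume W: "W \<in> obj C" and g: "g \<in> hom C Z W"
  show "fmap (hom_functor C X) Y W (cmp C Y Z W g f) =
    act Set (hom_functor C X) (fobj (hom_functor C X) Y) Z W g (fmap (hom_functor C X) Y Z f)"
    using cmp_in[OF C(1) _ f X Y Z] cmp_assoc[OF C(1) _ f g X Y Z W]
    by (auto simp: hom_functor_def compose_def fun_eq_iff)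
qed

text \<open>For a filtered \<open>D\<close> the two clauses say that the comparison from the colimit
  of the sets \<open>C(X, F d)\<close> to \<open>C(X, Z)\<close> is surjective and injective. In
  this elementwise form no colimit of sets has to be formed.\<close>

definition hom_preserves ::
  "('i, 'j) category \<Rightarrow> ('o, 'm) category \<Rightarrow> ('i, 'j, 'o, 'm) funct \<Rightarrow> 'o \<Rightarrow> ('i \<Rightarrow> 'm) \<Rightarrow> 'o \<Rightarrow> bool"
  where
  "hom_preserves D C F Z c X \<longleftrightarrow> X \<in> obj C \<and>
     (\<forall>k \<in> hom C X Z. \<exists>d \<in> obj D. \<exists>k' \<in> hom C X (fobj F d). cmp C X (fobj F d) Z (c d) k' = k) \<and>
     (\<forall>d \<in> obj D. \<forall>g \<in> hom C X (fobj F d). \<forall>g' \<in> hom C X (fobj F d).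
        cmp C X (fobj F d) Z (c d) g = cmp C X (fobj F d) Z (c d) g' \<longrightarrow>
        (\<exists>e \<in> obj D. \<exists>w \<in> hom D d e.
           act C F X d e w g =
           act C F X d e w g'))"

lemma hom_preserves_factor:
  assumes "hom_preserves D C F Z c X" "k \<in> hom C X Z"
  obtains d k' where "d \<in> obj D" "k' \<in> hom C X (fobj F d)" "cmp C X (fobj F d) Z (c d) k' = k"
  using assms unfolding hom_preserves_def by blast

lemma hom_preserves_merge:
  assumes "hom_preserves D C F Z c X" "d \<in> obj D"
    "g \<in> hom C X (fobj F d)" "g' \<in> hom C X (fobj F d)"
    "cmp C X (fobj F d) Z (c d) g = cmp C X (fobj F d) Z (c d) g'"
  obtains e w where "e \<in> obj D" "w \<in> hom D d e"
    "act C F X d e w g =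
     act C F X d e w g'"
  using assms unfolding hom_preserves_def by blast

lemma cmp_cocone:
  assumes C: "is_category C" and F: "is_functor D C F" and c: "is_cocone D C F Z c"
    and de: "d \<in> obj D" "e \<in> obj D" "p \<in> hom D d e"
    and X: "X \<in> obj C" and g: "g \<in> hom C X (fobj F d)"
  shows "cmp C X (fobj F e) Z (c e) (act C F X d e p g) =
    cmp C X (fobj F d) Z (c d) g"
  using cmp_assoc[OF C g fmap_in[OF F de(3,1,2)] cocone_inD[OF c de(2)] X fobj_in[OF F de(1)]
      fobj_in[OF F de(2)]] c cocone_natD[OF c de(3,1,2)]
  by (simp add: is_cocone_def)

lemma cmp_fmap_cmp:
  assumes C: "is_category C" and F: "is_functor D C F"
    and de: "d \<in> obj D" "e \<in> obj D" "e' \<in> obj D" "p \<in> hom D d e" "q \<in> hom D e e'"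
    and X: "X \<in> obj C" and g: "g \<in> hom C X (fobj F d)"
  shows "act C F X d e' (cmp D d e e' q p) g =
    act C F X e e' q (act C F X d e p g)"
  using cmp_assoc[OF C g fmap_in[OF F de(4,1,2)] fmap_in[OF F de(5,2,3)] X fobj_in[OF F de(1)]
      fobj_in[OF F de(2)] fobj_in[OF F de(3)]] fmap_cmp[OF F de(4,5,1,2,3)]
  by simp

text \<open>The two maps start at different stages. They are first moved to a common stage, which
  the identities of \<open>d\<close> and \<open>d'\<close> in \<open>?Y\<close> provide, and are
  then merged there.\<close>

lemma hom_preserves_merge2:
  assumes C: "is_category C" and D: "is_category D" "fin_filtered D"
    and F: "is_functor D C F" and Z: "is_colimit D C F Z c" and X: "hom_preserves D C F Z c X"
    and d: "d \<in> obj D" "g \<in> hom C X (fobj F d)" and d': "d' \<in> obj D" "g' \<in> hom C X (fobj F d')"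
    and eq: "cmp C X (fobj F d) Z (c d) g = cmp C X (fobj F d') Z (c d') g'"
  obtains e p p' where "e \<in> obj D" "p \<in> hom D d e" "p' \<in> hom D d' e"
    "act C F X d e p g =
     act C F X d' e p' g'"
proof -
  have XC: "X \<in> obj C" using X by (simp add: hom_preserves_def)
  note c = colimit_coconeD[OF Z]
  let ?Y = "{(d, d, idt D d), (d', d', idt D d')}"
  have "?Y \<subseteq> arrows D" using d d' idt_in[OF D(1)] by (auto simp: arrows_def)
  then obtain q \<kappa> where "graph_cocone D ?Y q \<kappa>"
    using D(2) unfolding fin_filtered_def by blast
  then have q: "q \<in> obj D" and \<kappa>: "\<kappa> d \<in> hom D d q" "\<kappa> d' \<in> hom D d' q"
    by (simp_all add: graph_cocone_def)
  let ?h = "act C F X d q (\<kappa> d) g"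
  let ?h' = "act C F X d' q (\<kappa> d') g'"
  have h: "?h \<in> hom C X (fobj F q)"
    by (rule cmp_in[OF C d(2) fmap_in[OF F \<kappa>(1) d(1) q] XC fobj_in[OF F d(1)] fobj_in[OF F q]])
  have h': "?h' \<in> hom C X (fobj F q)"
    by (rule cmp_in[OF C d'(2) fmap_in[OF F \<kappa>(2) d'(1) q] XC fobj_in[OF F d'(1)] fobj_in[OF F q]])
  have "cmp C X (fobj F q) Z (c q) ?h = cmp C X (fobj F q) Z (c q) ?h'"
    using cmp_cocone[OF C F c d(1) q \<kappa>(1) XC d(2)] cmp_cocone[OF C F c d'(1) q \<kappa>(2) XC d'(2)] eq
    by simp
  from hom_preserves_merge[OF X q h h' this]
  obtain e w where e: "e \<in> obj D" "w \<in> hom D q e"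
    and w: "act C F X q e w ?h =
      act C F X q e w ?h'" .
  have "cmp D d q e w (\<kappa> d) \<in> hom D d e" "cmp D d' q e w (\<kappa> d') \<in> hom D d' e"
    using cmp_in[OF D(1)] \<kappa> e q d(1) d'(1) by blast+
  moreover note cmp_fmap_cmp[OF C F d(1) q e(1) \<kappa>(1) e(2) XC d(2)]
    cmp_fmap_cmp[OF C F d'(1) q e(1) \<kappa>(2) e(2) XC d'(2)]
  ultimately show ?thesis using that e(1) w by metis
qed

text \<open>The two facts on filtered colimits of sets, applied to the diagram of the hom-sets
  \<open>C(X, F d)\<close>, which presentability makes a colimit diagram.\<close>

lemma (in grothendieck) presentable_hom_preserves:
  fixes C :: "('o, 'u) category" and D :: "('u, 'u) category"
  assumes C: "is_category C" "locally_small C" and X: "presentable \<alpha> C X"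
    and \<alpha>: "regular_cardinal \<alpha>"
    and D: "small_category D" "filtered \<alpha> D" and F: "is_functor D C F" and Z: "is_colimit D C F Z c"
  shows "hom_preserves D C F Z c X"
proof -
  have XC: "X \<in> obj C" using X by (simp add: presentable_def)
  note DD = small_categoryD(1)[OF D(1)]
  let ?G = "comp_functor (hom_functor C X) F"
  let ?c = "\<lambda>d. fmap (hom_functor C X) (fobj F d) Z (c d)"
  have G: "is_functor D Set ?G"
    by (rule is_functor_comp[OF F is_functor_hom_functor[OF C XC]])
  have col: "is_colimit D Set ?G (fobj (hom_functor C X) Z) ?c"
    using X D F Z unfolding presentable_def preserves_filtered_colimits_def by blast
  have fin: "fin_filtered D" by (rule filtered_fin_filtered[OF DD D(2) \<alpha>])
  show ?thesis
    unfolding hom_preserves_def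
  proof (intro conjI ballI impI)
    show "X \<in> obj C" by (rule XC)
    fix k assume "k \<in> hom C X Z"
    then have "k \<in> fobj (hom_functor C X) Z" by (simp add: hom_functor_def)
    from set_colimit_surj[OF G col this] obtain d x
      where "d \<in> obj D" "x \<in> fobj ?G d" "?c d x = k" .
    then show "\<exists>d \<in> obj D. \<exists>k' \<in> hom C X (fobj F d). cmp C X (fobj F d) Z (c d) k' = k"
      by (auto simp: hom_functor_def)
  next
    fix d g g'
    assume d: "d \<in> obj D" and g: "g \<in> hom C X (fobj F d)" "g' \<in> hom C X (fobj F d)"
      and eq: "cmp C X (fobj F d) Z (c d) g = cmp C X (fobj F d) Z (c d) g'"
    have "g \<in> fobj ?G d" "g' \<in> fobj ?G d" "?c d g = ?c d g'"
      using g eq by (simp_all add: hom_functor_def)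
    from set_colimit_merge[OF DD fin G col d this] obtain e w
      where "e \<in> obj D" "w \<in> hom D d e" "fmap ?G d e w g = fmap ?G d e w g'" .
    then show "\<exists>e \<in> obj D. \<exists>w \<in> hom D d e.
        act C F X d e w g =
        act C F X d e w g'"
      using g by (auto simp: hom_functor_def)
  qed
qed

text \<open>The counterpart of \<open>le_filtered\<close>: presentability for the successor of
  \<open>|N|\<close> when \<open>N\<close> is infinite, in the elementwise form.\<close>

definition le_presentable :: "'u set \<Rightarrow> ('o, 'u) category \<Rightarrow> 'o \<Rightarrow> bool" where
  "le_presentable N C X \<longleftrightarrow> X \<in> obj C \<and>
     (\<forall>(D :: ('u, 'u) category) F Z c.
        small_category D \<and> le_filtered N D \<and> is_functor D C F \<and> is_colimit D C F Z c \<longrightarrow>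
        hom_preserves D C F Z c X)"

text \<open>This is the argument that a colimit of few presentable objects is presentable, carried
  out for one fixed colimit \<open>Z\<close>. A map out of \<open>X\<close> is a cocone on
  \<open>G\<close>. Its components factor through stages of \<open>D\<close>, every arrow of
  \<open>E\<close> asks for one identification at a later stage, and \<open>|N|\<close> such demands
  are met by a single cocone in \<open>D\<close>.\<close>

lemma hom_preserves_colimit:
  fixes E :: "('p, 'q) category"
  assumes C: "is_category C"
    and D: "is_category D" "le_filtered N D" and F: "is_functor D C F" and Z: "is_colimit D C F Z c"
    and E: "is_category E" and card: "|arrows E| \<le>o |N|" and N: "infinite N"
    and G: "is_functor E C G" and X: "is_colimit E C G X g"
    and pres: "\<And>e. e \<in> obj E \<Longrightarrow> hom_preserves D C F Z c (fobj G e)"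
  shows "hom_preserves D C F Z c X"
proof -
  note c = colimit_coconeD[OF Z] and gc = colimit_coconeD[OF X]
  note ZC = colimit_objD[OF Z] and XC = colimit_objD[OF X]
  note FC = fobj_in[OF F] and GC = fobj_in[OF G]
  note fin = le_filtered_fin_filtered[OF D(2) N]
  have arr_img: "|f ` arrows E| \<le>o |N|" for f :: "'p \<times> 'p \<times> 'q \<Rightarrow> 'x"
    using card card_of_image ordLeq_transitive by blast
  have CN: "Cinfinite |N|" by (rule Cinfinite_card_of[OF N])
  show ?thesis
    unfolding hom_preserves_def
  proof (intro conjI ballI impI)
    show "X \<in> obj C" by (rule XC)
    fix k assume k: "k \<in> hom C X Z"
    have "\<exists>d k'. d \<in> obj D \<and> k' \<in> hom C (fobj G e) (fobj F d) \<and>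
        cmp C (fobj G e) (fobj F d) Z (c d) k' = cmp C (fobj G e) X Z k (g e)" if e: "e \<in> obj E" for e
      using hom_preserves_factor[OF pres[OF e] cmp_in[OF C cocone_inD[OF gc e] k GC[OF e] XC ZC]] by metis
    then obtain \<delta> \<phi> where \<delta>\<phi>: "\<forall>e. e \<in> obj E \<longrightarrow> \<delta> e \<in> obj D \<and>
        \<phi> e \<in> hom C (fobj G e) (fobj F (\<delta> e)) \<and>
        cmp C (fobj G e) (fobj F (\<delta> e)) Z (c (\<delta> e)) (\<phi> e) = cmp C (fobj G e) X Z k (g e)"
    by (rule choice_on2)
    note \<delta> = \<delta>\<phi>[rule_format, THEN conjunct1]
      and \<phi> = \<delta>\<phi>[rule_format, THEN conjunct2, THEN conjunct1]
      and \<phi>_eq = \<delta>\<phi>[rule_format, THEN conjunct2, THEN conjunct2]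
    have \<phi>G: "cmp C (fobj G e) (fobj G e') (fobj F (\<delta> e')) (\<phi> e') (fmap G e e' u)
        \<in> hom C (fobj G e) (fobj F (\<delta> e'))"
      if "(e, e', u) \<in> arrows E" for e e' u
      using that cmp_in[OF C fmap_in[OF G] \<phi>] GC FC \<delta> by (simp add: arrows_def)
    \<comment> \<open>For an arrow \<open>a\<close> of \<open>E\<close>, the stage \<open>d\<close>
      is one at which the chosen factors at the two ends of \<open>a\<close> become
      compatible.\<close>
    define Q where "Q a d p q \<longleftrightarrow> (case a of (e, e', u) \<Rightarrow>
        d \<in> obj D \<and> p \<in> hom D (\<delta> e) d \<and> q \<in> hom D (\<delta> e') d \<and>
        act C F (fobj G e) (\<delta> e) d p (\<phi> e) =
        act C F (fobj G e) (\<delta> e') d q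
          (cmp C (fobj G e) (fobj G e') (fobj F (\<delta> e')) (\<phi> e') (fmap G e e' u)))" for a :: "'p \<times> 'p \<times> 'q" and d p q
    have "\<exists>d p q. Q a d p q" if a_arr: "a \<in> arrows E" for a
    proof -
      obtain e e' u where a: "a = (e, e', u)" by (cases a)
      note True = a_arr[unfolded a]
      then have e: "e \<in> obj E" "e' \<in> obj E" "u \<in> hom E e e'" by (simp_all add: arrows_def)
      note Gu = fmap_in[OF G e(3,1,2)]
      have "cmp C (fobj G e) (fobj F (\<delta> e')) Z (c (\<delta> e'))
          (cmp C (fobj G e) (fobj G e') (fobj F (\<delta> e')) (\<phi> e') (fmap G e e' u)) =
          cmp C (fobj G e) (fobj G e') Z (cmp C (fobj G e') X Z k (g e')) (fmap G e e' u)"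
        using cmp_assoc[OF C Gu \<phi>[OF e(2)] cocone_inD[OF c \<delta>[OF e(2)]] GC[OF e(1)] GC[OF e(2)]
            FC[OF \<delta>[OF e(2)]] ZC] \<phi>_eq[OF e(2)] by simp
      also have "\<dots> = cmp C (fobj G e) X Z k (g e)"
        using cmp_assoc[OF C Gu cocone_inD[OF gc e(2)] k GC[OF e(1)] GC[OF e(2)] XC ZC]
          cocone_natD[OF gc e(3,1,2)] by simp
      finally have "cmp C (fobj G e) (fobj F (\<delta> e)) Z (c (\<delta> e)) (\<phi> e) =
        cmp C (fobj G e) (fobj F (\<delta> e')) Z (c (\<delta> e'))
          (cmp C (fobj G e) (fobj G e') (fobj F (\<delta> e')) (\<phi> e') (fmap G e e' u))"
        using \<phi>_eq[OF e(1)] by simp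
      from hom_preserves_merge2[OF C D(1) fin F Z pres[OF e(1)] \<delta>[OF e(1)] \<phi>[OF e(1)]
          \<delta>[OF e(2)] \<phi>G[OF True] this]
      obtain d p q where "d \<in> obj D" "p \<in> hom D (\<delta> e) d" "q \<in> hom D (\<delta> e') d"
        "act C F (fobj G e) (\<delta> e) d p (\<phi> e) =
          act C F (fobj G e) (\<delta> e') d q
            (cmp C (fobj G e) (fobj G e') (fobj F (\<delta> e')) (\<phi> e') (fmap G e e' u))" .
      then have "Q a d p q" by (simp add: Q_def a)
      then show ?thesis by blast
    qed
    then obtain \<eta> p q where H: "\<forall>a. a \<in> arrows E \<longrightarrow> Q a (\<eta> a) (p a) (q a)"
    by (rule choice_on3)
    \<comment> \<open>A cocone on these arrows leads all the separate stages to one stage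
      \<open>z\<close>. Objects of \<open>E\<close> need no extra entry, since each is an end of its
      identity.\<close>
    let ?Y = "(\<lambda>a. (\<delta> (fst a), \<eta> a, p a)) ` arrows E \<union> (\<lambda>a. (\<delta> (fst (snd a)), \<eta> a, q a)) ` arrows E"
    have "?Y \<subseteq> arrows D"
    proof -
      have "\<delta> (fst a) \<in> obj D \<and> \<delta> (fst (snd a)) \<in> obj D \<and> \<eta> a \<in> obj D \<and>
          p a \<in> hom D (\<delta> (fst a)) (\<eta> a) \<and> q a \<in> hom D (\<delta> (fst (snd a))) (\<eta> a)"
        if "a \<in> arrows E" for a
        using H[rule_format, OF that] that \<delta> by (auto simp: Q_def arrows_def)
      then show ?thesis by (auto simp: arrows_def[of D])
    qed
    moreover have "|?Y| \<le>o |N|"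
      by (rule Un_Cinfinite_bound[OF arr_img arr_img CN])
    ultimately obtain z \<kappa> where z: "graph_cocone D ?Y z \<kappa>"
      using D(2) unfolding le_filtered_def by blast
    have zD: "z \<in> obj D" using z by (simp add: graph_cocone_def)
    have \<kappa>: "\<kappa> (\<delta> e) \<in> hom D (\<delta> e) z" "\<kappa> (\<delta> e') \<in> hom D (\<delta> e') z"
        "\<kappa> (\<eta> (e, e', u)) \<in> hom D (\<eta> (e, e', u)) z"
        "cmp D (\<delta> e) (\<eta> (e, e', u)) z (\<kappa> (\<eta> (e, e', u))) (p (e, e', u)) = \<kappa> (\<delta> e)"
        "cmp D (\<delta> e') (\<eta> (e, e', u)) z (\<kappa> (\<eta> (e, e', u))) (q (e, e', u)) = \<kappa> (\<delta> e')"
      if "(e, e', u) \<in> arrows E" for e e' u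
    proof -
      have 1: "(\<delta> e, \<eta> (e, e', u), p (e, e', u)) \<in> ?Y" "(\<delta> e', \<eta> (e, e', u), q (e, e', u)) \<in> ?Y"
        by (rule UnI1, rule image_eqI[OF _ that], simp)
          (rule UnI2, rule image_eqI[OF _ that], simp)
      show "\<kappa> (\<delta> e) \<in> hom D (\<delta> e) z" "\<kappa> (\<delta> e') \<in> hom D (\<delta> e') z"
        "\<kappa> (\<eta> (e, e', u)) \<in> hom D (\<eta> (e, e', u)) z"
        "cmp D (\<delta> e) (\<eta> (e, e', u)) z (\<kappa> (\<eta> (e, e', u))) (p (e, e', u)) = \<kappa> (\<delta> e)"
        "cmp D (\<delta> e') (\<eta> (e, e', u)) z (\<kappa> (\<eta> (e, e', u))) (q (e, e', u)) = \<kappa> (\<delta> e')"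
        using graph_coconeD[OF z 1(1)] graph_coconeD[OF z 1(2)] by simp_all
    qed
    have \<kappa>1: "\<kappa> (\<delta> e) \<in> hom D (\<delta> e) z" if "e \<in> obj E" for e
      using \<kappa>(1)[of e e "idt E e"] that idt_in[OF E] by (simp add: arrows_def)
    define m where "m e = act C F (fobj G e) (\<delta> e) z (\<kappa> (\<delta> e)) (\<phi> e)" for e
    have m: "m e \<in> hom C (fobj G e) (fobj F z)" if "e \<in> obj E" for e
      unfolding m_def
      using cmp_in[OF C \<phi>[OF that] fmap_in[OF F \<kappa>1[OF that]]] GC FC \<delta> zD that by blast
    have "is_cocone E C G (fobj F z) m"
      unfolding is_cocone_def
    proof (intro conjI ballI)
      show "fobj F z \<in> obj C" by (rule FC[OF zD])
      show "m e \<in> hom C (fobj G e) (fobj F z)" if "e \<in> obj E" for e by (rule m[OF that])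
      fix e e' u assume e: "e \<in> obj E" "e' \<in> obj E" "u \<in> hom E e e'"
      then have arr: "(e, e', u) \<in> arrows E" by (simp add: arrows_def)
      note k1 = \<kappa>[OF arr]
      have h: "\<eta> (e, e', u) \<in> obj D" "p (e, e', u) \<in> hom D (\<delta> e) (\<eta> (e, e', u))"
        "q (e, e', u) \<in> hom D (\<delta> e') (\<eta> (e, e', u))"
        "act C F (fobj G e) (\<delta> e) (\<eta> (e, e', u)) (p (e, e', u)) (\<phi> e) =
        act C F (fobj G e) (\<delta> e') (\<eta> (e, e', u)) (q (e, e', u))
          (cmp C (fobj G e) (fobj G e') (fobj F (\<delta> e')) (\<phi> e') (fmap G e e' u))"
        using H[rule_format, OF arr] by (simp_all add: Q_def)
      have "cmp C (fobj G e) (fobj G e') (fobj F z) (m e') (fmap G e e' u) =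
        act C F (fobj G e) (\<delta> e') z (\<kappa> (\<delta> e'))
          (cmp C (fobj G e) (fobj G e') (fobj F (\<delta> e')) (\<phi> e') (fmap G e e' u))"
        unfolding m_def
        by (rule cmp_assoc[OF C fmap_in[OF G e(3,1,2)] \<phi>[OF e(2)] fmap_in[OF F k1(2) \<delta>[OF e(2)] zD]
              GC[OF e(1)] GC[OF e(2)] FC[OF \<delta>[OF e(2)]] FC[OF zD]])
      also have "\<dots> = m e"
        using cmp_fmap_cmp[OF C F \<delta>[OF e(2)] h(1) zD h(3) k1(3) GC[OF e(1)] \<phi>G[OF arr]]
          cmp_fmap_cmp[OF C F \<delta>[OF e(1)] h(1) zD h(2) k1(3) GC[OF e(1)] \<phi>[OF e(1)]]
        unfolding k1(4,5) h(4) m_def by simp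
      finally show "cmp C (fobj G e) (fobj G e') (fobj F z) (m e') (fmap G e e' u) = m e" .
    qed
    from colimit_map[OF X this] obtain h where h: "h \<in> hom C X (fobj F z)"
      and hg: "\<And>e. e \<in> obj E \<Longrightarrow> cmp C (fobj G e) X (fobj F z) h (g e) = m e" by blast
    have "cmp C X (fobj F z) Z (c z) h = k"
    proof (rule colimit_eqI[OF C G X ZC])
      show "cmp C X (fobj F z) Z (c z) h \<in> hom C X Z"
        by (rule cmp_in[OF C h cocone_inD[OF c zD] XC FC[OF zD] ZC])
      show "k \<in> hom C X Z" by (rule k)
      fix e assume e: "e \<in> obj E"
      have "cmp C (fobj G e) X Z (cmp C X (fobj F z) Z (c z) h) (g e) =
        cmp C (fobj G e) (fobj F z) Z (c z) (m e)"
        using cmp_assoc[OF C cocone_inD[OF gc e] h cocone_inD[OF c zD] GC[OF e] XC FC[OF zD] ZC]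
          hg[OF e] by simp
      also have "\<dots> = cmp C (fobj G e) X Z k (g e)"
        unfolding m_def cmp_cocone[OF C F c \<delta>[OF e] zD \<kappa>1[OF e] GC[OF e] \<phi>[OF e]]
        by (rule \<phi>_eq[OF e])
      finally show "cmp C (fobj G e) X Z (cmp C X (fobj F z) Z (c z) h) (g e) =
        cmp C (fobj G e) X Z k (g e)" .
    qed
    then show "\<exists>d \<in> obj D. \<exists>k' \<in> hom C X (fobj F d). cmp C X (fobj F d) Z (c d) k' = k"
      using zD h by blast
  next
    fix d h h'
    assume d: "d \<in> obj D" and h: "h \<in> hom C X (fobj F d)" and h': "h' \<in> hom C X (fobj F d)"
      and eq: "cmp C X (fobj F d) Z (c d) h = cmp C X (fobj F d) Z (c d) h'"
    let ?r = "\<lambda>h e. cmp C (fobj G e) X (fobj F d) h (g e)"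
    have r: "?r h e \<in> hom C (fobj G e) (fobj F d)" "?r h' e \<in> hom C (fobj G e) (fobj F d)"
      if "e \<in> obj E" for e
      using cmp_in[OF C cocone_inD[OF gc that]] h h' GC[OF that] XC FC[OF d] by blast+
    have r_cmp: "act C F (fobj G e) d d' w (?r h e) =
        cmp C (fobj G e) X (fobj F d') (act C F X d d' w h) (g e)"
      if "e \<in> obj E" "h \<in> hom C X (fobj F d)" "d' \<in> obj D" "w \<in> hom D d d'" for e h d' w
      using cmp_assoc[OF C cocone_inD[OF gc that(1)] that(2) fmap_in[OF F that(4) d that(3)]
        GC[OF that(1)] XC FC[OF d] FC[OF that(3)]] by simp
    have "\<exists>d' w. d' \<in> obj D \<and> w \<in> hom D d d' \<and>
        act C F (fobj G e) d d' w (?r h e) = act C F (fobj G e) d d' w (?r h' e)" if e: "e \<in> obj E" for e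
    proof -
      have "cmp C (fobj G e) (fobj F d) Z (c d) (?r h e) = cmp C (fobj G e) (fobj F d) Z (c d) (?r h' e)"
        using cmp_assoc[OF C cocone_inD[OF gc e] h cocone_inD[OF c d] GC[OF e] XC FC[OF d] ZC]
          cmp_assoc[OF C cocone_inD[OF gc e] h' cocone_inD[OF c d] GC[OF e] XC FC[OF d] ZC] eq
        by simp
      from hom_preserves_merge[OF pres[OF e] d r[OF e] this] show ?thesis by metis
    qed
    then obtain \<eta> w where \<eta>w: "\<forall>e. e \<in> obj E \<longrightarrow> \<eta> e \<in> obj D \<and> w e \<in> hom D d (\<eta> e) \<and>
        act C F (fobj G e) d (\<eta> e) (w e) (?r h e) = act C F (fobj G e) d (\<eta> e) (w e) (?r h' e)"
    by (rule choice_on2)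
    note \<eta> = \<eta>w[rule_format, THEN conjunct1]
      and w = \<eta>w[rule_format, THEN conjunct2, THEN conjunct1]
      and w_eq = \<eta>w[rule_format, THEN conjunct2, THEN conjunct2]
    \<comment> \<open>The identity of \<open>d\<close> makes \<open>\<kappa> d\<close> an arrow of
      \<open>D\<close> even if \<open>E\<close> is empty.\<close>
    let ?Y = "(\<lambda>a. (d, \<eta> (fst a), w (fst a))) ` arrows E \<union> {(d, d, idt D d)}"
    have "?Y \<subseteq> arrows D"
      using \<eta> w d idt_in[OF D(1) d] by (auto simp: arrows_def)
    moreover have "|?Y| \<le>o |N|"
    proof (rule Un_Cinfinite_bound[OF arr_img _ CN])
      show "|{(d, d, idt D d)}| \<le>o |N|" using N by (intro card_of_singl_ordLeq) auto
    qed
    ultimately obtain z \<kappa> where z: "graph_cocone D ?Y z \<kappa>"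
      using D(2) unfolding le_filtered_def by blast
    have zD: "z \<in> obj D" using z by (simp add: graph_cocone_def)
    have \<kappa>d: "\<kappa> d \<in> hom D d z" using graph_coconeD(1)[OF z, of d d "idt D d"] by simp
    have \<kappa>: "\<kappa> (\<eta> e) \<in> hom D (\<eta> e) z" "cmp D d (\<eta> e) z (\<kappa> (\<eta> e)) (w e) = \<kappa> d" if "e \<in> obj E" for e
    proof -
      have "(e, e, idt E e) \<in> arrows E" using that idt_in[OF E] by (simp add: arrows_def)
      then have "(d, \<eta> e, w e) \<in> ?Y" by (intro UnI1 image_eqI[of _ _ "(e, e, idt E e)"]) simp_all
      from graph_coconeD(2,3)[OF z this]
      show "\<kappa> (\<eta> e) \<in> hom D (\<eta> e) z" "cmp D d (\<eta> e) z (\<kappa> (\<eta> e)) (w e) = \<kappa> d" .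
    qed
    have "act C F X d z (\<kappa> d) h =
      act C F X d z (\<kappa> d) h'"
    proof (rule colimit_eqI[OF C G X FC[OF zD]])
      show "act C F X d z (\<kappa> d) h \<in> hom C X (fobj F z)"
        "act C F X d z (\<kappa> d) h' \<in> hom C X (fobj F z)"
        using cmp_in[OF C _ fmap_in[OF F \<kappa>d d zD] XC FC[OF d] FC[OF zD]] h h' by blast+
      fix e assume e: "e \<in> obj E"
      have "act C F (fobj G e) d z (\<kappa> d) (?r h e) =
        act C F (fobj G e) d z (\<kappa> d) (?r h' e)"
        using cmp_fmap_cmp[OF C F d \<eta>[OF e] zD w[OF e] \<kappa>(1)[OF e] GC[OF e] r(1)[OF e]]
          cmp_fmap_cmp[OF C F d \<eta>[OF e] zD w[OF e] \<kappa>(1)[OF e] GC[OF e] r(2)[OF e]]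
        unfolding \<kappa>(2)[OF e] w_eq[OF e] by simp
      then show "cmp C (fobj G e) X (fobj F z) (act C F X d z (\<kappa> d) h) (g e) =
        cmp C (fobj G e) X (fobj F z) (act C F X d z (\<kappa> d) h') (g e)"
        unfolding r_cmp[OF e h zD \<kappa>d] r_cmp[OF e h' zD \<kappa>d] .
    qed
    then show "\<exists>d' \<in> obj D. \<exists>w \<in> hom D d d'.
        act C F X d d' w h =
        act C F X d d' w h'"
      using zD \<kappa>d by blast
  qed
qed

lemma (in grothendieck) usmall_arrows:
  assumes "small_category (D :: ('u, 'u) category)"
  shows "usmall U (arrows D)"
proof -
  have "arrows D \<subseteq> Sigma (obj D) (\<lambda>X. Sigma (obj D) (hom D X))"
    by (auto simp: arrows_def)
  moreover have "usmall U (Sigma (obj D) (\<lambda>X. Sigma (obj D) (hom D X)))"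
    using small_categoryD[OF assms] unfolding small_usmall
    by (intro usmall_Sigma) auto
  ultimately show ?thesis using usmall_subset by blast
qed

lemma (in grothendieck) usmall_Field_regular:
  "regular_cardinal (\<alpha> :: 'u rel) \<Longrightarrow> usmall U (Field \<alpha>)"
  unfolding regular_cardinal_def usmall_def
  using card_of_Field_ordIso ordIso_ordLess_trans by blast

text \<open>\<open>N\<close> bounds both \<alpha> and one \<alpha>-filtered diagram of
  \<alpha>-presentable objects with colimit \<open>X\<close>, so \<open>N\<close> depends on
  \<open>X\<close>. The conclusion holds for all larger sets, which allows one index to serve
  several objects.\<close>

lemma (in grothendieck) accessible_le_presentable:
  fixes C :: "('o, 'u) category"
  assumes C: "accessible C" and X: "X \<in> obj C"
  obtains N :: "'u set" where "small N" "\<And>M :: 'u set. |N| \<le>o |M| \<Longrightarrow> le_presentable M C X"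
proof -
  obtain \<alpha> :: "'u rel" where cat: "is_category C" "locally_small C" and \<alpha>: "regular_cardinal \<alpha>"
    and acc: "accessible_for \<alpha> C"
    using C unfolding accessible_def by blast
  obtain I :: "'u set" and P where P: "\<forall>i \<in> I. presentable \<alpha> C (P i)"
    and gen: "\<forall>X \<in> obj C. colimit_from (filtered \<alpha>) C (P ` I) X"
    using acc unfolding accessible_for_def by blast
  obtain E :: "('u, 'u) category" and G g where E: "small_category E" and G: "is_functor E C G"
    and GP: "\<forall>e \<in> obj E. fobj G e \<in> P ` I" and Xg: "is_colimit E C G X g"
    using gen X by blast
  have "usmall U (arrows E <+> Field \<alpha>)"
    using usmall_arrows[OF E] usmall_Field_regular[OF \<alpha>] by (rule usmall_Plus)
  then obtain N :: "'u set" where N: "small N" "infinite N" "|arrows E <+> Field \<alpha>| \<le>o |N|"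
    by (rule usmall_bound)
  have "le_presentable M C X" if M: "|N| \<le>o |M|" for M :: "'u set"
    unfolding le_presentable_def
  proof (intro conjI allI impI)
    show "X \<in> obj C" by (rule X)
    fix D :: "('u, 'u) category" and F Z c
    assume "small_category D \<and> le_filtered M D \<and> is_functor D C F \<and> is_colimit D C F Z c"
    then have D: "small_category D" "le_filtered M D" and F: "is_functor D C F"
      and Z: "is_colimit D C F Z c" by simp_all
    have M_inf: "infinite M" using N(2) M card_of_ordLeq_finite by blast
    note NM = ordLeq_transitive[OF N(3) M]
    have le: "|arrows E| \<le>o |M|" "|Field \<alpha>| \<le>o |M|"
      by (rule ordLeq_transitive[OF card_of_Plus1 NM], rule ordLeq_transitive[OF card_of_Plus2 NM])
    have "\<alpha> =o |Field \<alpha>|"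
      using \<alpha> card_of_Field_ordIso ordIso_symmetric unfolding regular_cardinal_def by blast
    then have "\<alpha> \<le>o |M|" using le(2) by (rule ordIso_ordLeq_trans)
    then have filt: "filtered \<alpha> D" by (rule le_filtered_filtered[OF D(2)])
    show "hom_preserves D C F Z c X"
    proof (rule hom_preserves_colimit[OF cat(1) small_categoryD(1)[OF D(1)] D(2) F Z
          small_categoryD(1)[OF E] le(1) M_inf G Xg])
      fix e assume "e \<in> obj E"
      then have "presentable \<alpha> C (fobj G e)" using GP P by auto
      then show "hom_preserves D C F Z c (fobj G e)"
        by (rule presentable_hom_preserves[OF cat _ \<alpha> D(1) filt F Z])
    qed
  qed
  then show ?thesis using that N(1) by blast
qed

section \<open>Closure under operations of bounded arity\<close>

text \<open>A nonempty subset of size below \<alpha> is the image of a function from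
  \<open>Field \<alpha>\<close> to \<open>B\<close>, and there are at most
  \<open>|N| ^c \<alpha>\<close> of these. The empty set, which need not be such an image, is
  counted separately.\<close>

lemma card_of_bounded_subsets:
  fixes \<alpha> :: "'i rel" and N :: "'n set" and B :: "'x set"
  assumes \<alpha>: "Cinfinite \<alpha>" and N: "infinite N" "|N| ^c \<alpha> \<le>o |N|" and B: "|B| \<le>o |N|"
  shows "|{Y. Y \<subseteq> B \<and> |Y| <o \<alpha>}| \<le>o |N|"
proof -
  let ?F = "Func (Field \<alpha>) B"
  have "{Y. Y \<subseteq> B \<and> |Y| <o \<alpha>} \<subseteq> insert {} ((\<lambda>f. f ` Field \<alpha>) ` ?F)"
  proof
    fix Y assume "Y \<in> {Y. Y \<subseteq> B \<and> |Y| <o \<alpha>}"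
    then have Y: "Y \<subseteq> B" "|Y| <o \<alpha>" by simp_all
    show "Y \<in> insert {} ((\<lambda>f. f ` Field \<alpha>) ` ?F)"
    proof (cases "Y = {}")
      case False
      have "\<alpha> =o |Field \<alpha>|" using \<alpha> card_of_Field_ordIso ordIso_symmetric by blast
      with ordLess_imp_ordLeq[OF Y(2)] have "|Y| \<le>o |Field \<alpha>|"
        by (rule ordLeq_ordIso_trans)
      from card_of_ordLeq2[OF False, THEN iffD2, OF this]
      obtain g where g: "g ` Field \<alpha> = Y" ..
      let ?f = "\<lambda>x. if x \<in> Field \<alpha> then g x else undefined"
      have "g x \<in> B" if "x \<in> Field \<alpha>" for x
        using imageI[OF that, of g] Y(1) unfolding g by blast
      then have "?f \<in> ?F" by (simp add: Func_def)
      moreover have "?f ` Field \<alpha> = g ` Field \<alpha>" by (rule image_cong) simp_all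
      then have "?f ` Field \<alpha> = Y" unfolding g .
      ultimately show ?thesis by blast
    qed simp
  qed
  moreover have "|insert {} ((\<lambda>f. f ` Field \<alpha>) ` ?F)| \<le>o |N|"
  proof -
    have "|(\<lambda>f. f ` Field \<alpha>) ` ?F| \<le>o |B| ^c \<alpha>"
      unfolding cexp_def Field_card_of by (rule card_of_image)
    moreover have "|B| ^c \<alpha> \<le>o |N| ^c \<alpha>"
      using \<alpha> by (intro cexp_mono1[OF B]) simp
    ultimately have "|(\<lambda>f. f ` Field \<alpha>) ` ?F| \<le>o |N|"
      by (rule ordLeq_transitive[OF _ ordLeq_transitive[OF _ N(2)]])
    moreover have "|{{} :: 'x set}| \<le>o |N|" using N(1) by (intro card_of_singl_ordLeq) auto
    ultimately have "|{{}} \<union> ((\<lambda>f. f ` Field \<alpha>) ` ?F)| \<le>o |N|"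
      by (intro Un_Cinfinite_bound[OF _ _ Cinfinite_card_of[OF N(1)]])
    then show ?thesis by simp
  qed
  ultimately show ?thesis by (rule ordLeq_transitive[OF card_of_mono1])
qed

text \<open>Operations of arity below \<alpha> close up after \<alpha> steps: by regularity, fewer
  than \<alpha> elements of the union already lie in one stage. The exponent condition keeps each
  stage, and hence the union of \<alpha> stages, of size at most \<open>|N|\<close>.\<close>

lemma closure_exists:
  fixes \<alpha> :: "'i rel" and N :: "'n set" and M0 :: "'x set"
  assumes \<alpha>: "Cinfinite \<alpha>" "regularCard \<alpha>"
    and N: "infinite N" "|N| ^c \<alpha> \<le>o |N|" "|Field \<alpha>| \<le>o |N|"
    and M0: "|M0| \<le>o |N|" and G: "\<And>Y. |Y| <o \<alpha> \<Longrightarrow> |G Y| \<le>o |N|"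
    and V: "M0 \<subseteq> V" "\<And>Y. Y \<subseteq> V \<Longrightarrow> |Y| <o \<alpha> \<Longrightarrow> G Y \<subseteq> V"
  shows "\<exists>M. M0 \<subseteq> M \<and> M \<subseteq> V \<and> |M| \<le>o |N| \<and> (\<forall>Y. Y \<subseteq> M \<longrightarrow> |Y| <o \<alpha> \<longrightarrow> G Y \<subseteq> M)"
proof -
  have Wo: "Well_order \<alpha>" using \<alpha>(1) card_order_on_well_order_on by blast
  then interpret wo_rel \<alpha> by (simp add: wo_rel_def)
  define step where "step B = M0 \<union> B \<union> (\<Union>Y \<in> {Y. Y \<subseteq> B \<and> |Y| <o \<alpha>}. G Y)" for B
  \<comment> \<open>One recursion equation serves for zero, successor and limit stages: each stage
    is one closure step applied to the union of all earlier ones.\<close>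
  define H where "H X i = step (\<Union>j \<in> underS i. X j)" for X :: "'i \<Rightarrow> 'x set" and i
  define X where "X = worec H"
  have "adm_wo H" unfolding adm_wo_def H_def by auto
  then have "X = H X" unfolding X_def by (rule worec_fixpoint)
  then have X: "X i = step (\<Union>j \<in> underS i. X j)" for i
    unfolding H_def by (rule fun_cong)
  have CN: "Cinfinite |N|" by (rule Cinfinite_card_of[OF N(1)])
  have step_card: "|step B| \<le>o |N|" if "|B| \<le>o |N|" for B
    unfolding step_def
    by (intro Un_Cinfinite_bound[OF _ _ CN] M0 that UNION_Cinfinite_bound[OF _ _ CN] ballI
        card_of_bounded_subsets[OF \<alpha>(1) N(1,2)]) (use G in blast)
  have X_card: "|X i| \<le>o |N|" for i
  proof (induction i rule: well_order_induct)
    case (1 i)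
    have "underS i \<subseteq> Field \<alpha>" by (auto simp: underS_def Field_def)
    then have "|underS i| \<le>o |N|" by (rule ordLeq_transitive[OF card_of_mono1 N(3)])
    moreover have "\<forall>j \<in> underS i. |X j| \<le>o |N|"
      using 1 by (simp add: underS_def)
    ultimately have "|\<Union>j \<in> underS i. X j| \<le>o |N|"
      by (rule UNION_Cinfinite_bound[OF _ _ CN])
    then show ?case unfolding X[of i] by (rule step_card)
  qed
  have X_V: "X i \<subseteq> V" for i
  proof (induction i rule: well_order_induct)
    case (1 i)
    then have "(\<Union>j \<in> underS i. X j) \<subseteq> V" by (auto simp: underS_def)
    then show ?case unfolding X[of i] step_def using V by blast
  qed
  have X_mono: "X j \<subseteq> X i" if "(j, i) \<in> \<alpha>" for i j
  proof (cases "j = i")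
    case False
    then have "j \<in> underS i" using that by (simp add: underS_def)
    then show ?thesis unfolding X[of i] step_def by blast
  qed simp
  define M where "M = (\<Union>i \<in> Field \<alpha>. X i)"
  have "Field \<alpha> \<noteq> {}" using \<alpha>(1) by (auto simp: cinfinite_def)
  then obtain i0 where "i0 \<in> Field \<alpha>" by blast
  then have "M0 \<subseteq> M" using X[of i0] by (auto simp: M_def step_def)
  moreover have "M \<subseteq> V" using X_V by (auto simp: M_def)
  moreover have "|M| \<le>o |N|"
    unfolding M_def using X_card by (intro UNION_Cinfinite_bound[OF N(3) _ CN]) blast
  moreover have "G Y \<subseteq> M" if Y: "Y \<subseteq> M" "|Y| <o \<alpha>" for Y
  proof -
    have "relChain \<alpha> X" using X_mono by (simp add: relChain_def)
    then obtain i where i: "i \<in> Field \<alpha>" "Y \<subseteq> X i"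
      using regularCard_UNION[of \<alpha> X Y] \<alpha> Y unfolding M_def by blast
    \<comment> \<open>An infinite cardinal has no last element. The values of \<open>G\<close> on
      subsets of stage \<open>i\<close> are added at any later stage \<open>k\<close>.\<close>
    then obtain k where k: "k \<in> Field \<alpha>" "i \<noteq> k" "(i, k) \<in> \<alpha>"
      using infinite_Card_order_limit[of \<alpha> i] \<alpha>(1) by (auto simp: cinfinite_def)
    then have "i \<in> underS k" by (simp add: underS_def)
    then have "G Y \<subseteq> X k" unfolding X[of k] step_def using i(2) Y(2) by blast
    then show ?thesis using k(1) by (auto simp: M_def)
  qed
  ultimately show ?thesis by (intro exI[of _ M]) simp
qed

text \<open>\<open>N\<close> is a copy of the power set of an infinite set \<open>A\<close> of size
  at least \<alpha>. Raising 2 to the power \<open>|A|\<close> and then to the power \<alpha> is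
  raising 2 to the product, which is again \<open>|A|\<close>.\<close>

lemma (in grothendieck) usmall_exponent_bound:
  fixes N0 :: "'x set" and \<alpha> :: "'u rel"
  assumes N0: "usmall U N0" and \<alpha>: "regular_cardinal \<alpha>"
  obtains N :: "'u set" where "small N" "infinite N" "|N0| \<le>o |N|"
    "|N| ^c \<alpha> \<le>o |N|" "|Field \<alpha>| \<le>o |N|"
proof -
  have C\<alpha>: "Cinfinite \<alpha>" using \<alpha> by (simp add: regular_cardinal_def)
  obtain A :: "'u set" where A: "small A" "infinite A" "|N0 <+> Field \<alpha>| \<le>o |A|"
    using usmall_bound[OF usmall_Plus[OF N0 usmall_Field_regular[OF \<alpha>]]] by blast
  obtain N :: "'u set" where N: "small N" "|N| =o |Pow A|"
    using usmall_same_card[OF usmall_Pow] A(1) unfolding small_usmall by metis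
  have "|Pow A| =o ctwo ^c |A|"
    using card_of_Pow_Func[of A] by (simp add: cexp_def ctwo_def Field_card_of)
  then have N2: "|N| =o ctwo ^c |A|" using N(2) ordIso_transitive by blast
  have AN: "|A| \<le>o |N|"
    using card_of_Pow[of A] N(2) ordIso_symmetric ordLess_imp_ordLeq ordLeq_ordIso_trans by metis
  have le: "|N0| \<le>o |A|" "|Field \<alpha>| \<le>o |A|"
    by (rule ordLeq_transitive[OF card_of_Plus1 A(3)], rule ordLeq_transitive[OF card_of_Plus2 A(3)])
  have "\<alpha> =o |Field \<alpha>|"
    using C\<alpha> card_of_Field_ordIso ordIso_symmetric by blast
  then have \<alpha>A: "\<alpha> \<le>o |A|" using le(2) by (rule ordIso_ordLeq_trans)
  have "|N| ^c \<alpha> =o (ctwo ^c |A| ) ^c \<alpha>"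
    using C\<alpha> by (intro cexp_cong1[OF N2]) simp
  also have "(ctwo ^c |A| ) ^c \<alpha> =o ctwo ^c |A|"
    by (rule cexp_cprod_ordLeq[OF Card_order_ctwo Cinfinite_card_of[OF A(2)] Cinfinite_Cnotzero[OF C\<alpha>] \<alpha>A])
  also have "ctwo ^c |A| =o |N|" by (rule ordIso_symmetric[OF N2])
  finally have "|N| ^c \<alpha> \<le>o |N|" by (rule ordIso_imp_ordLeq)
  moreover have "infinite N" using AN A(2) card_of_ordLeq_finite by blast
  ultimately show ?thesis
    by (intro that[OF N(1)] ordLeq_transitive[OF le(1) AN] ordLeq_transitive[OF le(2) AN])
qed

section \<open>Small filtered subcategories\<close>

text \<open>The set of arrows is the only datum, with objects recovered from the identities it
  contains. A subcategory can thus be obtained by closing a single set under operations, and it need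
  not be full.\<close>

definition arrow_subcategory :: "('i, 'j) category \<Rightarrow> ('i \<times> 'i \<times> 'j) set \<Rightarrow> ('i, 'j) category" where
  "arrow_subcategory D M =
     \<lparr>obj = {d. (d, d, idt D d) \<in> M}, hom = (\<lambda>d e. {f. (d, e, f) \<in> M}), idt = idt D, cmp = cmp D\<rparr>"

lemma arrow_subcategory_simps [simp]:
  "d \<in> obj (arrow_subcategory D M) \<longleftrightarrow> (d, d, idt D d) \<in> M"
  "f \<in> hom (arrow_subcategory D M) d e \<longleftrightarrow> (d, e, f) \<in> M"
  "idt (arrow_subcategory D M) = idt D" "cmp (arrow_subcategory D M) = cmp D"
  by (simp_all add: arrow_subcategory_def)

lemma is_functor_arrow_subcategory:
  assumes "is_functor D C F" "M \<subseteq> arrows D"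
  shows "is_functor (arrow_subcategory D M) C F"
  using assms unfolding is_functor_def by (auto simp: arrows_def subset_iff)

lemma is_cocone_arrow_subcategory:
  assumes "is_cocone D C F Z c" "M \<subseteq> arrows D"
  shows "is_cocone (arrow_subcategory D M) C F Z c"
  using assms unfolding is_cocone_def by (auto simp: arrows_def subset_iff)

lemma is_cocone_arrow_subcategory_mono:
  assumes "is_cocone (arrow_subcategory D M') C F Z c" "M \<subseteq> M'"
  shows "is_cocone (arrow_subcategory D M) C F Z c"
  using assms unfolding is_cocone_def by (auto simp: subset_iff)

text \<open>The clause on \<open>arrows\<close> ensures that \<open>M\<close> contains the
  identities at both ends of each of its arrows, so that no arrow is lost on passing to the
  subcategory.\<close>

definition small_filtered_part ::
  "'u rel \<Rightarrow> 'n set \<Rightarrow> ('u, 'u) category \<Rightarrow> ('u \<times> 'u \<times> 'u) set \<Rightarrow> bool" where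
  "small_filtered_part \<alpha> N D M \<longleftrightarrow> M \<subseteq> arrows D \<and> |M| \<le>o |N| \<and>
     is_category (arrow_subcategory D M) \<and> arrows (arrow_subcategory D M) = M \<and>
     filtered \<alpha> (arrow_subcategory D M)"

lemma (in grothendieck) small_category_arrow_subcategory:
  assumes D: "small_category (D :: ('u, 'u) category)" and M: "M \<subseteq> arrows D"
    and cat: "is_category (arrow_subcategory D M)"
  shows "small_category (arrow_subcategory D M)"
  unfolding small_category_def locally_small_def
proof (intro conjI ballI)
  let ?S = "arrow_subcategory D M"
  show "is_category ?S" by (rule cat)
  have obj: "d \<in> obj D" if "d \<in> obj ?S" for d using that M by (auto simp: arrows_def)
  then have "obj ?S \<subseteq> obj D" by blast
  then show "small (obj ?S)"
    using small_categoryD(2)[OF D] unfolding small_usmall by (rule usmall_subset[rotated])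
  fix d e assume "d \<in> obj ?S" "e \<in> obj ?S"
  then have "small (hom D d e)" using small_categoryD(3)[OF D] obj by blast
  moreover have "hom ?S d e \<subseteq> hom D d e" using M by (auto simp: arrows_def)
  ultimately show "small (hom ?S d e)"
    unfolding small_usmall by (rule usmall_subset)
qed

text \<open>Identities, composites and the legs of a chosen cocone on each set of fewer than
  \<alpha> arrows are operations of arity below \<alpha>, to which \<open>closure_exists\<close>
  applies. The chosen cocones of \<open>D\<close> then lie inside the closure and make it
  \<alpha>-filtered.\<close>

lemma (in grothendieck) small_filtered_part_exists:
  fixes D :: "('u, 'u) category" and N :: "'n set"
  assumes D: "is_category D" "filtered \<alpha> D" and \<alpha>: "regular_cardinal \<alpha>"
    and N: "infinite N" "|N| ^c \<alpha> \<le>o |N|" "|Field \<alpha>| \<le>o |N|"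
    and M0: "M0 \<subseteq> arrows D" "|M0| \<le>o |N|"
  obtains M where "M0 \<subseteq> M" "small_filtered_part \<alpha> N D M"
proof -
  have C\<alpha>: "Cinfinite \<alpha>" "regularCard \<alpha>" using \<alpha> by (simp_all add: regular_cardinal_def)
  have CN: "Cinfinite |N|" by (rule Cinfinite_card_of[OF N(1)])
  have "\<forall>Y. \<exists>zc. Y \<subseteq> arrows D \<and> |Y| <o \<alpha> \<longrightarrow> graph_cocone D Y (fst zc) (snd zc)"
    using filtered_graph_cocone[OF D \<alpha>] by simp
  from choice[OF this] obtain zc where zc: "\<forall>Y. Y \<subseteq> arrows D \<and> |Y| <o \<alpha> \<longrightarrow>
    graph_cocone D Y (fst (zc Y)) (snd (zc Y))" ..
  define z \<kappa> where "z = fst \<circ> zc" and "\<kappa> = snd \<circ> zc"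
  have z\<kappa>: "graph_cocone D Y (z Y) (\<kappa> Y)" if "Y \<subseteq> arrows D" "|Y| <o \<alpha>" for Y
    using zc that by (simp add: z_def \<kappa>_def)
  define G where "G Y = {(z Y, z Y, idt D (z Y))} \<union>
      (\<lambda>(s, t, f). (s, z Y, \<kappa> Y s)) ` Y \<union> (\<lambda>(s, t, f). (t, z Y, \<kappa> Y t)) ` Y \<union>
      (\<lambda>(s, t, f). (s, s, idt D s)) ` Y \<union> (\<lambda>(s, t, f). (t, t, idt D t)) ` Y \<union>
      (\<lambda>((s, t, f), (_, t', g)). (s, t', cmp D s t t' g f)) ` {(y, y'). y \<in> Y \<and> y' \<in> Y \<and> fst (snd y) = fst y'}"
    for Y
  have G_I: "(s, s, idt D s) \<in> G Y" "(t, t, idt D t) \<in> G Y"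
    "(s, z Y, \<kappa> Y s) \<in> G Y" "(t, z Y, \<kappa> Y t) \<in> G Y" if "(s, t, f) \<in> Y" for s t f Y
    unfolding G_def Un_iff by (simp_all add: bexI[OF _ that] image_iff split_beta)
  have G_comp: "(s, t', cmp D s t t' g f) \<in> G Y" if "(s, t, f) \<in> Y" "(t, t', g) \<in> Y" for s t f t' g Y
    unfolding G_def by (rule UnI2, rule image_eqI[of _ _ "((s, t, f), (t, t', g))"]) (simp_all add: that)
  have G_card: "|G Y| \<le>o |N|" if "|Y| <o \<alpha>" for Y
  proof -
    have "\<alpha> =o |Field \<alpha>|" using C\<alpha> card_of_Field_ordIso ordIso_symmetric by blast
    then have "\<alpha> \<le>o |N|" using N(3) by (rule ordIso_ordLeq_trans)
    then have Y: "|Y| \<le>o |N|" using ordLess_imp_ordLeq[OF that] ordLeq_transitive by blast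
    then have img: "|f ` Y| \<le>o |N|" for f :: "'u \<times> 'u \<times> 'u \<Rightarrow> 'u \<times> 'u \<times> 'u"
      using card_of_image ordLeq_transitive by blast
    have "|Y \<times> Y| \<le>o |N|"
      using card_of_Times_ordLeq_infinite_Field[OF _ Y Y card_of_Card_order] N(1)
      by (simp add: Field_card_of)
    moreover have "{(y, y'). y \<in> Y \<and> y' \<in> Y \<and> fst (snd y) = fst y'} \<subseteq> Y \<times> Y" by auto
    ultimately have "|{(y, y'). y \<in> Y \<and> y' \<in> Y \<and> fst (snd y) = fst y'}| \<le>o |N|"
      by (rule ordLeq_transitive[OF card_of_mono1, rotated])
    then have "|f ` {(y, y'). y \<in> Y \<and> y' \<in> Y \<and> fst (snd y) = fst y'}| \<le>o |N|"
      for f :: "('u \<times> 'u \<times> 'u) \<times> ('u \<times> 'u \<times> 'u) \<Rightarrow> 'u \<times> 'u \<times> 'u"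
      using card_of_image ordLeq_transitive by blast
    moreover have "|{(z Y, z Y, idt D (z Y))}| \<le>o |N|" using N(1) by (intro card_of_singl_ordLeq) auto
    ultimately show ?thesis
      unfolding G_def by (intro Un_Cinfinite_bound[OF _ _ CN] img)
  qed
  have G_arr: "G Y \<subseteq> arrows D" if Y: "Y \<subseteq> arrows D" "|Y| <o \<alpha>" for Y
  proof -
    note gc = z\<kappa>[OF Y]
    have zD: "z Y \<in> obj D" using gc by (simp add: graph_cocone_def)
    have arr: "s \<in> obj D \<and> t \<in> obj D \<and> f \<in> hom D s t \<and> \<kappa> Y s \<in> hom D s (z Y) \<and> \<kappa> Y t \<in> hom D t (z Y)"
      if "(s, t, f) \<in> Y" for s t f
      using graph_coconeD(1,2)[OF gc that] that Y(1) by (auto simp: arrows_def)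
    have "(s, t', cmp D s t t' g f) \<in> arrows D" if "(s, t, f) \<in> Y" "(t, t', g) \<in> Y" for s t t' f g
      using arr[OF that(1)] arr[OF that(2)] cmp_in[OF D(1)] by (simp add: arrows_def)
    note comp = this
    note arr' = arr[of "fst y" "fst (snd y)" "snd (snd y)" for y]
    show ?thesis
      unfolding G_def
    proof (intro Un_least image_subsetI, goal_cases)
      case 1
      then show ?case using zD idt_in[OF D(1)] by (simp add: arrows_def)
    next
      case (2 y)
      then show ?case using arr'[of y] zD by (simp add: arrows_def split_beta)
    next
      case (3 y)
      then show ?case using arr'[of y] zD by (simp add: arrows_def split_beta)
    next
      case (4 y)
      then show ?case using arr'[of y] idt_in[OF D(1)] by (simp add: arrows_def split_beta)
    next
      case (5 y)
      then show ?case using arr'[of y] idt_in[OF D(1)] by (simp add: arrows_def split_beta)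
    next
      case (6 y)
      then show ?case by (auto intro: comp)
    qed
  qed
  from closure_exists[OF C\<alpha> N M0(2) G_card M0(1) G_arr]
  obtain M where "M0 \<subseteq> M \<and> M \<subseteq> arrows D \<and> |M| \<le>o |N| \<and>
    (\<forall>Y. Y \<subseteq> M \<longrightarrow> |Y| <o \<alpha> \<longrightarrow> G Y \<subseteq> M)" ..
  then have M: "M0 \<subseteq> M" "M \<subseteq> arrows D" "|M| \<le>o |N|"
    and cl: "\<And>Y. Y \<subseteq> M \<Longrightarrow> |Y| <o \<alpha> \<Longrightarrow> G Y \<subseteq> M" by simp_all
  let ?S = "arrow_subcategory D M"
  have fin: "G Y \<subseteq> M" if "Y \<subseteq> M" "finite Y" for Y
    using cl[OF that(1)] finite_ordLess_Cinfinite[OF that(2) C\<alpha>(1)] by blast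
  have ids: "(s, s, idt D s) \<in> M" "(t, t, idt D t) \<in> M" if "(s, t, f) \<in> M" for s t f
  proof -
    have "G {(s, t, f)} \<subseteq> M" using fin[of "{(s, t, f)}"] that by simp
    then show "(s, s, idt D s) \<in> M" "(t, t, idt D t) \<in> M"
      using G_I(1,2)[of s t f "{(s, t, f)}"] by auto
  qed
  have comp: "(s, t', cmp D s t t' g f) \<in> M" if "(s, t, f) \<in> M" "(t, t', g) \<in> M" for s t t' f g
  proof -
    have "G {(s, t, f), (t, t', g)} \<subseteq> M" using fin[of "{(s, t, f), (t, t', g)}"] that by simp
    then show ?thesis by (rule subsetD[OF _ G_comp]) simp_all
  qed
  have arr: "s \<in> obj D \<and> t \<in> obj D \<and> f \<in> hom D s t" if "(s, t, f) \<in> M" for s t f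
    using M(2) that by (auto simp: arrows_def)
  have "is_category ?S"
    unfolding is_category_def arrow_subcategory_simps
    using comp arr cmp_idt[OF D(1)] idt_cmp[OF D(1)] cmp_assoc[OF D(1)] by simp
  moreover have arrS: "arrows ?S = M"
    using ids by (auto simp: arrows_def)
  moreover have "filtered \<alpha> ?S"
  proof (rule filteredI)
    fix Y assume Y: "Y \<subseteq> arrows ?S" "|Y| <o \<alpha>"
    then have YM: "Y \<subseteq> M" and GM: "G Y \<subseteq> M" using cl arrS by simp_all
    have YD: "Y \<subseteq> arrows D" using YM M(2) by blast
    note gc = z\<kappa>[OF YD Y(2)]
    have "graph_cocone ?S Y (z Y) (\<kappa> Y)"
      unfolding graph_cocone_def
    proof (intro conjI ballI, goal_cases)
      case 1
      show ?case using GM by (simp add: G_def)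
    next
      case (2 y)
      obtain s t f where y: "y = (s, t, f)" by (cases y)
      have "(s, z Y, \<kappa> Y s) \<in> G Y" "(t, z Y, \<kappa> Y t) \<in> G Y"
        using G_I(3,4) 2 unfolding y by blast+
      then show ?case using y GM graph_coconeD(3)[OF gc] 2 by auto
    qed
    then show "\<exists>z c. graph_cocone ?S Y z c" by blast
  qed
  ultimately have "small_filtered_part \<alpha> N D M"
    using M by (simp add: small_filtered_part_def)
  then show ?thesis using that M(1) by blast
qed

section \<open>Raising the index of accessibility\<close>

text \<open>
  Colimits depend only on the underlying graph of a diagram.  A tuple \<open>(n, i, m, j, f)\<close> in a code
  is an edge from the vertex \<open>n\<close>, carrying the object \<open>P i\<close>, to the vertex \<open>m\<close>, carrying \<open>P j\<close>.
\<close>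

definition code_cocone ::
  "('o, 'm) category \<Rightarrow> ('p \<Rightarrow> 'o) \<Rightarrow> ('n \<times> 'p \<times> 'n \<times> 'p \<times> 'm) set \<Rightarrow> 'o \<Rightarrow> ('n \<Rightarrow> 'm) \<Rightarrow> bool" where
  "code_cocone C P T W e \<longleftrightarrow> W \<in> obj C \<and>
     (\<forall>(n, i, m, j, f) \<in> T. e n \<in> hom C (P i) W \<and> cmp C (P i) (P j) W (e m) f = e n)"

definition code_colimit ::
  "('o, 'm) category \<Rightarrow> ('p \<Rightarrow> 'o) \<Rightarrow> ('n \<times> 'p \<times> 'n \<times> 'p \<times> 'm) set \<Rightarrow> 'o \<Rightarrow> ('n \<Rightarrow> 'm) \<Rightarrow> bool" where
  "code_colimit C P T Z e \<longleftrightarrow> code_cocone C P T Z e \<and>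
     (\<forall>W e'. code_cocone C P T W e' \<longrightarrow>
        (\<exists>!u. u \<in> hom C Z W \<and> (\<forall>(n, i, m, j, f) \<in> T. cmp C (P i) Z W u (e n) = e' n)))"

lemma is_cocone_cong:
  assumes "\<And>d. d \<in> obj D \<Longrightarrow> c d = c' d"
  shows "is_cocone D C F Z c \<longleftrightarrow> is_cocone D C F Z c'"
  using assms by (simp add: is_cocone_def)

text \<open>\<open>\<phi>\<close> labels the objects of \<open>S\<close>, and \<open>\<iota>\<close>
  names their values among the generators. The identities in \<open>arrows S\<close> become loops of
  \<open>T\<close>, so every object leaves a trace in the code. Diagrams with the same code have the
  same colimits, whatever their index categories.\<close>

locale diagram_code =
  fixes S :: "('s, 't) category" and C :: "('o, 'm) category" and F :: "('s, 't, 'o, 'm) funct"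
    and P :: "'p \<Rightarrow> 'o" and \<iota> :: "'s \<Rightarrow> 'p" and \<phi> :: "'s \<Rightarrow> 'n" and T
  assumes S: "is_category S" and \<iota>: "\<And>s. s \<in> obj S \<Longrightarrow> P (\<iota> s) = fobj F s"
    and \<phi>: "inj_on \<phi> (obj S)"
    and T: "T = (\<lambda>(s, t, u). (\<phi> s, \<iota> s, \<phi> t, \<iota> t, fmap F s t u)) ` arrows S"
begin

lemma id_arrow: "s \<in> obj S \<Longrightarrow> (s, s, idt S s) \<in> arrows S"
  using idt_in[OF S] by (simp add: arrows_def)

lemma code_cocone_iff: "code_cocone C P T W e \<longleftrightarrow> is_cocone S C F W (\<lambda>s. e (\<phi> s))"
proof
  assume L: "code_cocone C P T W e"
  have *: "e (\<phi> s) \<in> hom C (fobj F s) W \<and>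
      cmp C (fobj F s) (fobj F t) W (e (\<phi> t)) (fmap F s t u) = e (\<phi> s)"
    if "(s, t, u) \<in> arrows S" for s t u
  proof -
    have "(\<phi> s, \<iota> s, \<phi> t, \<iota> t, fmap F s t u) \<in> T"
      unfolding T by (rule image_eqI[OF _ that]) simp
    then show ?thesis using L that \<iota> by (auto simp: code_cocone_def arrows_def)
  qed
  then show "is_cocone S C F W (\<lambda>s. e (\<phi> s))"
    using L id_arrow unfolding is_cocone_def code_cocone_def by (auto simp: arrows_def)
next
  assume R: "is_cocone S C F W (\<lambda>s. e (\<phi> s))"
  show "code_cocone C P T W e"
    unfolding code_cocone_def
  proof (intro conjI ballI, goal_cases)
    case 1
    then show ?case using R by (simp add: is_cocone_def)
  next
    case (2 x)
    then obtain s t u where "(s, t, u) \<in> arrows S" "x = (\<phi> s, \<iota> s, \<phi> t, \<iota> t, fmap F s t u)"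
      unfolding T by auto
    then show ?case using R \<iota> by (auto simp: is_cocone_def arrows_def)
  qed
qed

lemma code_map_iff:
  "(\<forall>(n, i, m, j, f) \<in> T. cmp C (P i) Z W u (e n) = e' n) \<longleftrightarrow>
   (\<forall>s \<in> obj S. cmp C (fobj F s) Z W u (e (\<phi> s)) = e' (\<phi> s))"
proof
  assume L: "\<forall>(n, i, m, j, f) \<in> T. cmp C (P i) Z W u (e n) = e' n"
  show "\<forall>s \<in> obj S. cmp C (fobj F s) Z W u (e (\<phi> s)) = e' (\<phi> s)"
  proof
    fix s assume s: "s \<in> obj S"
    have "(\<phi> s, \<iota> s, \<phi> s, \<iota> s, fmap F s s (idt S s)) \<in> T"
      unfolding T by (rule image_eqI[OF _ id_arrow[OF s]]) simp
    then show "cmp C (fobj F s) Z W u (e (\<phi> s)) = e' (\<phi> s)" using L \<iota>[OF s] by auto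
  qed
next
  assume "\<forall>s \<in> obj S. cmp C (fobj F s) Z W u (e (\<phi> s)) = e' (\<phi> s)"
  then show "\<forall>(n, i, m, j, f) \<in> T. cmp C (P i) Z W u (e n) = e' n"
    using \<iota> unfolding T by (auto simp: arrows_def)
qed

lemma code_colimitI:
  assumes "is_colimit S C F Z c"
  shows "\<exists>e. code_colimit C P T Z e"
proof -
  let ?e = "\<lambda>n. c (inv_into (obj S) \<phi> n)"
  have e: "?e (\<phi> s) = c s" if "s \<in> obj S" for s
    using inv_into_f_f[OF \<phi> that] by simp
  have "code_cocone C P T Z ?e"
    unfolding code_cocone_iff
    by (rule is_cocone_cong[THEN iffD2, OF _ colimit_coconeD[OF assms]]) (rule e)
  moreover have "\<exists>!u. u \<in> hom C Z W \<and> (\<forall>(n, i, m, j, f) \<in> T. cmp C (P i) Z W u (?e n) = e' n)"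
    if "code_cocone C P T W e'" for W e'
    using assms that unfolding code_cocone_iff code_map_iff is_colimit_def by (simp add: e)
  ultimately show ?thesis unfolding code_colimit_def by blast
qed

lemma colimit_of_code:
  assumes "code_colimit C P T Z e"
  shows "is_colimit S C F Z (\<lambda>s. e (\<phi> s))"
  unfolding is_colimit_def
proof (intro conjI allI impI)
  show "is_cocone S C F Z (\<lambda>s. e (\<phi> s))"
    using assms by (simp add: code_colimit_def code_cocone_iff)
  fix W d assume d: "is_cocone S C F W d"
  let ?e' = "\<lambda>n. d (inv_into (obj S) \<phi> n)"
  have e': "?e' (\<phi> s) = d s" if "s \<in> obj S" for s
    using inv_into_f_f[OF \<phi> that] by simp
  have "code_cocone C P T W ?e'"
    unfolding code_cocone_iff by (rule is_cocone_cong[THEN iffD2, OF _ d]) (rule e')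
  then have "\<exists>!u. u \<in> hom C Z W \<and> (\<forall>(n, i, m, j, f) \<in> T. cmp C (P i) Z W u (e n) = ?e' n)"
    using assms unfolding code_colimit_def by blast
  then show "\<exists>!u. u \<in> hom C Z W \<and> (\<forall>s \<in> obj S. cmp C (fobj F s) Z W u (e (\<phi> s)) = d s)"
    unfolding code_map_iff by (simp add: e')
qed

end

text \<open>There is no small set of all index categories \<open>S\<close>, but every code is a
  subset of one small set, and one chosen colimit per code suffices. A code without a colimit
  contributes an arbitrary value to \<open>Q\<close>.\<close>

lemma (in grothendieck) small_set_of_colimits:
  fixes C :: "('o, 'u) category" and P :: "'u \<Rightarrow> 'o" and N :: "'u set"
  assumes C: "is_category C" "locally_small C" and I: "small I" "\<And>i. i \<in> I \<Longrightarrow> P i \<in> obj C"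
    and N: "small N"
  shows "\<exists>Q :: 'o set. usmall U Q \<and> (\<forall>(S :: ('u, 'u) category) F Z c.
    is_category S \<and> |arrows S| \<le>o |N| \<and> is_functor S C F \<and>
    (\<forall>s \<in> obj S. fobj F s \<in> P ` I) \<and> is_colimit S C F Z c \<longrightarrow>
    (\<exists>Z' \<in> Q. \<exists>c'. is_colimit S C F Z' c'))"
proof -
  define H where "H = (\<Union>i \<in> I. \<Union>j \<in> I. hom C (P i) (P j))"
  define Ts where "Ts = Pow (N \<times> I \<times> N \<times> I \<times> H)"
  define Q where "Q = (\<lambda>T. SOME Z. \<exists>e. code_colimit C P T Z e) ` Ts"
  have H: "usmall U H"
    unfolding H_def using I C(2)
    by (intro usmall_UN) (simp_all add: small_usmall[symmetric] locally_small_def)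
  have sm: "usmall U N" "usmall U I" using N I(1) by (simp_all add: small_usmall)
  have "usmall U Q"
    unfolding Q_def Ts_def by (intro usmall_image usmall_Pow usmall_Sigma sm H)
  moreover have "\<exists>Z' \<in> Q. \<exists>c'. is_colimit S C F Z' c'"
    if S: "is_category S" "|arrows S| \<le>o |N|" and F: "is_functor S C F"
      and FP: "\<forall>s \<in> obj S. fobj F s \<in> P ` I" and Z: "is_colimit S C F Z c"
    for S :: "('u, 'u) category" and F Z c
  proof -
    have "obj S \<subseteq> fst ` arrows S"
      using idt_in[OF S(1)] by (force simp: arrows_def)
    then have "|obj S| \<le>o |N|"
      by (rule ordLeq_transitive[OF card_of_mono1 ordLeq_transitive[OF card_of_image S(2)]])
    then obtain \<phi> where vx: "inj_on \<phi> (obj S)" "\<phi> ` obj S \<subseteq> N"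
      using card_of_ordLeq[of "obj S" N] by blast
    have "\<forall>s. \<exists>i. s \<in> obj S \<longrightarrow> i \<in> I \<and> P i = fobj F s" using FP by fastforce
    from choice[OF this] obtain \<iota> where ix: "\<forall>s. s \<in> obj S \<longrightarrow> \<iota> s \<in> I \<and> P (\<iota> s) = fobj F s" ..
    define T where "T = (\<lambda>(s, t, u). (\<phi> s, \<iota> s, \<phi> t, \<iota> t, fmap F s t u)) ` arrows S"
    interpret diagram_code S C F P \<iota> \<phi> T
      using S(1) vx(1) ix T_def by unfold_locales simp_all
    have "T \<in> Ts"
    proof -
      have "fmap F s t u \<in> H" if "(s, t, u) \<in> arrows S" for s t u
      proof -
        have st: "s \<in> obj S" "t \<in> obj S" "u \<in> hom S s t" using that by (simp_all add: arrows_def)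
        have "fmap F s t u \<in> hom C (P (\<iota> s)) (P (\<iota> t))"
          using fmap_in[OF F st(3,1,2)] ix st by simp
        moreover have "\<iota> s \<in> I" "\<iota> t \<in> I" using ix st by simp_all
        ultimately show ?thesis unfolding H_def by (intro UN_I)
      qed
      then show ?thesis unfolding Ts_def T_def using vx(2) ix by (auto simp: arrows_def)
    qed
    moreover have "\<exists>e. code_colimit C P T (SOME Z. \<exists>e. code_colimit C P T Z e) e"
      using code_colimitI[OF Z] by (rule someI)
    ultimately show ?thesis unfolding Q_def using colimit_of_code by blast
  qed
  ultimately show ?thesis by (intro exI[of _ Q] conjI allI impI) blast+
qed

text \<open>
  The object \<open>X\<close> is the colimit, over the poset of small filtered parts \<open>M\<close> of its diagram, of the
  colimits \<open>L M\<close> of the restrictions to \<open>M\<close>.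
\<close>

lemma (in grothendieck) colimit_of_small_parts:
  fixes C :: "('o, 'u) category" and D :: "('u, 'u) category" and N :: "'u set"
  assumes C: "is_category C" and D: "small_category D" "filtered \<alpha> D" and \<alpha>: "regular_cardinal \<alpha>"
    and F: "is_functor D C F" and X: "is_colimit D C F X c"
    and N: "infinite N" "|N| ^c \<alpha> \<le>o |N|" "|Field \<alpha>| \<le>o |N|"
    and Q: "\<And>M. small_filtered_part \<alpha> N D M \<Longrightarrow>
      \<exists>Z \<in> Q. \<exists>l. is_colimit (arrow_subcategory D M) C F Z l"
  shows "colimit_from (le_filtered N) C Q X"
proof -
  note DD = small_categoryD(1)[OF D(1)]
  define good where "good M \<longleftrightarrow> small_filtered_part \<alpha> N D M" for M
  have good_arr: "M \<subseteq> arrows D" if "good M" for M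
    using that by (simp add: good_def small_filtered_part_def)
  have good_card: "|M| \<le>o |N|" if "good M" for M
    using that by (simp add: good_def small_filtered_part_def)
  have good_ex: "\<exists>M. M0 \<subseteq> M \<and> good M" if "M0 \<subseteq> arrows D" "|M0| \<le>o |N|" for M0
    using small_filtered_part_exists[OF DD D(2) \<alpha> N that] unfolding good_def by blast
  have CN: "Cinfinite |N|" by (rule Cinfinite_card_of[OF N(1)])
  have good2: "\<exists>M''. M \<subseteq> M'' \<and> M' \<subseteq> M'' \<and> good M''" if "good M" "good M'" for M M'
    using good_ex[of "M \<union> M'"] good_arr that Un_Cinfinite_bound[OF good_card good_card CN] by auto
  have good_arr_ex: "\<exists>M. a \<in> M \<and> good M" if "a \<in> arrows D" for a
  proof -
    have "|{a}| \<le>o |N|" using N(1) by (intro card_of_singl_ordLeq) auto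
    then show ?thesis using good_ex[of "{a}"] that by auto
  qed
  let ?S = "arrow_subcategory D"
  have good_cat: "is_category (?S M)" "arrows (?S M) = M" if "good M" for M
    using that by (simp_all add: good_def small_filtered_part_def)
  have good_fun: "is_functor (?S M) C F" if "good M" for M
    by (rule is_functor_arrow_subcategory[OF F good_arr[OF that]])
  have good_id: "(s, s, idt D s) \<in> M" "(t, t, idt D t) \<in> M" if "good M" "(s, t, f) \<in> M" for M s t f
  proof -
    have "(s, t, f) \<in> arrows (?S M)" using that good_cat by simp
    then show "(s, s, idt D s) \<in> M" "(t, t, idt D t) \<in> M" by (simp_all add: arrows_def)
  qed
  have dD: "d \<in> obj D" if "good M" "(d, d, idt D d) \<in> M" for M d
    using good_arr[OF that(1)] that(2) by (auto simp: arrows_def)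
  have "\<exists>Z l. Z \<in> Q \<and> is_colimit (?S M) C F Z l" if "good M" for M
    using Q that unfolding good_def by blast
  then obtain L l where Ll: "\<forall>M. good M \<longrightarrow> L M \<in> Q \<and> is_colimit (?S M) C F (L M) (l M)"
    by (rule choice_on2)
  note LQ = Ll[rule_format, THEN conjunct1] and Lcol = Ll[rule_format, THEN conjunct2]
  note Lobj = colimit_objD[OF Lcol] and Lcoc = colimit_coconeD[OF Lcol]
  have l_in: "l M d \<in> hom C (fobj F d) (L M)" if "good M" "(d, d, idt D d) \<in> M" for M d
    using cocone_inD[OF Lcoc[OF that(1)]] that(2) by simp
  note XC = colimit_objD[OF X] and cX = colimit_coconeD[OF X]
  note FC = fobj_in[OF F]
  have L_eqI: "u = v"
    if "good M" "W \<in> obj C" "u \<in> hom C (L M) W" "v \<in> hom C (L M) W"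
      "\<And>d. (d, d, idt D d) \<in> M \<Longrightarrow> cmp C (fobj F d) (L M) W u (l M d) = cmp C (fobj F d) (L M) W v (l M d)"
    for M W u v
    by (rule colimit_eqI[OF C good_fun[OF that(1)] Lcol[OF that(1)] that(2-4)]) (use that(5) in simp)
  have "\<exists>u. u \<in> hom C (L (fst p)) (L (snd p)) \<and> (\<forall>d. (d, d, idt D d) \<in> fst p \<longrightarrow>
        cmp C (fobj F d) (L (fst p)) (L (snd p)) u (l (fst p) d) = l (snd p) d)"
    if p: "good (fst p) \<and> good (snd p) \<and> fst p \<subseteq> snd p" for p
  proof -
    have "is_cocone (?S (fst p)) C F (L (snd p)) (l (snd p))"
      using p is_cocone_arrow_subcategory_mono[OF Lcoc] by blast
    from colimit_map[OF Lcol this] p show ?thesis by (metis arrow_subcategory_simps(1))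
  qed
  then obtain t' where t': "\<forall>p. good (fst p) \<and> good (snd p) \<and> fst p \<subseteq> snd p \<longrightarrow>
     t' p \<in> hom C (L (fst p)) (L (snd p)) \<and> (\<forall>d. (d, d, idt D d) \<in> fst p \<longrightarrow>
        cmp C (fobj F d) (L (fst p)) (L (snd p)) (t' p) (l (fst p) d) = l (snd p) d)"
    by (rule choice_on1)
  define t where "t M M' = t' (M, M')" for M M'
  have t_in: "t M M' \<in> hom C (L M) (L M')"
    and t_l: "(d, d, idt D d) \<in> M \<Longrightarrow> cmp C (fobj F d) (L M) (L M') (t M M') (l M d) = l M' d"
    if "good M" "good M'" "M \<subseteq> M'" for M M' d
    using t'[rule_format, of "(M, M')"] that by (simp_all add: t_def)
  have "\<exists>u. u \<in> hom C (L M) X \<and> (\<forall>d. (d, d, idt D d) \<in> M \<longrightarrow> cmp C (fobj F d) (L M) X u (l M d) = c d)"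
    if M: "good M" for M
    using colimit_map[OF Lcol[OF M] is_cocone_arrow_subcategory[OF cX good_arr[OF M]]]
    by (metis arrow_subcategory_simps(1))
  then obtain r where r: "\<forall>M. good M \<longrightarrow> r M \<in> hom C (L M) X \<and>
     (\<forall>d. (d, d, idt D d) \<in> M \<longrightarrow> cmp C (fobj F d) (L M) X (r M) (l M d) = c d)"
    by (rule choice_on1)
  note r_in = r[rule_format, THEN conjunct1]
    and r_l = r[rule_format, THEN conjunct2, rule_format]
  have t_id: "t M M = idt C (L M)" if M: "good M" for M
    by (rule L_eqI[OF M Lobj[OF M] t_in[OF M M order_refl] idt_in[OF C Lobj[OF M]]])
      (simp add: t_l[OF M M order_refl] idt_cmp[OF C l_in[OF M] FC[OF dD[OF M]] Lobj[OF M]])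
  have push: "cmp C (fobj F d) (L M) W (cmp C (L M) (L M') W v (t M M')) (l M d) =
      cmp C (fobj F d) (L M') W v (l M' d)"
    if "good M" "good M'" "M \<subseteq> M'" "W \<in> obj C" "v \<in> hom C (L M') W" "(d, d, idt D d) \<in> M" for d M M' W v
    using cmp_assoc[OF C l_in[OF that(1,6)] t_in[OF that(1-3)] that(5) FC[OF dD[OF that(1,6)]]
        Lobj[OF that(1)] Lobj[OF that(2)] that(4)] t_l[OF that(1-3,6)] by simp
  have t_cmp: "t M M'' = cmp C (L M) (L M') (L M'') (t M' M'') (t M M')"
    if M: "good M" "good M'" "good M''" "M \<subseteq> M'" "M' \<subseteq> M''" for M M' M''
  proof (rule L_eqI[OF M(1) Lobj[OF M(3)]])
    have sub: "M \<subseteq> M''" using M by blast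
    show "t M M'' \<in> hom C (L M) (L M'')" by (rule t_in[OF M(1,3) sub])
    show "cmp C (L M) (L M') (L M'') (t M' M'') (t M M') \<in> hom C (L M) (L M'')"
      by (rule cmp_in[OF C t_in[OF M(1,2,4)] t_in[OF M(2,3,5)] Lobj[OF M(1)] Lobj[OF M(2)] Lobj[OF M(3)]])
    fix d assume d: "(d, d, idt D d) \<in> M"
    then have "(d, d, idt D d) \<in> M'" using M(4) by blast
    then show "cmp C (fobj F d) (L M) (L M'') (t M M'') (l M d) =
      cmp C (fobj F d) (L M) (L M'') (cmp C (L M) (L M') (L M'') (t M' M'') (t M M')) (l M d)"
      using push[OF M(1,2,4) Lobj[OF M(3)] t_in[OF M(2,3,5)] d] t_l[OF M(1,3) sub d]
        t_l[OF M(2,3,5)] by simp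
  qed
  have r_t: "cmp C (L M) (L M') X (r M') (t M M') = r M" if M: "good M" "good M'" "M \<subseteq> M'" for M M'
  proof (rule L_eqI[OF M(1) XC _ r_in[OF M(1)]])
    show "cmp C (L M) (L M') X (r M') (t M M') \<in> hom C (L M) X"
      by (rule cmp_in[OF C t_in[OF M] r_in[OF M(2)] Lobj[OF M(1)] Lobj[OF M(2)] XC])
    fix d assume d: "(d, d, idt D d) \<in> M"
    then have "(d, d, idt D d) \<in> M'" using M(3) by blast
    then show "cmp C (fobj F d) (L M) X (cmp C (L M) (L M') X (r M') (t M M')) (l M d) =
      cmp C (fobj F d) (L M) X (r M) (l M d)"
      using push[OF M XC r_in[OF M(2)] d] r_l[OF M(1) d] r_l[OF M(2)] by simp
  qed

  have "usmall U (Collect good)"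
    using usmall_subset[OF usmall_Pow[OF usmall_arrows[OF D(1)]]] good_arr by blast
  then obtain \<iota> :: "('u \<times> 'u \<times> 'u) set \<Rightarrow> 'u" where \<iota>: "inj_on \<iota> (Collect good)"
    by (rule usmall_embed)
  define dec where "dec = inv_into (Collect good) \<iota>"
  have dec: "dec (\<iota> M) = M" if "good M" for M
    using inv_into_f_f[OF \<iota>] that by (simp add: dec_def)
  \<comment> \<open>The inclusion order of the good parts as a category on \<open>'u\<close>: parts
    are coded by \<open>\<iota>\<close>, and \<open>undefined\<close> is the only possible
    arrow.\<close>
  define E :: "('u, 'u) category" where
    "E = \<lparr>obj = \<iota> ` Collect good, hom = (\<lambda>x y. if dec x \<subseteq> dec y then {undefined} else {}),
          idt = (\<lambda>x. undefined), cmp = (\<lambda>x y z g f. undefined)\<rparr>"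
  have E_simps: "obj E = \<iota> ` Collect good" "f \<in> hom E x y \<longleftrightarrow> dec x \<subseteq> dec y \<and> f = undefined"
    "idt E x = undefined" "cmp E x y z g f = undefined" for x y z f g
    by (simp_all add: E_def)
  have dec_good: "good (dec x)" if "x \<in> obj E" for x
    using that dec by (auto simp: E_simps)
  have "is_category E"
    unfolding is_category_def by (auto simp: E_simps(2-))
  then have small_E: "small_category E"
    unfolding small_category_def locally_small_def small_usmall
  proof (intro conjI ballI)
    show "usmall U (obj E)" unfolding E_simps(1) by (rule usmall_image[OF \<open>usmall U (Collect good)\<close>])
    show "usmall U (hom E x y)" for x y by (rule usmall_finite) (simp add: E_def)
  qed
  have filt_E: "le_filtered N E"
    unfolding le_filtered_def
  proof (intro allI impI)
    fix Y assume Y: "Y \<subseteq> arrows E" "|Y| \<le>o |N|"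
    \<comment> \<open>At most \<open>|N|\<close> good parts have together at most \<open>|N|\<close>
      arrows, so one good part contains them all. This is where the higher filteredness comes
      from.\<close>
    let ?M0 = "\<Union>y \<in> Y. dec (fst y) \<union> dec (fst (snd y))"
    have gY: "good (dec (fst y))" "good (dec (fst (snd y)))" if "y \<in> Y" for y
      using that Y(1) dec_good by (auto simp: arrows_def)
    have "|?M0| \<le>o |N|"
      by (intro UNION_Cinfinite_bound[OF Y(2) _ CN] ballI Un_Cinfinite_bound[OF good_card good_card CN] gY)
    moreover have "?M0 \<subseteq> arrows D"
      by (intro UN_least Un_least good_arr gY)
    ultimately obtain M where M: "?M0 \<subseteq> M" "good M" using good_ex[of ?M0] by blast
    have "graph_cocone E Y (\<iota> M) (\<lambda>_. undefined)"
      unfolding graph_cocone_def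
    proof (intro conjI ballI, goal_cases)
      case 1
      then show ?case using M(2) by (simp add: E_simps(1))
    next
      case (2 y)
      obtain x x' f where y: "y = (x, x', f)" by (cases y)
      have "dec x \<subseteq> M" "dec x' \<subseteq> M" using M(1) 2 y by force+
      then show ?case by (simp add: y E_simps(2-) dec[OF M(2)])
    qed
    then show "\<exists>z c. graph_cocone E Y z c" by blast
  qed
  define G :: "('u, 'u, 'o, 'u) funct" where
    "G = \<lparr>fobj = (\<lambda>x. L (dec x)), fmap = (\<lambda>x y f. t (dec x) (dec y))\<rparr>"
  have G_simps: "fobj G x = L (dec x)" "fmap G x y f = t (dec x) (dec y)" for x y f
    by (simp_all add: G_def)
  have G: "is_functor E C G"
    unfolding is_functor_def G_simps
  proof (intro conjI ballI)
    fix x assume x: "x \<in> obj E"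
    note gx = dec_good[OF x]
    show "L (dec x) \<in> obj C" by (rule Lobj[OF gx])
    show "t (dec x) (dec x) = idt C (L (dec x))" by (rule t_id[OF gx])
    fix y f assume y: "y \<in> obj E" and f: "f \<in> hom E x y"
    note gy = dec_good[OF y]
    have xy: "dec x \<subseteq> dec y" using f by (simp add: E_simps(2))
    show "t (dec x) (dec y) \<in> hom C (L (dec x)) (L (dec y))" by (rule t_in[OF gx gy xy])
    fix z g assume z: "z \<in> obj E" and g: "g \<in> hom E y z"
    have yz: "dec y \<subseteq> dec z" using g by (simp add: E_simps(2))
    show "t (dec x) (dec z) =
        cmp C (L (dec x)) (L (dec y)) (L (dec z)) (t (dec y) (dec z)) (t (dec x) (dec y))"
      by (rule t_cmp[OF gx gy dec_good[OF z] xy yz])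
  qed
  have cocone: "is_cocone E C G X (\<lambda>x. r (dec x))"
    unfolding is_cocone_def G_simps
    using XC r_in r_t dec_good by (simp add: E_simps(2-))
  have "is_colimit E C G X (\<lambda>x. r (dec x))"
    unfolding is_colimit_def
  proof (intro conjI allI impI)
    show "is_cocone E C G X (\<lambda>x. r (dec x))" by (rule cocone)
    fix W e' assume e': "is_cocone E C G W e'"
    have WC: "W \<in> obj C" using e' by (simp add: is_cocone_def)
    define e where "e M = e' (\<iota> M)" for M
    have \<iota>E: "\<iota> M \<in> obj E" if "good M" for M using that by (simp add: E_simps)
    have e_in: "e M \<in> hom C (L M) W" if "good M" for M
      using cocone_inD[OF e' \<iota>E[OF that]] by (simp add: e_def G_simps dec[OF that])
    have e_t: "cmp C (L M) (L M') W (e M') (t M M') = e M" if M: "good M" "good M'" "M \<subseteq> M'" for M M'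
      using cocone_natD[OF e' _ \<iota>E[OF M(1)] \<iota>E[OF M(2)], of undefined] M
      by (simp add: e_def G_simps E_simps(2) dec)
    have e_l: "cmp C (fobj F d) (L M) W (e M) (l M d) = cmp C (fobj F d) (L M') W (e M') (l M' d)"
      if M: "good M" "good M'" "M \<subseteq> M'" and d: "(d, d, idt D d) \<in> M" for M M' d
      using push[OF M WC e_in[OF M(2)] d] e_t[OF M] by simp
    have e_l2: "cmp C (fobj F d) (L M) W (e M) (l M d) = cmp C (fobj F d) (L M') W (e M') (l M' d)"
      if M: "good M" "good M'" and d: "(d, d, idt D d) \<in> M" "(d, d, idt D d) \<in> M'" for M M' d
      using good2[OF M] e_l[OF M(1)] e_l[OF M(2)] d by metis
    \<comment> \<open>A cocone on the objects \<open>L M\<close> yields one on \<open>F\<close>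
      through any good part containing \<open>d\<close>. By \<open>e_l2\<close>, which compares two
      parts inside a third, the choice is immaterial.\<close>
    define b where "b d = (let M = SOME M. good M \<and> (d, d, idt D d) \<in> M in
      cmp C (fobj F d) (L M) W (e M) (l M d))" for d
    have b: "b d = cmp C (fobj F d) (L M) W (e M) (l M d)" if "good M" "(d, d, idt D d) \<in> M" for M d
    proof -
      have "good (SOME M. good M \<and> (d, d, idt D d) \<in> M) \<and> (d, d, idt D d) \<in> (SOME M. good M \<and> (d, d, idt D d) \<in> M)"
        by (rule someI[of "\<lambda>M. good M \<and> (d, d, idt D d) \<in> M" M]) (use that in simp)
      then show ?thesis unfolding b_def Let_def using e_l2 that by blast
    qed
    have b_cocone: "is_cocone D C F W b"
      unfolding is_cocone_def
    proof (intro conjI ballI)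
      show "W \<in> obj C" by (rule WC)
      fix d assume d: "d \<in> obj D"
      then have "(d, d, idt D d) \<in> arrows D" using idt_in[OF DD] by (simp add: arrows_def)
      then obtain M where M: "good M" "(d, d, idt D d) \<in> M" using good_arr_ex by blast
      show "b d \<in> hom C (fobj F d) W"
        unfolding b[OF M] by (rule cmp_in[OF C l_in[OF M] e_in[OF M(1)] FC[OF d] Lobj[OF M(1)] WC])
      fix d' u assume d': "d' \<in> obj D" and u: "u \<in> hom D d d'"
      then have "(d, d', u) \<in> arrows D" using d by (simp add: arrows_def)
      then obtain M where M: "good M" "(d, d', u) \<in> M" using good_arr_ex by blast
      note id = good_id[OF M]
      have lu: "cmp C (fobj F d) (fobj F d') (L M) (l M d') (fmap F d d' u) = l M d"
        using cocone_natD[OF Lcoc[OF M(1)], of u d d'] M(2) id by simp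
      show "cmp C (fobj F d) (fobj F d') W (b d') (fmap F d d' u) = b d"
        unfolding b[OF M(1) id(1)] b[OF M(1) id(2)]
        using cmp_assoc[OF C fmap_in[OF F u d d'] l_in[OF M(1) id(2)] e_in[OF M(1)] FC[OF d] FC[OF d']
            Lobj[OF M(1)] WC] lu by simp
    qed
    \<comment> \<open>A map mediates the cocone on the small parts exactly if it mediates the
      induced cocone \<open>b\<close> on \<open>F\<close>. Existence and uniqueness are thereby
      inherited from the given colimit.\<close>
    have key: "(\<forall>x \<in> obj E. cmp C (fobj G x) X W u (r (dec x)) = e' x) \<longleftrightarrow>
        (\<forall>d \<in> obj D. cmp C (fobj F d) X W u (c d) = b d)" if u: "u \<in> hom C X W" for u
    proof
      assume L: "\<forall>x \<in> obj E. cmp C (fobj G x) X W u (r (dec x)) = e' x"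
      show "\<forall>d \<in> obj D. cmp C (fobj F d) X W u (c d) = b d"
      proof
        fix d assume d: "d \<in> obj D"
        then have "(d, d, idt D d) \<in> arrows D" using idt_in[OF DD] by (simp add: arrows_def)
        then obtain M where M: "good M" "(d, d, idt D d) \<in> M" using good_arr_ex by blast
        have "cmp C (L M) X W u (r M) = e M"
          using L[rule_format, OF \<iota>E[OF M(1)]] dec[OF M(1)] by (simp add: e_def G_simps)
        then show "cmp C (fobj F d) X W u (c d) = b d"
          unfolding b[OF M] r_l[OF M, symmetric]
          using cmp_assoc[OF C l_in[OF M] r_in[OF M(1)] u FC[OF d] Lobj[OF M(1)] XC WC] by simp
      qed
    next
      assume R: "\<forall>d \<in> obj D. cmp C (fobj F d) X W u (c d) = b d"
      show "\<forall>x \<in> obj E. cmp C (fobj G x) X W u (r (dec x)) = e' x"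
      proof
        fix x assume x: "x \<in> obj E"
        define M where "M = dec x"
        have M: "good M" "\<iota> M = x"
          using x dec by (auto simp: M_def E_simps(1))
        have "cmp C (L M) X W u (r M) = e M"
        proof (rule L_eqI[OF M(1) WC _ e_in[OF M(1)]])
          show "cmp C (L M) X W u (r M) \<in> hom C (L M) W"
            by (rule cmp_in[OF C r_in[OF M(1)] u Lobj[OF M(1)] XC WC])
          fix d assume d: "(d, d, idt D d) \<in> M"
          note dD = dD[OF M(1) d]
          show "cmp C (fobj F d) (L M) W (cmp C (L M) X W u (r M)) (l M d) =
            cmp C (fobj F d) (L M) W (e M) (l M d)"
            using cmp_assoc[OF C l_in[OF M(1) d] r_in[OF M(1)] u FC[OF dD] Lobj[OF M(1)] XC WC]
              r_l[OF M(1) d] R dD b[OF M(1) d] by simp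
        qed
        then show "cmp C (fobj G x) X W u (r (dec x)) = e' x"
          using M(2) by (simp add: G_simps M_def[symmetric] e_def)
      qed
    qed
    have "\<exists>!u. u \<in> hom C X W \<and> (\<forall>d \<in> obj D. cmp C (fobj F d) X W u (c d) = b d)"
      using X b_cocone unfolding is_colimit_def by blast
    then show "\<exists>!u. u \<in> hom C X W \<and> (\<forall>x \<in> obj E. cmp C (fobj G x) X W u (r (dec x)) = e' x)"
      using key by (metis (no_types, lifting))
  qed
  moreover have "fobj G x \<in> Q" if "x \<in> obj E" for x
    using LQ dec_good[OF that] by (simp add: G_simps)
  ultimately show ?thesis using small_E filt_E G by blast
qed

text \<open>\<open>N0\<close> is a lower bound through which the ranks that an application needs are
  fed in. The small filtered parts of a diagram of generators have colimits because they are
  \<alpha>-filtered, and \<open>small_set_of_colimits\<close> collects these in one small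
  set.\<close>

lemma (in grothendieck) accessible_raise:
  fixes C :: "('o, 'u) category" and N0 :: "'x set"
  assumes C: "accessible C" and N0: "usmall U N0"
  obtains N :: "'u set" and Q :: "'o set" where "small N" "infinite N" "|N0| \<le>o |N|" "usmall U Q" "Q \<subseteq> obj C"
    "\<And>X. X \<in> obj C \<Longrightarrow> colimit_from (le_filtered N) C Q X"
proof -
  obtain \<alpha> :: "'u rel" where cat: "is_category C" "locally_small C" and \<alpha>: "regular_cardinal \<alpha>"
    and acc: "accessible_for \<alpha> C"
    using C unfolding accessible_def by blast
  obtain I :: "'u set" and P where I: "small I" "\<forall>i \<in> I. presentable \<alpha> C (P i)"
    and gen: "\<forall>X \<in> obj C. colimit_from (filtered \<alpha>) C (P ` I) X"
    using acc unfolding accessible_for_def by blast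
  have colims: "has_filtered_colimits \<alpha> C" using acc by (simp add: accessible_for_def)
  obtain N :: "'u set" where N: "small N" "infinite N" "|N0| \<le>o |N|" "|N| ^c \<alpha> \<le>o |N|" "|Field \<alpha>| \<le>o |N|"
    by (rule usmall_exponent_bound[OF N0 \<alpha>])
  have PC: "P i \<in> obj C" if "i \<in> I" for i using I(2) that by (simp add: presentable_def)
  from small_set_of_colimits[OF cat I(1) PC N(1)] obtain Q :: "'o set" where "usmall U Q \<and>
    (\<forall>(S :: ('u, 'u) category) F Z c.
      is_category S \<and> |arrows S| \<le>o |N| \<and> is_functor S C F \<and>
      (\<forall>s \<in> obj S. fobj F s \<in> P ` I) \<and> is_colimit S C F Z c \<longrightarrow>
      (\<exists>Z' \<in> Q. \<exists>c'. is_colimit S C F Z' c'))" ..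
  note Q = this[THEN conjunct1] this[THEN conjunct2, rule_format]
  \<comment> \<open>The intersection discards the arbitrary values that \<open>Q\<close> may contain
    for codes without a colimit.\<close>
  have "colimit_from (le_filtered N) C (Q \<inter> obj C) X"
    if X: "X \<in> obj C" for X
  proof -
    obtain D :: "('u, 'u) category" and F c where D: "small_category D" "filtered \<alpha> D"
      and F: "is_functor D C F" "\<forall>d \<in> obj D. fobj F d \<in> P ` I" and c: "is_colimit D C F X c"
      using gen X by blast
    have QM: "\<exists>Z \<in> Q. \<exists>l. is_colimit (arrow_subcategory D M) C F Z l"
      if M: "small_filtered_part \<alpha> N D M" for M
    proof -
      let ?S = "arrow_subcategory D M"
      have M': "M \<subseteq> arrows D" "|arrows ?S| \<le>o |N|" "is_category ?S" "filtered \<alpha> ?S"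
        using M by (simp_all add: small_filtered_part_def)
      note FS = is_functor_arrow_subcategory[OF F(1) M'(1)]
      note sm = small_category_arrow_subcategory[OF D(1) M'(1,3)]
      obtain Z l where Z: "is_colimit ?S C F Z l"
        using colims sm M'(4) FS unfolding has_filtered_colimits_def by blast
      have "\<forall>s \<in> obj ?S. fobj F s \<in> P ` I"
        using F(2) M'(1) by (auto simp: arrows_def)
      with M'(2,3) FS Z have "is_category ?S \<and> |arrows ?S| \<le>o |N| \<and> is_functor ?S C F \<and>
        (\<forall>s \<in> obj ?S. fobj F s \<in> P ` I) \<and> is_colimit ?S C F Z l" by blast
      then show ?thesis by (rule Q(2))
    qed
    obtain E :: "('u, 'u) category" and G g where E: "small_category E" "le_filtered N E"
      and G: "is_functor E C G" "\<forall>e \<in> obj E. fobj G e \<in> Q" and g: "is_colimit E C G X g"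
      using colimit_of_small_parts[OF cat(1) D \<alpha> F(1) c N(2,4,5) QM] by blast
    have "\<forall>e \<in> obj E. fobj G e \<in> Q \<inter> obj C"
      using G(2) fobj_in[OF G(1)] by blast
    then show ?thesis using E G(1) g by blast
  qed
  moreover have "usmall U (Q \<inter> obj C)" by (rule usmall_subset[OF Q(1)]) blast
  ultimately show ?thesis using that[OF N(1-3), of "Q \<inter> obj C"] by blast
qed

section \<open>Embeddings of accessible categories\<close>

lemma is_cocone_comp_functor:
  assumes F: "is_functor D C F" and J: "is_functor C C' J" and c: "is_cocone D C F Z c"
  shows "is_cocone D C' (comp_functor J F) (fobj J Z) (\<lambda>d. fmap J (fobj F d) Z (c d))"
  unfolding is_cocone_def comp_functor_simps
proof (intro conjI ballI)
  have Z: "Z \<in> obj C" using c by (simp add: is_cocone_def)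
  show "fobj J Z \<in> obj C'" by (rule fobj_in[OF J Z])
  fix d assume d: "d \<in> obj D"
  show "fmap J (fobj F d) Z (c d) \<in> hom C' (fobj J (fobj F d)) (fobj J Z)"
    by (rule fmap_in[OF J cocone_inD[OF c d] fobj_in[OF F d] Z])
  fix d' u assume d': "d' \<in> obj D" and u: "u \<in> hom D d d'"
  show "act C' J (fobj J (fobj F d)) (fobj F d') Z (c d')
      (fmap J (fobj F d) (fobj F d') (fmap F d d' u)) = fmap J (fobj F d) Z (c d)"
    using fmap_cmp[OF J fmap_in[OF F u d d'] cocone_inD[OF c d'] fobj_in[OF F d] fobj_in[OF F d'] Z]
      cocone_natD[OF c u d d'] by simp
qed

text \<open>Successor cardinals of infinite cardinals are regular. \<open>cardSuc |N|\<close> is a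
  relation on sets of elements of \<open>'u\<close>; being at most \<open>|Pow N|\<close> it is
  small and has a copy on \<open>'u\<close>.\<close>

lemma (in grothendieck) small_successor:
  fixes N :: "'u set"
  assumes N: "small N" "infinite N"
  obtains \<mu> :: "'u rel" where "regular_cardinal \<mu>" "|N| <o \<mu>"
proof -
  let ?s = "cardSuc |N|"
  have CN: "Cinfinite |N|" by (rule Cinfinite_card_of[OF N(2)])
  have Cs: "Cinfinite ?s" by (rule Cinfinite_cardSuc[OF CN])
  have "?s \<le>o |Pow N|"
    by (rule cardSuc_least[OF card_of_Card_order card_of_Card_order card_of_Pow])
  moreover have fs: "|Field ?s| =o ?s" using card_of_Field_ordIso Cs by blast
  ultimately have "|Field ?s| \<le>o |Pow N|" by (rule ordIso_ordLeq_trans[rotated])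
  moreover have "usmall U (Pow N)" using N(1) by (simp add: usmall_Pow small_usmall)
  ultimately have "usmall U (Field ?s)" by (rule usmall_ordLeq[rotated])
  then obtain Y :: "'u set" where Y: "small Y" "|Y| =o |Field ?s|"
    by (rule usmall_same_card)
  have iso: "?s =o |Y|" by (rule ordIso_symmetric[OF ordIso_transitive[OF Y(2) fs]])
  have "regularCard |Y|" by (rule regularCard_ordIso[OF iso Cs regularCard_cardSuc[OF CN]])
  moreover have "Cinfinite |Y|" by (rule Cinfinite_cong[OF iso Cs])
  ultimately have "regular_cardinal |Y|"
    using Y(1) by (simp add: regular_cardinal_def small_def)
  moreover have "|N| <o |Y|"
    by (rule ordLess_ordIso_trans[OF cardSuc_greater[OF card_of_Card_order] iso])
  ultimately show ?thesis by (rule that)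
qed

section \<open>Solution sets for a fully faithful functor\<close>

locale accessible_embedding = grothendieck U for U :: "'u itself" +
  fixes A :: "('a, 'u) category" and K :: "('k, 'u) category" and J :: "('a, 'u, 'k, 'u) funct"
  assumes accA: "accessible A" and accK: "accessible K"
    and J: "is_functor A K J" and ff: "fully_faithful A K J"
begin

lemma catA: "is_category A" "locally_small A" and catK: "is_category K" "locally_small K"
  using accA accK by (simp_all add: accessible_def)

lemmas inA = cmp_in[OF catA(1)] and assocA = cmp_assoc[OF catA(1)]
  and inK = cmp_in[OF catK(1)] and assocK = cmp_assoc[OF catK(1)]

lemma full:
  assumes "X \<in> obj A" "Y \<in> obj A" "g \<in> hom K (fobj J X) (fobj J Y)"
  obtains f where "f \<in> hom A X Y" "fmap J X Y f = g"
proof -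
  have "fmap J X Y ` hom A X Y = hom K (fobj J X) (fobj J Y)"
    using ff assms(1,2) unfolding fully_faithful_def bij_betw_def by blast
  then have "g \<in> fmap J X Y ` hom A X Y" using assms(3) by simp
  then show ?thesis using that by (elim imageE) simp
qed

lemma faithful:
  assumes "X \<in> obj A" "Y \<in> obj A" "f \<in> hom A X Y" "f' \<in> hom A X Y" "fmap J X Y f = fmap J X Y f'"
  shows "f = f'"
  using ff assms unfolding fully_faithful_def bij_betw_def inj_on_def by blast

text \<open>By Yoneda an element \<open>h\<close> of \<open>K(X, J B)\<close> is a transformation
  \<open>A(B, -) \<rightarrow> K(X, J-)\<close>. The second clause says that the transformations
  given by \<open>S\<close> are jointly surjective.\<close>

definition covers :: "'k \<Rightarrow> ('a \<times> 'u) set \<Rightarrow> bool" where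
  "covers X S \<longleftrightarrow> (\<forall>(B, h) \<in> S. B \<in> obj A \<and> h \<in> hom K X (fobj J B)) \<and>
     (\<forall>A' \<in> obj A. \<forall>k \<in> hom K X (fobj J A'). \<exists>(B, h) \<in> S. \<exists>f \<in> hom A B A'.
        k = act K J X B A' f h)"

lemma coversD: "covers X S \<Longrightarrow> (B, h) \<in> S \<Longrightarrow> B \<in> obj A" "covers X S \<Longrightarrow> (B, h) \<in> S \<Longrightarrow> h \<in> hom K X (fobj J B)"
  by (auto simp: covers_def)

lemma covers_factor:
  assumes "covers X S" "A' \<in> obj A" "k \<in> hom K X (fobj J A')"
  obtains B h f where "(B, h) \<in> S" "B \<in> obj A" "h \<in> hom K X (fobj J B)" "f \<in> hom A B A'"
    "act K J X B A' f h = k"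
proof -
  have "\<exists>x \<in> S. case x of (B, h) \<Rightarrow> \<exists>f \<in> hom A B A'. k = act K J X B A' f h"
    using assms unfolding covers_def by blast
  then obtain B h f where "(B, h) \<in> S" "f \<in> hom A B A'"
    "k = act K J X B A' f h" by auto
  then show ?thesis using that coversD[OF assms(1)] by metis
qed

lemma cone_reflective_iff:
  "cone_reflective A K J \<longleftrightarrow> (\<forall>X \<in> obj K. \<exists>S. usmall U S \<and> covers X S)"
proof
  assume L: "cone_reflective A K J"
  show "\<forall>X \<in> obj K. \<exists>S. usmall U S \<and> covers X S"
  proof
    fix X assume "X \<in> obj K"
    from bspec[OF L[unfolded cone_reflective_def] this]
    obtain I :: "'u set" and B h where I: "small I"
      and Bh: "\<forall>i \<in> I. B i \<in> obj A \<and> h i \<in> hom K X (fobj J (B i))"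
      and fac: "\<forall>A' \<in> obj A. \<forall>k \<in> hom K X (fobj J A'). \<exists>i \<in> I. \<exists>f \<in> hom A (B i) A'.
             k = act K J X (B i) A' f (h i)"
      by (elim exE conjE)
    have "usmall U ((\<lambda>i. (B i, h i)) ` I)"
      using I by (intro usmall_image) (simp add: small_usmall)
    moreover have "covers X ((\<lambda>i. (B i, h i)) ` I)"
      using Bh fac unfolding covers_def by simp
    ultimately show "\<exists>S. usmall U S \<and> covers X S" by blast
  qed
next
  assume R: "\<forall>X \<in> obj K. \<exists>S. usmall U S \<and> covers X S"
  show "cone_reflective A K J"
    unfolding cone_reflective_def
  proof
    fix X assume "X \<in> obj K"
    then obtain S where S: "usmall U S" "covers X S" using R by blast
    from usmall_enum[OF S(1)] obtain I :: "'u set" and e where I: "small I" "bij_betw e I S" .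
    have eS: "e ` I = S" using I(2) by (simp add: bij_betw_def)
    have "\<forall>i \<in> I. fst (e i) \<in> obj A \<and> snd (e i) \<in> hom K X (fobj J (fst (e i)))"
      using S(2) unfolding covers_def eS[symmetric] by (simp add: split_beta)
    moreover have "\<forall>A' \<in> obj A. \<forall>k \<in> hom K X (fobj J A'). \<exists>i \<in> I. \<exists>f \<in> hom A (fst (e i)) A'.
       k = act K J X (fst (e i)) A' f (snd (e i))"
      using S(2) unfolding covers_def eS[symmetric] by (simp add: split_beta)
    ultimately show "\<exists>(I :: 'u set) B h. small I \<and>
        (\<forall>i \<in> I. B i \<in> obj A \<and> h i \<in> hom K X (fobj J (B i))) \<and>
        (\<forall>A' \<in> obj A. \<forall>k \<in> hom K X (fobj J A').
           \<exists>i \<in> I. \<exists>f \<in> hom A (B i) A'.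
             k = act K J X (B i) A' f (h i))"
      using I(1) by (intro exI[of _ I] exI[of _ "\<lambda>i. fst (e i)"] exI[of _ "\<lambda>i. snd (e i)"] conjI)
  qed
qed

lemma accessibly_embedded_imp_cone_reflective:
  assumes "accessibly_embedded A K J"
  shows "cone_reflective A K J"
  unfolding cone_reflective_iff
proof
  fix X assume X: "X \<in> obj K"
  obtain \<gamma> :: "'u rel" where \<gamma>: "regular_cardinal \<gamma>" and pres: "preserves_filtered_colimits \<gamma> A K J"
    using assms unfolding accessibly_embedded_def by blast
  obtain NX :: "'u set" where NX: "small NX" "\<And>M :: 'u set. |NX| \<le>o |M| \<Longrightarrow> le_presentable M K X"
    by (rule accessible_le_presentable[OF accK X]) blast
  \<comment> \<open>The first summand makes \<open>X\<close> presentable for the raised index of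
    \<open>A\<close>; the second makes \<open>J\<close> preserve the colimits that occur at that
    index.\<close>
  have "usmall U (NX <+> Field \<gamma>)"
    using NX(1) usmall_Field_regular[OF \<gamma>] by (simp add: usmall_Plus small_usmall)
  from accessible_raise[OF accA this] obtain N :: "'u set" and Q :: "'a set"
    where N: "|NX <+> Field \<gamma>| \<le>o |N|" and Q: "usmall U Q" "Q \<subseteq> obj A"
      and gen: "\<And>X. X \<in> obj A \<Longrightarrow> colimit_from (le_filtered N) A Q X"
    by metis
  have pX: "le_presentable N K X" by (rule NX(2)[OF ordLeq_transitive[OF card_of_Plus1 N]])
  have "|Field \<gamma>| \<le>o |N|" by (rule ordLeq_transitive[OF card_of_Plus2 N])
  moreover have "\<gamma> =o |Field \<gamma>|"
    using \<gamma> card_of_Field_ordIso ordIso_symmetric unfolding regular_cardinal_def by blast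
  ultimately have \<gamma>N: "\<gamma> \<le>o |N|" by (rule ordIso_ordLeq_trans[rotated])
  let ?S = "Sigma Q (\<lambda>B. hom K X (fobj J B))"
  have "usmall U ?S"
    using catK(2) X Q fobj_in[OF J]
    by (intro usmall_Sigma) (auto simp: locally_small_def small_usmall[symmetric])
  moreover have "covers X ?S"
    unfolding covers_def
  proof (intro conjI ballI)
    show "case x of (B, h) \<Rightarrow> B \<in> obj A \<and> h \<in> hom K X (fobj J B)" if "x \<in> ?S" for x
      using that Q(2) by auto
    fix A' k assume A': "A' \<in> obj A" and k: "k \<in> hom K X (fobj J A')"
    obtain D :: "('u, 'u) category" and F c where D: "small_category D" "le_filtered N D"
      and F: "is_functor D A F" "\<forall>d \<in> obj D. fobj F d \<in> Q" and c: "is_colimit D A F A' c"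
      using gen[OF A'] by blast
    have "filtered \<gamma> D" by (rule le_filtered_filtered[OF D(2) \<gamma>N])
    then have "is_colimit D K (comp_functor J F) (fobj J A') (\<lambda>d. fmap J (fobj F d) A' (c d))"
      using pres D(1) F(1) c unfolding preserves_filtered_colimits_def by blast
    then have "hom_preserves D K (comp_functor J F) (fobj J A') (\<lambda>d. fmap J (fobj F d) A' (c d)) X"
      using pX D is_functor_comp[OF F(1) J] unfolding le_presentable_def by blast
    from hom_preserves_factor[OF this k] obtain d k' where d: "d \<in> obj D"
      and k': "k' \<in> hom K X (fobj J (fobj F d))"
        "act K J X (fobj F d) A' (c d) k' = k"
      unfolding comp_functor_simps .
    show "\<exists>(B, h) \<in> ?S. \<exists>f \<in> hom A B A'. k = act K J X B A' f h"
    proof (rule bexI[of _ "(fobj F d, k')"])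
      show "(fobj F d, k') \<in> ?S" using F(2) d k'(1) by simp
      show "case (fobj F d, k') of (B, h) \<Rightarrow> \<exists>f \<in> hom A B A'. k = act K J X B A' f h"
        using k'(2) cocone_inD[OF colimit_coconeD[OF c] d] by auto
    qed
  qed
  ultimately show "\<exists>S. usmall U S \<and> covers X S" by blast
qed

section \<open>Weak pushouts and small presentations of \<open>K(X, J-)\<close>\<close>

abbreviation weak_pushouts :: "'k set \<Rightarrow> 'k \<Rightarrow> 'k \<Rightarrow> 'u \<Rightarrow> 'k \<Rightarrow> 'u \<Rightarrow> bool" where
  "weak_pushouts Q X Y h Y' h' \<equiv> usmall U Q \<and> Q \<subseteq> obj K \<and>
     (\<forall>W \<in> obj K. \<forall>m \<in> hom K Y W. \<forall>m' \<in> hom K Y' W. cmp K X Y W m h = cmp K X Y' W m' h' \<longrightarrow>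
       (\<exists>Z \<in> Q. \<exists>p \<in> hom K Y Z. \<exists>p' \<in> hom K Y' Z. \<exists>n \<in> hom K Z W.
          m = cmp K Y Z W n p \<and> m' = cmp K Y' Z W n p' \<and> cmp K X Y Z p h = cmp K X Y' Z p' h'))"

text \<open>The vertex \<open>W\<close> of a commutative square is a highly filtered colimit of
  objects from one small set. Its two sides factor through stages because \<open>Y\<close> and
  \<open>Y'\<close> are presentable, and the square commutes at a later stage because
  \<open>X\<close> is. The index is raised above the ranks of all three.\<close>

lemma small_weak_pushouts:
  assumes X: "X \<in> obj K" and Y: "Y \<in> obj K" and Y': "Y' \<in> obj K"
    and h: "h \<in> hom K X Y" and h': "h' \<in> hom K X Y'"
  shows "\<exists>Q. weak_pushouts Q X Y h Y' h'"
proof -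
  obtain N1 :: "'u set" where N1: "small N1" "\<And>M :: 'u set. |N1| \<le>o |M| \<Longrightarrow> le_presentable M K X"
    by (rule accessible_le_presentable[OF accK X]) blast
  obtain N2 :: "'u set" where N2: "small N2" "\<And>M :: 'u set. |N2| \<le>o |M| \<Longrightarrow> le_presentable M K Y"
    by (rule accessible_le_presentable[OF accK Y]) blast
  obtain N3 :: "'u set" where N3: "small N3" "\<And>M :: 'u set. |N3| \<le>o |M| \<Longrightarrow> le_presentable M K Y'"
    by (rule accessible_le_presentable[OF accK Y']) blast
  have "usmall U (N1 <+> (N2 <+> N3))"
    using N1(1) N2(1) N3(1) by (simp add: usmall_Plus small_usmall)
  from accessible_raise[OF accK this] obtain N :: "'u set" and Q :: "'k set"
    where N: "infinite N" "|N1 <+> (N2 <+> N3)| \<le>o |N|" and Q: "usmall U Q" "Q \<subseteq> obj K"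
      and gen: "\<And>X. X \<in> obj K \<Longrightarrow> colimit_from (le_filtered N) K Q X"
    by metis
  note N23 = ordLeq_transitive[OF card_of_Plus2 N(2)]
  have pX: "le_presentable N K X" by (rule N1(2)[OF ordLeq_transitive[OF card_of_Plus1 N(2)]])
  have pY: "le_presentable N K Y" by (rule N2(2)[OF ordLeq_transitive[OF card_of_Plus1 N23]])
  have pY': "le_presentable N K Y'" by (rule N3(2)[OF ordLeq_transitive[OF card_of_Plus2 N23]])
  have "\<exists>Z \<in> Q. \<exists>p \<in> hom K Y Z. \<exists>p' \<in> hom K Y' Z. \<exists>n \<in> hom K Z W.
         m = cmp K Y Z W n p \<and> m' = cmp K Y' Z W n p' \<and> cmp K X Y Z p h = cmp K X Y' Z p' h'"
    if W: "W \<in> obj K" and m: "m \<in> hom K Y W" and m': "m' \<in> hom K Y' W"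
      and eq: "cmp K X Y W m h = cmp K X Y' W m' h'" for W m m'
  proof -
    obtain D :: "('u, 'u) category" and F c where D: "small_category D" "le_filtered N D"
      and F: "is_functor D K F" "\<forall>d \<in> obj D. fobj F d \<in> Q" and c: "is_colimit D K F W c"
      using gen[OF W] by blast
    note DD = small_categoryD(1)[OF D(1)] and cc = colimit_coconeD[OF c] and FK = fobj_in[OF F(1)]
    have hp: "hom_preserves D K F W c X" "hom_preserves D K F W c Y" "hom_preserves D K F W c Y'"
      using pX pY pY' D F(1) c unfolding le_presentable_def by blast+
    obtain d1 m1 where d1: "d1 \<in> obj D" and m1: "m1 \<in> hom K Y (fobj F d1)"
      "cmp K Y (fobj F d1) W (c d1) m1 = m"
      by (rule hom_preserves_factor[OF hp(2) m])
    obtain d2 m2 where d2: "d2 \<in> obj D" and m2: "m2 \<in> hom K Y' (fobj F d2)"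
      "cmp K Y' (fobj F d2) W (c d2) m2 = m'"
      by (rule hom_preserves_factor[OF hp(3) m'])
    let ?g = "cmp K X Y (fobj F d1) m1 h" and ?g' = "cmp K X Y' (fobj F d2) m2 h'"
    have g: "?g \<in> hom K X (fobj F d1)" "?g' \<in> hom K X (fobj F d2)"
      using m1 m2 h h' X Y Y' FK d1 d2 by (simp_all add: inK)
    have "cmp K X (fobj F d1) W (c d1) ?g = cmp K X (fobj F d2) W (c d2) ?g'"
      using eq assocK[OF h m1(1) cocone_inD[OF cc d1] X Y FK[OF d1] W]
        assocK[OF h' m2(1) cocone_inD[OF cc d2] X Y' FK[OF d2] W] m1(2) m2(2) by simp
    from hom_preserves_merge2[OF catK(1) DD le_filtered_fin_filtered[OF D(2) N(1)] F(1) c hp(1) d1 g(1) d2 g(2) this]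
    obtain e q q' where e: "e \<in> obj D" and q: "q \<in> hom D d1 e" "q' \<in> hom D d2 e"
      and eq': "act K F X d1 e q ?g =
        act K F X d2 e q' ?g'" .
    let ?p = "act K F Y d1 e q m1"
      and ?p' = "act K F Y' d2 e q' m2"
    note Fq = fmap_in[OF F(1) q(1) d1 e] and Fq' = fmap_in[OF F(1) q(2) d2 e]
    have "?p \<in> hom K Y (fobj F e)" "?p' \<in> hom K Y' (fobj F e)"
      using inK[OF m1(1) Fq Y FK[OF d1] FK[OF e]] inK[OF m2(1) Fq' Y' FK[OF d2] FK[OF e]]
      by simp_all
    moreover have "m = cmp K Y (fobj F e) W (c e) ?p" "m' = cmp K Y' (fobj F e) W (c e) ?p'"
      using cmp_cocone[OF catK(1) F(1) cc d1 e q(1) Y m1(1)] cmp_cocone[OF catK(1) F(1) cc d2 e q(2) Y' m2(1)]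
        m1(2) m2(2) by simp_all
    moreover have "cmp K X Y (fobj F e) ?p h = cmp K X Y' (fobj F e) ?p' h'"
      using eq' assocK[OF h m1(1) Fq X Y FK[OF d1] FK[OF e]]
        assocK[OF h' m2(1) Fq' X Y' FK[OF d2] FK[OF e]] by simp
    moreover have "fobj F e \<in> Q" "c e \<in> hom K (fobj F e) W"
      using F(2) e cocone_inD[OF cc e] by blast+
    ultimately show ?thesis by blast
  qed
  then show ?thesis using Q by blast
qed

abbreviation kernel_factors ::
  "'k \<Rightarrow> 'a set \<Rightarrow> 'a \<Rightarrow> 'u \<Rightarrow> 'a \<Rightarrow> 'u \<Rightarrow> 'a \<Rightarrow> 'u \<Rightarrow> 'u \<Rightarrow> bool" where
  "kernel_factors X Q B h B' h' A' f f' \<equiv>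
     \<exists>C \<in> Q. \<exists>p \<in> hom A B C. \<exists>p' \<in> hom A B' C. \<exists>g \<in> hom A C A'.
       f = cmp A B C A' g p \<and> f' = cmp A B' C A' g p' \<and> act K J X B C p h = act K J X B' C p' h'"

text \<open>The pairs \<open>(f, f')\<close> in question form the fibre product of
  \<open>A(B, -)\<close> and \<open>A(B', -)\<close> over \<open>K(X, J-)\<close>. The condition is
  that this functor is covered by its elements over objects of \<open>Q\<close>.\<close>

definition kernel_covers :: "'k \<Rightarrow> ('a \<times> 'u) set \<Rightarrow> 'a set \<Rightarrow> bool" where
  "kernel_covers X S Q \<longleftrightarrow> (\<forall>B h B' h' A' f f'. (B, h) \<in> S \<longrightarrow> (B', h') \<in> S \<longrightarrow> A' \<in> obj A \<longrightarrow>
     f \<in> hom A B A' \<longrightarrow> f' \<in> hom A B' A' \<longrightarrow>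
     act K J X B A' f h =
     act K J X B' A' f' h' \<longrightarrow>
     kernel_factors X Q B h B' h' A' f f')"

text \<open>Generators and relations for \<open>K(X, J-)\<close>: \<open>S\<close> gives the
  generators, and \<open>Q\<close> contains the objects at which generators and covering relations
  live.\<close>

definition presents :: "'k \<Rightarrow> ('a \<times> 'u) set \<Rightarrow> 'a set \<Rightarrow> bool" where
  "presents X S Q \<longleftrightarrow> usmall U S \<and> usmall U Q \<and> Q \<subseteq> obj A \<and> fst ` S \<subseteq> Q \<and>
     covers X S \<and> kernel_covers X S Q"

lemma presentsD:
  assumes "presents X S Q"
  shows "usmall U S" "usmall U Q" "Q \<subseteq> obj A" "fst ` S \<subseteq> Q" "covers X S" "kernel_covers X S Q"
  using assms by (simp_all add: presents_def)

text \<open>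
  The pairs identified by \<open>A(B, -) + A(B', -) \<rightarrow> K(X, J-)\<close> are the cocones with vertex \<open>J A'\<close> on a
  span \<open>J B \<leftarrow> X \<rightarrow> J B'\<close>; composing its weak pushouts with their own solution sets covers these,
  because \<open>J\<close> is fully faithful.
\<close>

lemma cone_reflective_imp_presents:
  assumes "cone_reflective A K J" and X: "X \<in> obj K"
  shows "\<exists>S Q. presents X S Q"
proof -
  have "\<exists>S. usmall U S \<and> covers Z S" if "Z \<in> obj K" for Z
    using assms(1) that unfolding cone_reflective_iff by blast
  then obtain S where S: "\<forall>Z. Z \<in> obj K \<longrightarrow> usmall U (S Z) \<and> covers Z (S Z)"
    by (rule choice_on1)
  note Ssm = S[rule_format, THEN conjunct1] and Scov = S[rule_format, THEN conjunct2]
  define wp where "wp Q Y h Y' h' \<longleftrightarrow> weak_pushouts Q X Y h Y' h'" for Q Y h Y' h'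
  have "\<exists>Q. wp Q (fobj J (fst (fst x))) (snd (fst x)) (fobj J (fst (snd x))) (snd (snd x))"
    if x0: "x \<in> S X \<times> S X" for x
  proof -
    obtain B h B' h' where x: "x = ((B, h), (B', h'))" and Bh: "(B, h) \<in> S X" "(B', h') \<in> S X"
      using x0 by auto
    note cov = coversD[OF Scov[OF X]]
    show ?thesis
      unfolding wp_def x fst_conv snd_conv
      by (rule small_weak_pushouts[OF X fobj_in[OF J cov(1)[OF Bh(1)]] fobj_in[OF J cov(1)[OF Bh(2)]]
            cov(2)[OF Bh(1)] cov(2)[OF Bh(2)]])
  qed
  then obtain R where R: "\<forall>x. x \<in> S X \<times> S X \<longrightarrow>
      wp (R x) (fobj J (fst (fst x))) (snd (fst x)) (fobj J (fst (snd x))) (snd (snd x))"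
    by (rule choice_on1)
  define Q where "Q = fst ` S X \<union> (\<Union>x \<in> S X \<times> S X. \<Union>Z \<in> R x. fst ` S Z)"
  have R_obj: "Z \<in> obj K" if "x \<in> S X \<times> S X" "Z \<in> R x" for x Z
    using R that unfolding wp_def by blast
  have R_sm: "usmall U (R x)" if "x \<in> S X \<times> S X" for x
    using R that unfolding wp_def by blast
  have "usmall U Q"
    unfolding Q_def
    by (intro usmall_Un usmall_image Ssm X usmall_UN usmall_Sigma R_sm) (use R_obj in auto)
  moreover have "Q \<subseteq> obj A"
    unfolding Q_def
  proof (intro Un_least UN_least image_subsetI)
    show "fst y \<in> obj A" if "y \<in> S X" for y
      using coversD(1)[OF Scov[OF X], of "fst y" "snd y"] that by simp
    show "fst y \<in> obj A" if "x \<in> S X \<times> S X" "Z \<in> R x" "y \<in> S Z" for x Z y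
      using coversD(1)[OF Scov[OF R_obj[OF that(1,2)]], of "fst y" "snd y"] that by simp
  qed
  moreover have "kernel_covers X (S X) Q"
    unfolding kernel_covers_def
  proof (intro allI impI)
    fix B h B' h' A' f f'
    assume Bh: "(B, h) \<in> S X" and Bh': "(B', h') \<in> S X" and A': "A' \<in> obj A"
      and f: "f \<in> hom A B A'" and f': "f' \<in> hom A B' A'"
      and eq: "act K J X B A' f h =
        act K J X B' A' f' h'"
    note cov = coversD[OF Scov[OF X]]
    have B: "B \<in> obj A" "h \<in> hom K X (fobj J B)" by (rule cov[OF Bh])+
    have B': "B' \<in> obj A" "h' \<in> hom K X (fobj J B')" by (rule cov[OF Bh'])+
    let ?x = "((B, h), (B', h'))"
    have x: "?x \<in> S X \<times> S X" using Bh Bh' by simp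
    then have "wp (R ?x) (fobj J B) h (fobj J B') h'" using R by fastforce
    then obtain Z p p' n where Z: "Z \<in> R ?x" and p: "p \<in> hom K (fobj J B) Z" "p' \<in> hom K (fobj J B') Z"
      and n: "n \<in> hom K Z (fobj J A')"
      and np: "fmap J B A' f = cmp K (fobj J B) Z (fobj J A') n p"
        "fmap J B' A' f' = cmp K (fobj J B') Z (fobj J A') n p'"
      and ph: "cmp K X (fobj J B) Z p h = cmp K X (fobj J B') Z p' h'"
      using eq fobj_in[OF J A'] fmap_in[OF J f B(1) A'] fmap_in[OF J f' B'(1) A'] unfolding wp_def by blast
    have ZK: "Z \<in> obj K" by (rule R_obj[OF x Z])
    obtain C k g where Ck: "(C, k) \<in> S Z" and C: "C \<in> obj A" and k: "k \<in> hom K Z (fobj J C)"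
      and g: "g \<in> hom A C A'" and gk: "act K J Z C A' g k = n"
      by (rule covers_factor[OF Scov[OF ZK] A' n])
    have JO: "fobj J B \<in> obj K" "fobj J B' \<in> obj K" "fobj J C \<in> obj K" "fobj J A' \<in> obj K"
      using fobj_in[OF J] B B' C A' by simp_all
    \<comment> \<open>By fullness the composite from \<open>J B\<close> over \<open>Z\<close> to
      \<open>J C\<close> is the image of an arrow \<open>q\<close> of \<open>A\<close>. Faithfulness
      below turns the factorization of \<open>J f\<close> over \<open>Z\<close> into one of
      \<open>f\<close> over \<open>C\<close>.\<close>
    obtain q where q: "q \<in> hom A B C" "fmap J B C q = cmp K (fobj J B) Z (fobj J C) k p"
      by (rule full[OF B(1) C inK[OF p(1) k JO(1) ZK JO(3)]])
    obtain q' where q': "q' \<in> hom A B' C" "fmap J B' C q' = cmp K (fobj J B') Z (fobj J C) k p'"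
      by (rule full[OF B'(1) C inK[OF p(2) k JO(2) ZK JO(3)]])
    note Jg = fmap_in[OF J g C A']
    have "fmap J B A' (cmp A B C A' g q) = fmap J B A' f"
      using fmap_cmp[OF J q(1) g B(1) C A'] q(2) assocK[OF p(1) k Jg JO(1) ZK JO(3,4)] gk np(1)
      by simp
    then have "f = cmp A B C A' g q"
      using faithful[OF B(1) A' f inA[OF q(1) g B(1) C A']] by simp
    moreover have "fmap J B' A' (cmp A B' C A' g q') = fmap J B' A' f'"
      using fmap_cmp[OF J q'(1) g B'(1) C A'] q'(2) assocK[OF p(2) k Jg JO(2) ZK JO(3,4)] gk np(2)
      by simp
    then have "f' = cmp A B' C A' g q'"
      using faithful[OF B'(1) A' f' inA[OF q'(1) g B'(1) C A']] by simp
    moreover have "act K J X B C q h =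
        act K J X B' C q' h'"
      using assocK[OF B(2) p(1) k X JO(1) ZK JO(3)] assocK[OF B'(2) p(2) k X JO(2) ZK JO(3)]
        q(2) q'(2) ph by simp
    moreover have "fst (C, k) \<in> Q" unfolding Q_def using x Z Ck by blast
    ultimately show "kernel_factors X Q B h B' h' A' f f'"
      using q(1) q'(1) g by auto
  qed
  ultimately have "presents X (S X) Q"
    using Ssm[OF X] Scov[OF X] by (simp add: presents_def Q_def)
  then show ?thesis by blast
qed

section \<open>Preservation of filtered colimits\<close>

text \<open>
  A cocone on \<open>J F\<close> identifies \<open>k1\<close> and \<open>k2\<close> as soon as the cocone \<open>J c\<close> does: both factor through
  the presentation of \<open>X\<close>, whose objects see the colimit \<open>Z\<close> of \<open>F\<close> as a filtered one.
\<close>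

lemma presents_cocone_eq:
  assumes S: "presents X S Q" and X: "X \<in> obj K"
    and D: "is_category D" "fin_filtered D" and F: "is_functor D A F" and Z: "is_colimit D A F Z c"
    and pQ: "\<And>B. B \<in> Q \<Longrightarrow> hom_preserves D A F Z c B"
    and \<epsilon>: "is_cocone D K (comp_functor J F) W \<epsilon>"
    and d: "d \<in> obj D" "k1 \<in> hom K X (fobj J (fobj F d))"
    and d': "d' \<in> obj D" "k2 \<in> hom K X (fobj J (fobj F d'))"
    and eq: "act K J X (fobj F d) Z (c d) k1 =
      act K J X (fobj F d') Z (c d') k2"
  shows "cmp K X (fobj J (fobj F d)) W (\<epsilon> d) k1 = cmp K X (fobj J (fobj F d')) W (\<epsilon> d') k2"
proof -
  note cc = colimit_coconeD[OF Z] and ZA = colimit_objD[OF Z] and FA = fobj_in[OF F]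
  have WK: "W \<in> obj K" using \<epsilon> by (simp add: is_cocone_def)
  have \<epsilon>_in: "\<epsilon> d \<in> hom K (fobj J (fobj F d)) W" if "d \<in> obj D" for d
    using cocone_inD[OF \<epsilon> that] by simp
  have shift: "cmp K (fobj J B) (fobj J (fobj F d)) W (\<epsilon> d) (fmap J B (fobj F d) x) =
      cmp K (fobj J B) (fobj J (fobj F e)) W (\<epsilon> e)
        (fmap J B (fobj F e) (act A F B d e q x))"
    if B: "B \<in> obj A" and d: "d \<in> obj D" "e \<in> obj D" and x: "x \<in> hom A B (fobj F d)" and q: "q \<in> hom D d e"
    for B d e x q
  proof -
    note Fq = fmap_in[OF F q d]
    have "cmp K (fobj J (fobj F d)) (fobj J (fobj F e)) W (\<epsilon> e) (fmap J (fobj F d) (fobj F e) (fmap F d e q)) = \<epsilon> d"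
      using cocone_natD[OF \<epsilon> q d] by simp
    then show ?thesis
      using fmap_cmp[OF J x Fq B FA[OF d(1)] FA[OF d(2)]]
        assocK[OF fmap_in[OF J x B FA[OF d(1)]] fmap_in[OF J Fq FA[OF d(1)] FA[OF d(2)]]
          \<epsilon>_in[OF d(2)] fobj_in[OF J B] fobj_in[OF J FA[OF d(1)]] fobj_in[OF J FA[OF d(2)]] WK]
      by simp
  qed
  \<comment> \<open>On arrows from a suitably presentable \<open>B\<close> into stages of
    \<open>F\<close>, the value of \<epsilon> depends only on the composite into
    \<open>Z\<close>.\<close>
  have merge: "cmp K (fobj J B) (fobj J (fobj F d)) W (\<epsilon> d) (fmap J B (fobj F d) x) =
      cmp K (fobj J B) (fobj J (fobj F e)) W (\<epsilon> e) (fmap J B (fobj F e) y)"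
    if p: "hom_preserves D A F Z c B" and d: "d \<in> obj D" "x \<in> hom A B (fobj F d)"
      and e: "e \<in> obj D" "y \<in> hom A B (fobj F e)"
      and eq: "cmp A B (fobj F d) Z (c d) x = cmp A B (fobj F e) Z (c e) y" for B d e x y
  proof -
    have B: "B \<in> obj A" using p by (simp add: hom_preserves_def)
    from hom_preserves_merge2[OF catA(1) D F Z p d e eq] obtain e1 q r where e1: "e1 \<in> obj D"
      and q: "q \<in> hom D d e1" and r: "r \<in> hom D e e1"
      and qr: "act A F B d e1 q x =
        act A F B e e1 r y" .
    show ?thesis using shift[OF B d(1) e1 d(2) q] shift[OF B e(1) e1 e(2) r] qr by simp
  qed
  note cov = presentsD(5)[OF S]
  obtain B h f where Bh: "(B, h) \<in> S" and B: "B \<in> obj A" and h: "h \<in> hom K X (fobj J B)"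
    and f: "f \<in> hom A B (fobj F d)" and fh: "act K J X B (fobj F d) f h = k1"
    by (rule covers_factor[OF cov FA[OF d(1)] d(2)])
  obtain B' h' f' where Bh': "(B', h') \<in> S" and B': "B' \<in> obj A" and h': "h' \<in> hom K X (fobj J B')"
    and f': "f' \<in> hom A B' (fobj F d')" and fh': "act K J X B' (fobj F d') f' h' = k2"
    by (rule covers_factor[OF cov FA[OF d'(1)] d'(2)])
  have BQ: "B \<in> Q" "B' \<in> Q" using presentsD(4)[OF S] Bh Bh' by force+
  note cd = cocone_inD[OF cc d(1)] and cd' = cocone_inD[OF cc d'(1)]
  let ?f = "cmp A B (fobj F d) Z (c d) f" and ?f' = "cmp A B' (fobj F d') Z (c d') f'"
  have fZ: "?f \<in> hom A B Z" "?f' \<in> hom A B' Z"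
    by (rule inA[OF f cd B FA[OF d(1)] ZA], rule inA[OF f' cd' B' FA[OF d'(1)] ZA])
  have "act K J X B Z ?f h = act K J X B' Z ?f' h'"
    using eq fh fh' fmap_cmp[OF J f cd B FA[OF d(1)] ZA] fmap_cmp[OF J f' cd' B' FA[OF d'(1)] ZA]
      assocK[OF h fmap_in[OF J f B FA[OF d(1)]] fmap_in[OF J cd FA[OF d(1)] ZA] X fobj_in[OF J B]
        fobj_in[OF J FA[OF d(1)]] fobj_in[OF J ZA]]
      assocK[OF h' fmap_in[OF J f' B' FA[OF d'(1)]] fmap_in[OF J cd' FA[OF d'(1)] ZA] X fobj_in[OF J B']
        fobj_in[OF J FA[OF d'(1)]] fobj_in[OF J ZA]]
    by simp
  then have "kernel_factors X Q B h B' h' Z ?f ?f'"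
    using presentsD(6)[OF S] Bh Bh' ZA fZ unfolding kernel_covers_def by blast
  then obtain C p p' g where CQ: "C \<in> Q" and p: "p \<in> hom A B C" and p': "p' \<in> hom A B' C"
    and g: "g \<in> hom A C Z" and gp: "?f = cmp A B C Z g p" "?f' = cmp A B' C Z g p'"
    and ph: "act K J X B C p h =
        act K J X B' C p' h'" by blast
  have C: "C \<in> obj A" using CQ presentsD(3)[OF S] by blast
  obtain e g' where e: "e \<in> obj D" and g': "g' \<in> hom A C (fobj F e)" and cg': "cmp A C (fobj F e) Z (c e) g' = g"
    by (rule hom_preserves_factor[OF pQ[OF CQ] g])
  note ce = cocone_inD[OF cc e]
  \<comment> \<open>Both sides are brought to one form. Over \<open>Z\<close> the arrow from
    \<open>B\<close> is \<open>g p\<close>, and \<open>g\<close> itself factors through the stage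
    \<open>e\<close> as \<open>g'\<close>. Hence the value is a map out of \<open>J C\<close>, the
    same for both sides, applied to \<open>J p h\<close>; and \<open>J p h\<close> equals
    \<open>J p' h'\<close>.\<close>
  have aux: "cmp K X (fobj J (fobj F d)) W (\<epsilon> d) (act K J X B (fobj F d) f h) =
      cmp K X (fobj J C) W (cmp K (fobj J C) (fobj J (fobj F e)) W (\<epsilon> e) (fmap J C (fobj F e) g'))
        (act K J X B C p h)"
    if B: "B \<in> obj A" and BQ: "B \<in> Q" and h: "h \<in> hom K X (fobj J B)" and d: "d \<in> obj D"
      and f: "f \<in> hom A B (fobj F d)" and p: "p \<in> hom A B C" and gp: "cmp A B (fobj F d) Z (c d) f = cmp A B C Z g p"
    for B h d f p
  proof -
    let ?g = "cmp A B C (fobj F e) g' p"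
    note gB = inA[OF p g' B C FA[OF e]]
    note JO = fobj_in[OF J B] fobj_in[OF J C] fobj_in[OF J FA[OF e]] fobj_in[OF J FA[OF d]]
    note Jm = fmap_in[OF J p B C] fmap_in[OF J g' C FA[OF e]] fmap_in[OF J gB B FA[OF e]] fmap_in[OF J f B FA[OF d]]
    have "cmp A B (fobj F d) Z (c d) f = cmp A B (fobj F e) Z (c e) ?g"
      using assocA[OF p g' ce B C FA[OF e] ZA] cg' gp by simp
    note m = merge[OF pQ[OF BQ] d f e gB this]
    have "cmp K X (fobj J (fobj F d)) W (\<epsilon> d) (act K J X B (fobj F d) f h) =
      cmp K X (fobj J B) W (cmp K (fobj J B) (fobj J (fobj F e)) W (\<epsilon> e) (fmap J B (fobj F e) ?g)) h"
      using assocK[OF h Jm(4) \<epsilon>_in[OF d] X JO(1,4) WK] m by simp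
    also have "\<dots> = cmp K X (fobj J B) W (cmp K (fobj J B) (fobj J C) W
        (cmp K (fobj J C) (fobj J (fobj F e)) W (\<epsilon> e) (fmap J C (fobj F e) g')) (fmap J B C p)) h"
      using fmap_cmp[OF J p g' B C FA[OF e]] assocK[OF Jm(1,2) \<epsilon>_in[OF e] JO(1-3) WK] by simp
    also have "\<dots> = cmp K X (fobj J C) W (cmp K (fobj J C) (fobj J (fobj F e)) W (\<epsilon> e) (fmap J C (fobj F e) g'))
        (act K J X B C p h)"
      by (rule assocK[OF h Jm(1) inK[OF Jm(2) \<epsilon>_in[OF e] JO(2,3) WK] X JO(1,2) WK])
    finally show ?thesis .
  qed
  show ?thesis
    using aux[OF B BQ(1) h d(1) f p gp(1)] aux[OF B' BQ(2) h' d'(1) f' p' gp(2)] fh fh' ph by simp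
qed

text \<open>A map to \<open>J Z\<close> comes from a generator \<open>h\<close> and an arrow
  \<open>B \<rightarrow> Z\<close>, and the latter factors through a stage because \<open>B\<close>
  lies in \<open>Q\<close>. With \<open>presents_cocone_eq\<close> in place of injectivity, maps
  from \<open>X\<close> thus see \<open>J Z\<close> as the colimit of \<open>J F\<close>.\<close>

lemma presents_factor:
  assumes S: "presents X S Q" and X: "X \<in> obj K"
    and F: "is_functor D A F" and Z: "is_colimit D A F Z c"
    and pQ: "\<And>B. B \<in> Q \<Longrightarrow> hom_preserves D A F Z c B" and k: "k \<in> hom K X (fobj J Z)"
  obtains d k' where "d \<in> obj D" "k' \<in> hom K X (fobj J (fobj F d))"
    "act K J X (fobj F d) Z (c d) k' = k"
proof -
  note cc = colimit_coconeD[OF Z] and ZA = colimit_objD[OF Z] and FA = fobj_in[OF F]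
  obtain B h f where Bh: "(B, h) \<in> S" and B: "B \<in> obj A" and h: "h \<in> hom K X (fobj J B)"
    and f: "f \<in> hom A B Z" and fh: "act K J X B Z f h = k"
    by (rule covers_factor[OF presentsD(5)[OF S] ZA k])
  have "B \<in> Q" using presentsD(4)[OF S] Bh by force
  from hom_preserves_factor[OF pQ[OF this] f] obtain d f' where d: "d \<in> obj D"
    and f': "f' \<in> hom A B (fobj F d)" "cmp A B (fobj F d) Z (c d) f' = f" .
  note JO = fobj_in[OF J B] fobj_in[OF J FA[OF d]] fobj_in[OF J ZA]
  note Jf' = fmap_in[OF J f'(1) B FA[OF d]] and cd = cocone_inD[OF cc d]
  have "act K J X (fobj F d) Z (c d)
      (act K J X B (fobj F d) f' h) = k"
    using assocK[OF h Jf' fmap_in[OF J cd FA[OF d] ZA] X JO] fmap_cmp[OF J f'(1) cd B FA[OF d] ZA]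
      f'(2) fh by simp
  then show ?thesis using that[OF d inK[OF h Jf' X JO(1,2)]] by blast
qed

text \<open>\<open>J Z\<close> is a \<beta>-filtered colimit of generators \<open>P i\<close> of
  \<open>K\<close>, so a map from \<open>J Z\<close> to \<open>W\<close> can be prescribed on the
  legs \<open>g x\<close>. Each leg is lifted to a stage of \<open>J F\<close> and followed by
  \<epsilon>; \<open>presents_cocone_eq\<close> makes the result independent of the lift.\<close>

lemma preserved_colimit:
  assumes \<beta>: "regular_cardinal (\<beta> :: 'u rel)"
    and I: "\<And>i. i \<in> I \<Longrightarrow> presentable \<beta> K (P i)"
    and gen: "\<And>X. X \<in> obj K \<Longrightarrow> colimit_from (filtered \<beta>) K (P ` I) X"
    and S: "\<And>i. i \<in> I \<Longrightarrow> presents (P i) (S i) (Q i)"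
    and D: "is_category D" "fin_filtered D" and F: "is_functor D A F" and Z: "is_colimit D A F Z c"
    and pQ: "\<And>i B. i \<in> I \<Longrightarrow> B \<in> Q i \<Longrightarrow> hom_preserves D A F Z c B"
  shows "is_colimit D K (comp_functor J F) (fobj J Z) (\<lambda>d. fmap J (fobj F d) Z (c d))"
proof -
  note cc = colimit_coconeD[OF Z] and ZA = colimit_objD[OF Z] and FA = fobj_in[OF F]
  have JFO: "fobj J (fobj F d) \<in> obj K" if "d \<in> obj D" for d by (rule fobj_in[OF J FA[OF that]])
  have JZ: "fobj J Z \<in> obj K" by (rule fobj_in[OF J ZA])
  define cJ where "cJ d = fmap J (fobj F d) Z (c d)" for d
  have cJ: "cJ d \<in> hom K (fobj J (fobj F d)) (fobj J Z)" if "d \<in> obj D" for d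
    unfolding cJ_def by (rule fmap_in[OF J cocone_inD[OF cc that] FA[OF that] ZA])
  have PK: "P i \<in> obj K" if "i \<in> I" for i using I[OF that] by (simp add: presentable_def)
  obtain E :: "('u, 'u) category" and G g where E: "small_category E" "filtered \<beta> E"
    and G: "is_functor E K G" and GP: "\<forall>x \<in> obj E. fobj G x \<in> P ` I" and g: "is_colimit E K G (fobj J Z) g"
    using gen[OF JZ] by blast
  note gc = colimit_coconeD[OF g] and GK = fobj_in[OF G]
  have "\<exists>d k. d \<in> obj D \<and> k \<in> hom K (fobj G x) (fobj J (fobj F d)) \<and>
      cmp K (fobj G x) (fobj J (fobj F d)) (fobj J Z) (cJ d) k = g x" if x: "x \<in> obj E" for x
  proof -
    obtain i where i: "i \<in> I" "fobj G x = P i" using GP x by blast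
    have gx: "g x \<in> hom K (P i) (fobj J Z)" using cocone_inD[OF gc x] i(2) by simp
    from presents_factor[OF S[OF i(1)] PK[OF i(1)] F Z pQ[OF i(1)] gx]
    show ?thesis unfolding cJ_def i(2) by metis
  qed
  then obtain \<delta> \<kappa> where \<delta>\<kappa>: "\<forall>x. x \<in> obj E \<longrightarrow> \<delta> x \<in> obj D \<and>
      \<kappa> x \<in> hom K (fobj G x) (fobj J (fobj F (\<delta> x))) \<and>
      cmp K (fobj G x) (fobj J (fobj F (\<delta> x))) (fobj J Z) (cJ (\<delta> x)) (\<kappa> x) = g x"
    by (rule choice_on2)
  note \<delta> = \<delta>\<kappa>[rule_format, THEN conjunct1]
    and \<kappa> = \<delta>\<kappa>[rule_format, THEN conjunct2, THEN conjunct1]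
    and c\<kappa> = \<delta>\<kappa>[rule_format, THEN conjunct2, THEN conjunct2]
  have "\<exists>!u. u \<in> hom K (fobj J Z) W \<and> (\<forall>d \<in> obj D. cmp K (fobj J (fobj F d)) (fobj J Z) W u (cJ d) = \<epsilon> d)"
    if \<epsilon>: "is_cocone D K (comp_functor J F) W \<epsilon>" for W \<epsilon>
  proof -
    have WK: "W \<in> obj K" using \<epsilon> by (simp add: is_cocone_def)
    have \<epsilon>_in: "\<epsilon> d \<in> hom K (fobj J (fobj F d)) W" if "d \<in> obj D" for d
      using cocone_inD[OF \<epsilon> that] by simp
    have eq: "cmp K (P i) (fobj J (fobj F d)) W (\<epsilon> d) k1 = cmp K (P i) (fobj J (fobj F d')) W (\<epsilon> d') k2"
      if "i \<in> I" "d \<in> obj D" "k1 \<in> hom K (P i) (fobj J (fobj F d))"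
        "d' \<in> obj D" "k2 \<in> hom K (P i) (fobj J (fobj F d'))"
        "cmp K (P i) (fobj J (fobj F d)) (fobj J Z) (cJ d) k1 =
         cmp K (P i) (fobj J (fobj F d')) (fobj J Z) (cJ d') k2" for i d k1 d' k2
      by (rule presents_cocone_eq[OF S[OF that(1)] PK[OF that(1)] D F Z pQ[OF that(1)] \<epsilon> that(2-5) that(6)[unfolded cJ_def]])
    define m where "m x = cmp K (fobj G x) (fobj J (fobj F (\<delta> x))) W (\<epsilon> (\<delta> x)) (\<kappa> x)" for x
    have m: "m x \<in> hom K (fobj G x) W" if "x \<in> obj E" for x
      unfolding m_def by (rule inK[OF \<kappa>[OF that] \<epsilon>_in[OF \<delta>[OF that]] GK[OF that] JFO[OF \<delta>[OF that]] WK])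
    have "is_cocone E K G W m"
      unfolding is_cocone_def
    proof (intro conjI ballI)
      show "W \<in> obj K" by (rule WK)
      show "m x \<in> hom K (fobj G x) W" if "x \<in> obj E" for x by (rule m[OF that])
      fix x y v assume x: "x \<in> obj E" and y: "y \<in> obj E" and v: "v \<in> hom E x y"
      note Gv = fmap_in[OF G v x y]
      let ?k = "cmp K (fobj G x) (fobj G y) (fobj J (fobj F (\<delta> y))) (\<kappa> y) (fmap G x y v)"
      have k: "?k \<in> hom K (fobj G x) (fobj J (fobj F (\<delta> y)))"
        by (rule inK[OF Gv \<kappa>[OF y] GK[OF x] GK[OF y] JFO[OF \<delta>[OF y]]])
      obtain i where i: "i \<in> I" "fobj G x = P i" using GP x by blast
      have "cmp K (fobj G x) (fobj J (fobj F (\<delta> y))) (fobj J Z) (cJ (\<delta> y)) ?k = g x"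
        using assocK[OF Gv \<kappa>[OF y] cJ[OF \<delta>[OF y]] GK[OF x] GK[OF y] JFO[OF \<delta>[OF y]] JZ]
          c\<kappa>[OF y] cocone_natD[OF gc v x y] by simp
      then have "cmp K (fobj G x) (fobj J (fobj F (\<delta> y))) W (\<epsilon> (\<delta> y)) ?k = m x"
        unfolding m_def using eq[OF i(1) \<delta>[OF y] _ \<delta>[OF x]] k \<kappa>[OF x] c\<kappa>[OF x] unfolding i(2) by metis
      then show "cmp K (fobj G x) (fobj G y) W (m y) (fmap G x y v) = m x"
        using assocK[OF Gv \<kappa>[OF y] \<epsilon>_in[OF \<delta>[OF y]] GK[OF x] GK[OF y] JFO[OF \<delta>[OF y]] WK]
        by (simp add: m_def[of y])
    qed
    from colimit_map[OF g this] obtain u where u: "u \<in> hom K (fobj J Z) W"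
      and ug: "\<And>x. x \<in> obj E \<Longrightarrow> cmp K (fobj G x) (fobj J Z) W u (g x) = m x" by blast
    \<comment> \<open>So far \<open>u\<close> is known only on the legs \<open>g x\<close>. A map
      from a generator into \<open>J Z\<close> factors through some leg because \<open>P i\<close>
      is \<beta>-presentable and \<open>E\<close> is \<beta>-filtered, and two lifts of it to
      \<open>J F\<close> have the same value under \<epsilon>.\<close>
    have u_cJ: "cmp K (P i) (fobj J Z) W u (cmp K (P i) (fobj J (fobj F d)) (fobj J Z) (cJ d) k) =
        cmp K (P i) (fobj J (fobj F d)) W (\<epsilon> d) k"
      if i: "i \<in> I" and d: "d \<in> obj D" and k: "k \<in> hom K (P i) (fobj J (fobj F d))" for i d k
    proof -
      note P = PK[OF i]
      have hp: "hom_preserves E K G (fobj J Z) g (P i)"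
        by (rule presentable_hom_preserves[OF catK I[OF i] \<beta> E G g])
      have ck: "cmp K (P i) (fobj J (fobj F d)) (fobj J Z) (cJ d) k \<in> hom K (P i) (fobj J Z)"
        by (rule inK[OF k cJ[OF d] P JFO[OF d] JZ])
      obtain x y where x: "x \<in> obj E" and y: "y \<in> hom K (P i) (fobj G x)"
        and gy: "cmp K (P i) (fobj G x) (fobj J Z) (g x) y = cmp K (P i) (fobj J (fobj F d)) (fobj J Z) (cJ d) k"
        by (rule hom_preserves_factor[OF hp ck])
      let ?k = "cmp K (P i) (fobj G x) (fobj J (fobj F (\<delta> x))) (\<kappa> x) y"
      have k': "?k \<in> hom K (P i) (fobj J (fobj F (\<delta> x)))"
        by (rule inK[OF y \<kappa>[OF x] P GK[OF x] JFO[OF \<delta>[OF x]]])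
      have "cmp K (P i) (fobj J (fobj F (\<delta> x))) (fobj J Z) (cJ (\<delta> x)) ?k =
        cmp K (P i) (fobj J (fobj F d)) (fobj J Z) (cJ d) k"
        using assocK[OF y \<kappa>[OF x] cJ[OF \<delta>[OF x]] P GK[OF x] JFO[OF \<delta>[OF x]] JZ] c\<kappa>[OF x] gy
        by simp
      from eq[OF i \<delta>[OF x] k' d k this]
      have "cmp K (P i) (fobj G x) W (m x) y = cmp K (P i) (fobj J (fobj F d)) W (\<epsilon> d) k"
        unfolding m_def
        using assocK[OF y \<kappa>[OF x] \<epsilon>_in[OF \<delta>[OF x]] P GK[OF x] JFO[OF \<delta>[OF x]] WK] by simp
      then show ?thesis
        using assocK[OF y cocone_inD[OF gc x] u P GK[OF x] JZ WK] ug[OF x] gy by simp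
    qed
    have ex: "cmp K (fobj J (fobj F d)) (fobj J Z) W u (cJ d) = \<epsilon> d" if d: "d \<in> obj D" for d
    proof -
      \<comment> \<open>\<open>J (F d)\<close> is a colimit of generators as well, so agreement on
        maps from generators is enough.\<close>
      obtain E' :: "('u, 'u) category" and G' g' where G': "is_functor E' K G'"
        and GP': "\<forall>x \<in> obj E'. fobj G' x \<in> P ` I" and g': "is_colimit E' K G' (fobj J (fobj F d)) g'"
        using gen[OF JFO[OF d]] by blast
      show ?thesis
      proof (rule colimit_eqI[OF catK(1) G' g' WK _ \<epsilon>_in[OF d]])
        show "cmp K (fobj J (fobj F d)) (fobj J Z) W u (cJ d) \<in> hom K (fobj J (fobj F d)) W"
          by (rule inK[OF cJ[OF d] u JFO[OF d] JZ WK])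
        fix x assume x: "x \<in> obj E'"
        then obtain i where i: "i \<in> I" "fobj G' x = P i" using GP' by blast
        have g'x: "g' x \<in> hom K (P i) (fobj J (fobj F d))"
          using cocone_inD[OF colimit_coconeD[OF g'] x] i(2) by simp
        show "cmp K (fobj G' x) (fobj J (fobj F d)) W (cmp K (fobj J (fobj F d)) (fobj J Z) W u (cJ d)) (g' x) =
          cmp K (fobj G' x) (fobj J (fobj F d)) W (\<epsilon> d) (g' x)"
          unfolding i(2)
          using assocK[OF g'x cJ[OF d] u PK[OF i(1)] JFO[OF d] JZ WK] u_cJ[OF i(1) d g'x] by simp
      qed
    qed
    have uniq: "v = u" if v: "v \<in> hom K (fobj J Z) W"
      and vc: "\<forall>d \<in> obj D. cmp K (fobj J (fobj F d)) (fobj J Z) W v (cJ d) = \<epsilon> d" for v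
    proof (rule colimit_eqI[OF catK(1) G g WK v u])
      fix x assume x: "x \<in> obj E"
      have "cmp K (fobj G x) (fobj J Z) W v (g x) = m x"
        using assocK[OF \<kappa>[OF x] cJ[OF \<delta>[OF x]] v GK[OF x] JFO[OF \<delta>[OF x]] JZ WK] c\<kappa>[OF x]
          vc \<delta>[OF x] by (simp add: m_def)
      then show "cmp K (fobj G x) (fobj J Z) W v (g x) = cmp K (fobj G x) (fobj J Z) W u (g x)"
        using ug[OF x] by simp
    qed
    show ?thesis using u ex uniq by blast
  qed
  moreover have "is_cocone D K (comp_functor J F) (fobj J Z) cJ"
    unfolding cJ_def by (rule is_cocone_comp_functor[OF F J cc])
  ultimately show ?thesis
    unfolding is_colimit_def cJ_def by simp
qed

text \<open>The presentations of the generators of \<open>K\<close> are chosen at the index \<beta>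
  that \<open>K\<close> already has. Only then is \<mu> taken, above \<alpha>, so that
  \<open>A\<close> has the colimits, and above the ranks in \<open>A\<close> of all objects in these
  presentations.\<close>

lemma cone_reflective_imp_accessibly_embedded:
  assumes "cone_reflective A K J"
  shows "accessibly_embedded A K J"
proof -
  obtain \<alpha> :: "'u rel" where \<alpha>: "regular_cardinal \<alpha>" and colims: "has_filtered_colimits \<alpha> A"
    using accA unfolding accessible_def accessible_for_def by blast
  obtain \<beta> :: "'u rel" and I :: "'u set" and P where \<beta>: "regular_cardinal \<beta>"
    and I: "small I" "\<forall>i \<in> I. presentable \<beta> K (P i)"
    and gen: "\<forall>X \<in> obj K. colimit_from (filtered \<beta>) K (P ` I) X"
    using accK unfolding accessible_def accessible_for_def by blast
  have "\<exists>S Q. presents (P i) S Q" if "i \<in> I" for i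
    using cone_reflective_imp_presents[OF assms] I(2) that unfolding presentable_def by blast
  then obtain S Q where SQ': "\<forall>i. i \<in> I \<longrightarrow> presents (P i) (S i) (Q i)"
    by (rule choice_on2)
  note SQ = SQ'[rule_format]
  define QQ where "QQ = (\<Union>i \<in> I. Q i)"
  have QQ: "usmall U QQ" "QQ \<subseteq> obj A"
    unfolding QQ_def using I(1) presentsD(2,3)[OF SQ]
    by (auto intro: usmall_UN simp: small_usmall)
  have "\<forall>B. \<exists>N :: 'u set. B \<in> QQ \<longrightarrow> small N \<and> (\<forall>M :: 'u set. |N| \<le>o |M| \<longrightarrow> le_presentable M A B)"
    using accessible_le_presentable[OF accA] QQ(2) by (metis subsetD)
  from choice[OF this] obtain NB :: "'a \<Rightarrow> 'u set" where NB: "\<forall>B. B \<in> QQ \<longrightarrow> small (NB B) \<and>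
    (\<forall>M :: 'u set. |NB B| \<le>o |M| \<longrightarrow> le_presentable M A B)" ..
  \<comment> \<open>\<open>NB B\<close> is a bound for the single object \<open>B\<close>. The sum
    of all these bounds is small and lies above each of them.\<close>
  have "usmall U ((Field \<alpha> <+> Field \<beta>) <+> Sigma QQ NB)"
    using NB QQ(1) usmall_Field_regular[OF \<alpha>] usmall_Field_regular[OF \<beta>]
    by (intro usmall_Plus usmall_Sigma) (simp_all add: small_usmall)
  then obtain N :: "'u set" where N: "small N" "infinite N" "|(Field \<alpha> <+> Field \<beta>) <+> Sigma QQ NB| \<le>o |N|"
    by (rule usmall_bound)
  note N1 = ordLeq_transitive[OF card_of_Plus1 N(3)] and N2 = ordLeq_transitive[OF card_of_Plus2 N(3)]
  have pB: "le_presentable N A B" if B: "B \<in> QQ" for B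
  proof -
    have "NB B \<subseteq> snd ` ({B} \<times> NB B)" by auto
    then have "|NB B| \<le>o |{B} \<times> NB B|"
      by (rule ordLeq_transitive[OF card_of_mono1 card_of_image])
    moreover have "{B} \<times> NB B \<subseteq> Sigma QQ NB" using B by auto
    then have "|{B} \<times> NB B| \<le>o |N|" by (rule ordLeq_transitive[OF card_of_mono1 N2])
    ultimately have "|NB B| \<le>o |N|" by (rule ordLeq_transitive)
    then show ?thesis using NB B by blast
  qed
  obtain \<mu> :: "'u rel" where \<mu>: "regular_cardinal \<mu>" "|N| <o \<mu>"
    by (rule small_successor[OF N(1,2)])
  have le_\<mu>: "\<rho> \<le>o \<mu>" if "regular_cardinal \<rho>" "|Field \<rho>| \<le>o |N|" for \<rho> :: "'u rel"
  proof -
    have "\<rho> =o |Field \<rho>|"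
      using that(1) card_of_Field_ordIso ordIso_symmetric unfolding regular_cardinal_def by blast
    then show ?thesis
      using ordIso_ordLeq_trans[OF _ ordLeq_transitive[OF that(2) ordLess_imp_ordLeq[OF \<mu>(2)]]] by blast
  qed
  have "\<alpha> \<le>o \<mu>" by (rule le_\<mu>[OF \<alpha> ordLeq_transitive[OF card_of_Plus1 N1]])
  then have "has_filtered_colimits \<mu> A"
    using colims filtered_mono unfolding has_filtered_colimits_def by blast
  moreover have "preserves_filtered_colimits \<mu> A K J"
    unfolding preserves_filtered_colimits_def
  proof (intro allI impI, elim conjE)
    fix D :: "('u, 'u) category" and F Z c
    assume D: "small_category D" "filtered \<mu> D" and F: "is_functor D A F" and Z: "is_colimit D A F Z c"
    note DD = small_categoryD(1)[OF D(1)]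
    have le: "le_filtered N D" by (rule filtered_le_filtered[OF DD D(2) \<mu>])
    show "is_colimit D K (comp_functor J F) (fobj J Z) (\<lambda>i. fmap J (fobj F i) Z (c i))"
    proof (rule preserved_colimit[OF \<beta> _ _ SQ DD le_filtered_fin_filtered[OF le N(2)] F Z])
      show "presentable \<beta> K (P i)" if "i \<in> I" for i using I(2) that by blast
      show "colimit_from (filtered \<beta>) K (P ` I) X" if "X \<in> obj K" for X
        using gen that by blast
      show "hom_preserves D A F Z c B" if "i \<in> I" "B \<in> Q i" for i B
      proof -
        have "le_presentable N A B" by (rule pB) (use that in \<open>auto simp: QQ_def\<close>)
        then show ?thesis using D(1) le F Z unfolding le_presentable_def by blast
      qed
    qed
  qed
  ultimately show ?thesis using \<mu>(1) unfolding accessibly_embedded_def by blast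
qed

end

section \<open>Small functors\<close>

lemma functor_category_simps:
  "F \<in> obj (functor_category C D) \<longleftrightarrow> is_functor C D F"
  "idt (functor_category C D) F = (\<lambda>X \<in> obj C. idt D (fobj F X))"
  "cmp (functor_category C D) F G H \<theta> \<eta> =
     (\<lambda>X \<in> obj C. cmp D (fobj F X) (fobj G X) (fobj H X) (\<theta> X) (\<eta> X))"
  by (simp_all add: functor_category_def)

lemma set_nat_transI:
  assumes "\<And>X. X \<in> obj C \<Longrightarrow> \<eta> X \<in> fobj F X \<rightarrow>\<^sub>E fobj G X" "\<eta> \<in> extensional (obj C)"
    and "\<And>X Y f x. X \<in> obj C \<Longrightarrow> Y \<in> obj C \<Longrightarrow> f \<in> hom C X Y \<Longrightarrow> x \<in> fobj F X \<Longrightarrow>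
      fmap G X Y f (\<eta> X x) = \<eta> Y (fmap F X Y f x)"
  shows "\<eta> \<in> hom (functor_category C Set) F G"
  using assms by (auto simp: functor_category_def PiE_def compose_def fun_eq_iff)

lemma set_nat_transD:
  assumes "\<eta> \<in> hom (functor_category C Set) F G"
  shows "X \<in> obj C \<Longrightarrow> \<eta> X \<in> fobj F X \<rightarrow>\<^sub>E fobj G X" "\<eta> \<in> extensional (obj C)"
    "X \<in> obj C \<Longrightarrow> Y \<in> obj C \<Longrightarrow> f \<in> hom C X Y \<Longrightarrow> x \<in> fobj F X \<Longrightarrow>
      fmap G X Y f (\<eta> X x) = \<eta> Y (fmap F X Y f x)"
proof -
  have \<eta>: "\<eta> \<in> (\<Pi>\<^sub>E X \<in> obj C. fobj F X \<rightarrow>\<^sub>E fobj G X)"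
    using assms by (simp add: functor_category_def)
  then show "X \<in> obj C \<Longrightarrow> \<eta> X \<in> fobj F X \<rightarrow>\<^sub>E fobj G X" "\<eta> \<in> extensional (obj C)"
    by (auto simp: PiE_def)
  assume *: "X \<in> obj C" "Y \<in> obj C" "f \<in> hom C X Y" "x \<in> fobj F X"
  then have "compose (fobj F X) (fmap G X Y f) (\<eta> X) = compose (fobj F X) (\<eta> Y) (fmap F X Y f)"
    using assms by (simp add: functor_category_def)
  from fun_cong[OF this, of x] show "fmap G X Y f (\<eta> X x) = \<eta> Y (fmap F X Y f x)"
    using *(4) by (simp add: compose_def)
qed

lemma set_nat_trans_eqI:
  assumes "\<eta> \<in> hom (functor_category C Set) F G" "\<theta> \<in> hom (functor_category C Set) F G"
    and "\<And>X x. X \<in> obj C \<Longrightarrow> x \<in> fobj F X \<Longrightarrow> \<eta> X x = \<theta> X x"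
  shows "\<eta> = \<theta>"
proof (rule extensionalityI[OF set_nat_transD(2)[OF assms(1)] set_nat_transD(2)[OF assms(2)]])
  fix X assume X: "X \<in> obj C"
  show "\<eta> X = \<theta> X"
    by (rule PiE_ext[OF set_nat_transD(1)[OF assms(1) X] set_nat_transD(1)[OF assms(2) X]])
      (rule assms(3)[OF X])
qed

lemma set_nat_trans_in:
  "\<eta> \<in> hom (functor_category C Set) F G \<Longrightarrow> X \<in> obj C \<Longrightarrow> x \<in> fobj F X \<Longrightarrow> \<eta> X x \<in> fobj G X"
  by (rule PiE_mem[OF set_nat_transD(1)])

lemma set_nat_trans_cmp:
  assumes "X \<in> obj C" "x \<in> fobj F X"
  shows "cmp (functor_category C Set) F G H \<theta> \<eta> X x = \<theta> X (\<eta> X x)"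
  using assms by (simp add: functor_category_simps compose_def)

lemma set_functor_idt:
  assumes "is_functor C Set F" "X \<in> obj C" "x \<in> fobj F X"
  shows "fmap F X X (idt C X) x = x"
  using fmap_idt[OF assms(1,2)] assms(3) by simp

text \<open>The colimit is compared with the joint image of its cocone.\<close>

lemma functor_colimit_surj:
  fixes F0 :: "('o, 'm, 'u set, 'u \<Rightarrow> 'u) funct"
  assumes Hf: "\<And>d. d \<in> obj D \<Longrightarrow> is_functor C Set (fobj H d)"
    and col: "is_colimit D (functor_category C Set) H F0 c"
    and X: "X \<in> obj C" and x: "x \<in> fobj F0 X"
  obtains d y where "d \<in> obj D" "y \<in> fobj (fobj H d) X" "c d X y = x"
proof -
  let ?FC = "functor_category C Set"
  have F0: "is_functor C Set F0"
    using colimit_objD[OF col] by (simp add: functor_category_simps)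
  have c: "c d \<in> hom ?FC (fobj H d) F0" if "d \<in> obj D" for d
    using cocone_inD[OF colimit_coconeD[OF col] that] .
  define Im where "Im X = {x \<in> fobj F0 X. \<exists>d \<in> obj D. \<exists>y \<in> fobj (fobj H d) X. c d X y = x}" for X
  define G :: "('o, 'm, 'u set, 'u \<Rightarrow> 'u) funct" where
    "G = \<lparr>fobj = Im, fmap = (\<lambda>X Y f. restrict (fmap F0 X Y f) (Im X))\<rparr>"
  have G_simps: "fobj G X = Im X" "fmap G X Y f = restrict (fmap F0 X Y f) (Im X)" for X Y f
    by (simp_all add: G_def)
  have Im_sub: "x \<in> fobj F0 X" if "x \<in> Im X" for x X using that by (simp add: Im_def)
  have Im_map: "fmap F0 X Y f x \<in> Im Y" if XY: "X \<in> obj C" "Y \<in> obj C" "f \<in> hom C X Y" and x: "x \<in> Im X" for X Y f x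
  proof -
    obtain d y where d: "d \<in> obj D" "y \<in> fobj (fobj H d) X" "c d X y = x"
      using x by (auto simp: Im_def)
    have "c d Y (fmap (fobj H d) X Y f y) = fmap F0 X Y f x"
      using set_nat_transD(3)[OF c[OF d(1)] XY d(2)] d(3) by simp
    then show ?thesis
      using set_fmap_in[OF F0 XY Im_sub[OF x]] set_fmap_in[OF Hf[OF d(1)] XY d(2)] d(1)
      unfolding Im_def by blast
  qed
  have G: "is_functor C Set G"
    unfolding is_functor_def
  proof (intro conjI ballI)
    fix X assume X: "X \<in> obj C"
    have "small (fobj F0 X)" using fobj_in[OF F0 X] by simp
    moreover have "Im X \<subseteq> fobj F0 X" using Im_sub by blast
    ultimately show "fobj G X \<in> obj Set"
      using usmall_subset[of "TYPE('u)"] by (simp add: G_simps small_iff_usmall[where U = "TYPE('u)"])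
    show "fmap G X X (idt C X) = idt Set (fobj G X)"
      using set_functor_idt[OF F0 X Im_sub] by (auto simp: G_simps)
    fix Y f assume Y: "Y \<in> obj C" and f: "f \<in> hom C X Y"
    show "fmap G X Y f \<in> hom Set (fobj G X) (fobj G Y)"
      using Im_map[OF X Y f] by (simp add: G_simps)
    fix Z g assume Z: "Z \<in> obj C" and g: "g \<in> hom C Y Z"
    show "fmap G X Z (cmp C X Y Z g f) = act Set G (fobj G X) Y Z g (fmap G X Y f)"
      using set_fmap_cmp[OF F0 X Y Z f g Im_sub] Im_map[OF X Y f] by (auto simp: G_simps compose_def fun_eq_iff)
  qed
  have cG: "c d \<in> hom ?FC (fobj H d) G" if d: "d \<in> obj D" for d
  proof (rule set_nat_transI)
    show "c d X \<in> fobj (fobj H d) X \<rightarrow>\<^sub>E fobj G X" if X: "X \<in> obj C" for X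
      using set_nat_transD(1)[OF c[OF d] X] d by (auto simp: G_simps Im_def)
    then have in_Im: "c d X x \<in> Im X" if "X \<in> obj C" "x \<in> fobj (fobj H d) X" for X x
      using that by (auto simp: G_simps)
    show "c d \<in> extensional (obj C)" by (rule set_nat_transD(2)[OF c[OF d]])
    show "fmap G X Y f (c d X x) = c d Y (fmap (fobj H d) X Y f x)"
      if "X \<in> obj C" "Y \<in> obj C" "f \<in> hom C X Y" "x \<in> fobj (fobj H d) X" for X Y f x
      using set_nat_transD(3)[OF c[OF d] that] in_Im[OF that(1,4)] by (simp add: G_simps)
  qed
  have "is_cocone D ?FC H G c"
    using colimit_coconeD[OF col] G cG unfolding is_cocone_def by (simp add: functor_category_simps)
  from colimit_map[OF col this] obtain u where u: "u \<in> hom ?FC F0 G"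
    and uc: "\<And>d. d \<in> obj D \<Longrightarrow> cmp ?FC (fobj H d) F0 G u (c d) = c d" by blast
  \<comment> \<open>Composed with the inclusion of the joint image, \<open>u\<close> is an
    endomorphism of the colimit that fixes the cocone. It is therefore the identity, and the joint
    image is everything.\<close>
  have u': "u \<in> hom ?FC F0 F0"
  proof (rule set_nat_transI)
    show "u X \<in> fobj F0 X \<rightarrow>\<^sub>E fobj F0 X" if "X \<in> obj C" for X
      using set_nat_transD(1)[OF u that] PiE_mono[of "fobj F0 X" "\<lambda>_. Im X" "\<lambda>_. fobj F0 X"] Im_sub
      unfolding G_simps by blast
    show "u \<in> extensional (obj C)" by (rule set_nat_transD(2)[OF u])
    show "fmap F0 X Y f (u X x) = u Y (fmap F0 X Y f x)"
      if "X \<in> obj C" "Y \<in> obj C" "f \<in> hom C X Y" "x \<in> fobj F0 X" for X Y f x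
      using set_nat_transD(3)[OF u that] set_nat_trans_in[OF u that(1,4)] by (simp add: G_simps)
  qed
  have id: "idt ?FC F0 \<in> hom ?FC F0 F0"
    by (rule set_nat_transI) (auto simp: functor_category_simps set_fmap_in[OF F0])
  have id_c: "cmp ?FC (fobj H d) F0 F0 (idt ?FC F0) (c d) = c d" if d: "d \<in> obj D" for d
  proof (rule extensionalityI)
    show "cmp ?FC (fobj H d) F0 F0 (idt ?FC F0) (c d) \<in> extensional (obj C)"
      by (simp add: functor_category_simps)
    show "c d \<in> extensional (obj C)" by (rule set_nat_transD(2)[OF c[OF d]])
    fix X assume X: "X \<in> obj C"
    note cX = set_nat_transD(1)[OF c[OF d] X]
    have "cmp ?FC (fobj H d) F0 F0 (idt ?FC F0) (c d) X = compose (fobj (fobj H d) X) (\<lambda>x \<in> fobj F0 X. x) (c d X)"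
      using X by (simp add: functor_category_simps)
    also have "\<dots> = c d X"
      using cX by (intro ext) (auto simp: compose_def PiE_def extensional_def)
    finally show "cmp ?FC (fobj H d) F0 F0 (idt ?FC F0) (c d) X = c d X" .
  qed
  have uc': "cmp ?FC (fobj H d) F0 F0 u (c d) = c d" if "d \<in> obj D" for d
    using uc[OF that] by (simp add: functor_category_simps)
  have "\<exists>!v. v \<in> hom ?FC F0 F0 \<and> (\<forall>d \<in> obj D. cmp ?FC (fobj H d) F0 F0 v (c d) = c d)"
    using col unfolding is_colimit_def by blast
  then have "u = idt ?FC F0" using u' uc' id id_c by blast
  then have "u X x = x" using X x by (simp add: functor_category_simps)
  moreover have "u X x \<in> Im X" using set_nat_trans_in[OF u X x] by (simp add: G_simps)
  ultimately have "x \<in> Im X" by simp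
  then show ?thesis using that by (auto simp: Im_def)
qed

section \<open>Virtual reflectivity and presentations\<close>

context accessible_embedding
begin

lemma is_functor_restricted_hom:
  assumes "X \<in> obj K"
  shows "is_functor A Set (comp_functor (hom_functor K X) J)"
  by (rule is_functor_comp[OF J is_functor_hom_functor[OF catK assms]])

lemma restricted_hom_simps:
  "fobj (comp_functor (hom_functor K X) J) A' = hom K X (fobj J A')"
  "k \<in> hom K X (fobj J A') \<Longrightarrow> fmap (comp_functor (hom_functor K X) J) A' A'' f k =
     act K J X A' A'' f k"
  by (simp_all add: hom_functor_def)

lemma hom_functor_simps:
  "fobj (hom_functor C X) Y = hom C X Y"
  "f \<in> hom C X Y \<Longrightarrow> fmap (hom_functor C X) Y Z g f = cmp C X Y Z g f"
  by (simp_all add: hom_functor_def)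

text \<open>By Yoneda the leg at \<open>d\<close>, preceded by the isomorphism with
  \<open>A(B d, -)\<close>, is the element \<open>h d\<close> of \<open>K(X, J (B d))\<close>. These
  elements cover because the legs of a colimit of set-valued functors are jointly
  surjective.\<close>

lemma virtually_reflective_imp_cone_reflective:
  assumes "virtually_reflective A K J"
  shows "cone_reflective A K J"
  unfolding cone_reflective_iff
proof
  fix X assume X: "X \<in> obj K"
  let ?FC = "functor_category A Set" and ?F0 = "comp_functor (hom_functor K X) J"
  obtain D :: "('u, 'u) category" and H c where D: "small_category D" and H: "is_functor D ?FC H"
    and rep: "\<forall>d \<in> obj D. representable A (fobj H d)" and col: "is_colimit D ?FC H ?F0 c"
    using assms X unfolding virtually_reflective_def small_functor_def by blast
  have Hf: "is_functor A Set (fobj H d)" if "d \<in> obj D" for d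
    using fobj_in[OF H that] by (simp add: functor_category_simps)
  have "\<forall>d. \<exists>B. d \<in> obj D \<longrightarrow> B \<in> obj A \<and> isomorphic ?FC (hom_functor A B) (fobj H d)"
    using rep unfolding representable_def by blast
  from choice[OF this] obtain B where B: "\<forall>d. d \<in> obj D \<longrightarrow> B d \<in> obj A \<and>
    isomorphic ?FC (hom_functor A (B d)) (fobj H d)" ..
  then have "\<forall>d. \<exists>\<tau>. d \<in> obj D \<longrightarrow> \<tau> \<in> hom ?FC (hom_functor A (B d)) (fobj H d) \<and>
    (\<exists>\<sigma> \<in> hom ?FC (fobj H d) (hom_functor A (B d)).
       cmp ?FC (fobj H d) (hom_functor A (B d)) (fobj H d) \<tau> \<sigma> = idt ?FC (fobj H d))"
    unfolding isomorphic_def by blast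
  from choice[OF this] obtain \<tau> where \<tau>: "\<forall>d. d \<in> obj D \<longrightarrow>
    \<tau> d \<in> hom ?FC (hom_functor A (B d)) (fobj H d) \<and>
    (\<exists>\<sigma> \<in> hom ?FC (fobj H d) (hom_functor A (B d)).
       cmp ?FC (fobj H d) (hom_functor A (B d)) (fobj H d) (\<tau> d) \<sigma> = idt ?FC (fobj H d))" ..
  have cd: "c d \<in> hom ?FC (fobj H d) ?F0" if "d \<in> obj D" for d
    using cocone_inD[OF colimit_coconeD[OF col] that] .
  define h where "h d = c d (B d) (\<tau> d (B d) (idt A (B d)))" for d
  have \<tau>id: "\<tau> d (B d) (idt A (B d)) \<in> fobj (fobj H d) (B d)" if d: "d \<in> obj D" for d
    using set_nat_trans_in[of "\<tau> d" A "hom_functor A (B d)" "fobj H d" "B d" "idt A (B d)"] \<tau> B d idt_in[OF catA(1)]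
    by (simp add: hom_functor_simps)
  have h: "h d \<in> hom K X (fobj J (B d))" if d: "d \<in> obj D" for d
    unfolding h_def using set_nat_trans_in[OF cd[OF d] _ \<tau>id[OF d]] B d
    by (simp only: restricted_hom_simps)
  let ?S = "(\<lambda>d. (B d, h d)) ` obj D"
  have "usmall U ?S"
    using small_categoryD(2)[OF D] by (intro usmall_image) (simp add: small_usmall)
  moreover have "covers X ?S"
    unfolding covers_def
  proof (intro conjI ballI)
    show "case x of (B, h) \<Rightarrow> B \<in> obj A \<and> h \<in> hom K X (fobj J B)" if "x \<in> ?S" for x
      using that B h by auto
    fix A' k assume A': "A' \<in> obj A" and k: "k \<in> hom K X (fobj J A')"
    then have "k \<in> fobj ?F0 A'" by (simp only: restricted_hom_simps)
    from functor_colimit_surj[OF Hf col A' this]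
    obtain d y where d: "d \<in> obj D" and y: "y \<in> fobj (fobj H d) A'" and cy: "c d A' y = k" .
    have Bd: "B d \<in> obj A" using B d by blast
    have \<tau>d: "\<tau> d \<in> hom ?FC (hom_functor A (B d)) (fobj H d)" using \<tau> d by blast
    obtain \<sigma> where \<sigma>: "\<sigma> \<in> hom ?FC (fobj H d) (hom_functor A (B d))"
      and \<tau>\<sigma>: "cmp ?FC (fobj H d) (hom_functor A (B d)) (fobj H d) (\<tau> d) \<sigma> = idt ?FC (fobj H d)"
      using \<tau> d by blast
    define f where "f = \<sigma> A' y"
    have f: "f \<in> hom A (B d) A'"
      using set_nat_trans_in[OF \<sigma> A' y] by (simp add: f_def hom_functor_simps)
    have "\<tau> d A' f = cmp ?FC (fobj H d) (hom_functor A (B d)) (fobj H d) (\<tau> d) \<sigma> A' y"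
      unfolding f_def by (rule set_nat_trans_cmp[OF A' y, symmetric])
    then have "\<tau> d A' f = y"
      unfolding \<tau>\<sigma> using A' y by (simp add: functor_category_simps)
    moreover have "fmap (fobj H d) (B d) A' f (\<tau> d (B d) (idt A (B d))) = \<tau> d A' f"
      using set_nat_transD(3)[OF \<tau>d Bd A' f, of "idt A (B d)"] idt_in[OF catA(1) Bd] cmp_idt[OF catA(1) f Bd A']
      by (simp add: hom_functor_simps)
    ultimately have "k = fmap ?F0 (B d) A' f (h d)"
      using set_nat_transD(3)[OF cd[OF d] Bd A' f \<tau>id[OF d]] cy by (simp add: h_def)
    then have "k = act K J X (B d) A' f (h d)"
      using restricted_hom_simps(2)[OF h[OF d]] by simp
    then show "\<exists>(B, h) \<in> ?S. \<exists>f \<in> hom A B A'. k = act K J X B A' f h"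
      using d f by (intro bexI[of _ "(B d, h d)"]) auto
  qed
  ultimately show "\<exists>S. usmall U S \<and> covers X S" by blast
qed

lemma representable_hom_functor:
  assumes B: "B \<in> obj A"
  shows "representable A (hom_functor A B)"
proof -
  let ?FC = "functor_category A Set" and ?H = "hom_functor A B"
  have H: "is_functor A Set ?H" by (rule is_functor_hom_functor[OF catA B])
  have id: "idt ?FC ?H \<in> hom ?FC ?H ?H"
    by (rule set_nat_transI) (auto simp: functor_category_simps set_fmap_in[OF H])
  have "cmp ?FC ?H ?H ?H (idt ?FC ?H) (idt ?FC ?H) = idt ?FC ?H"
    by (auto simp: functor_category_simps compose_def fun_eq_iff)
  then have "isomorphic ?FC ?H ?H"
    using id H unfolding isomorphic_def by (auto simp: functor_category_simps(1))
  then show ?thesis using B unfolding representable_def by blast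
qed

text \<open>
  \<open>K(X, J-)\<close> is the colimit of the representables \<open>A(B, -)\<close> over the opposite of the category of
  those of its elements \<open>(B, h)\<close> that have \<open>B \<in> Q\<close>.
\<close>

lemma presents_imp_small_functor:
  assumes S: "presents X S Q" and X: "X \<in> obj K"
  shows "small_functor A (comp_functor (hom_functor K X) J)"
proof -
  let ?FC = "functor_category A Set" and ?F0 = "comp_functor (hom_functor K X) J"
  have QA: "B \<in> obj A" if "B \<in> Q" for B using presentsD(3)[OF S] that by blast
  note JO = fobj_in[OF J]
  let ?T = "Sigma Q (\<lambda>B. hom K X (fobj J B))"
  have T: "usmall U ?T"
    using presentsD(2)[OF S] catK(2) X JO QA
    by (intro usmall_Sigma) (auto simp: locally_small_def small_usmall[symmetric])
  then obtain e :: "'a \<times> 'u \<Rightarrow> 'u" where e: "inj_on e ?T" by (rule usmall_embed)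
  define ob where "ob x = fst (inv_into ?T e x)" for x
  define el where "el x = snd (inv_into ?T e x)" for x
  have ob_e: "ob (e (B, h)) = B" and el_e: "el (e (B, h)) = h" if "B \<in> Q" "h \<in> hom K X (fobj J B)" for B h
    using inv_into_f_f[OF e, of "(B, h)"] that by (simp_all add: ob_def el_def)
  define D :: "('u, 'u) category" where
    "D = \<lparr>obj = e ` ?T,
          hom = (\<lambda>x y. {p \<in> hom A (ob y) (ob x).
                   act K J X (ob y) (ob x) p (el y) = el x}),
          idt = (\<lambda>x. idt A (ob x)), cmp = (\<lambda>x y z g f. cmp A (ob z) (ob y) (ob x) f g)\<rparr>"
  have D_simps: "obj D = e ` ?T"
    "p \<in> hom D x y \<longleftrightarrow> p \<in> hom A (ob y) (ob x) \<and>
       act K J X (ob y) (ob x) p (el y) = el x"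
    "idt D x = idt A (ob x)" "cmp D x y z g f = cmp A (ob z) (ob y) (ob x) f g" for x y z f g p
    by (simp_all add: D_def)
  have D_in: "e (B, h) \<in> obj D" if "B \<in> Q" "h \<in> hom K X (fobj J B)" for B h
    using that by (simp add: D_simps(1))
  have obQ: "ob x \<in> Q" and el: "el x \<in> hom K X (fobj J (ob x))" if "x \<in> obj D" for x
    using that ob_e el_e by (auto simp: D_simps(1))
  note obA = QA[OF obQ]
  have homD: "p \<in> hom A (ob y) (ob x)"
    "act K J X (ob y) (ob x) p (el y) = el x" if "p \<in> hom D x y" for p x y
    using that by (simp_all add: D_simps(2))
  have catD: "is_category D"
    unfolding is_category_def
  proof (intro conjI ballI)
    fix x assume x: "x \<in> obj D"
    have "fmap J (ob x) (ob x) (idt A (ob x)) = idt K (fobj J (ob x))" by (rule fmap_idt[OF J obA[OF x]])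
    then show "idt D x \<in> hom D x x"
      using idt_in[OF catA(1) obA[OF x]] idt_cmp[OF catK(1) el[OF x] X JO[OF obA[OF x]]]
      by (simp add: D_simps(2,3))
    fix y f assume y: "y \<in> obj D" and f: "f \<in> hom D x y"
    show "cmp D x x y f (idt D x) = f" "cmp D x y y (idt D y) f = f"
      using idt_cmp[OF catA(1) homD(1)[OF f] obA[OF y] obA[OF x]]
        cmp_idt[OF catA(1) homD(1)[OF f] obA[OF y] obA[OF x]] by (simp_all add: D_simps(3,4))
    fix z g assume z: "z \<in> obj D" and g: "g \<in> hom D y z"
    note O = obA[OF z] obA[OF y] obA[OF x]
    note m = homD(1)[OF g] homD(1)[OF f]
    have "act K J X (ob z) (ob x) (cmp A (ob z) (ob y) (ob x) f g) (el z) = el x"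
      using fmap_cmp[OF J m O] assocK[OF el[OF z] fmap_in[OF J m(1) O(1,2)] fmap_in[OF J m(2) O(2,3)]
          X JO[OF O(1)] JO[OF O(2)] JO[OF O(3)]] homD(2)[OF f] homD(2)[OF g] by simp
    then show "cmp D x y z g f \<in> hom D x z"
      using inA[OF m O] by (simp add: D_simps(2,4))
    fix w h assume w: "w \<in> obj D" and h: "h \<in> hom D z w"
    show "cmp D x z w h (cmp D x y z g f) = cmp D x y w (cmp D y z w h g) f"
      using assocA[OF homD(1)[OF h] m obA[OF w] O] by (simp add: D_simps(4))
  qed
  have smD: "small_category D"
    unfolding small_category_def locally_small_def
  proof (intro conjI ballI catD)
    show "small (obj D)" unfolding D_simps(1) small_usmall by (rule usmall_image[OF T])
    fix x y assume x: "x \<in> obj D" and y: "y \<in> obj D"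
    have "usmall U (hom A (ob y) (ob x))"
      using catA(2) obA[OF x] obA[OF y] by (simp add: locally_small_def small_usmall)
    moreover have "hom D x y \<subseteq> hom A (ob y) (ob x)" using homD(1) by blast
    ultimately show "small (hom D x y)" unfolding small_usmall by (rule usmall_subset)
  qed
  define H :: "('u, 'u, ('a, 'u, 'u set, 'u \<Rightarrow> 'u) funct, 'a \<Rightarrow> 'u \<Rightarrow> 'u) funct" where
    "H = \<lparr>fobj = (\<lambda>x. hom_functor A (ob x)),
          fmap = (\<lambda>x y p. \<lambda>A' \<in> obj A. \<lambda>f \<in> hom A (ob x) A'. cmp A (ob y) (ob x) A' f p)\<rparr>"
  have H_simps: "fobj H x = hom_functor A (ob x)"
    "fmap H x y p = (\<lambda>A' \<in> obj A. \<lambda>f \<in> hom A (ob x) A'. cmp A (ob y) (ob x) A' f p)" for x y p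
    by (simp_all add: H_def)
  have hf: "is_functor A Set (hom_functor A (ob x))" if "x \<in> obj D" for x
    by (rule is_functor_hom_functor[OF catA obA[OF that]])
  have H: "is_functor D ?FC H"
    unfolding is_functor_def
  proof (intro conjI ballI)
    fix x assume x: "x \<in> obj D"
    show "fobj H x \<in> obj ?FC" using hf[OF x] by (simp add: functor_category_simps H_simps)
    show "fmap H x x (idt D x) = idt ?FC (fobj H x)"
      using cmp_idt[OF catA(1) _ obA[OF x]]
      by (auto simp: functor_category_simps H_simps hom_functor_simps D_simps(3) fun_eq_iff)
    fix y p assume y: "y \<in> obj D" and p: "p \<in> hom D x y"
    note pA = homD(1)[OF p]
    show "fmap H x y p \<in> hom ?FC (fobj H x) (fobj H y)"
    proof (rule set_nat_transI)
      show "fmap H x y p A' \<in> fobj (fobj H x) A' \<rightarrow>\<^sub>E fobj (fobj H y) A'" if "A' \<in> obj A" for A'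
        using inA[OF pA _ obA[OF y] obA[OF x] that] that by (auto simp: H_simps hom_functor_simps)
      show "fmap H x y p \<in> extensional (obj A)" by (simp add: H_simps)
      show "fmap (fobj H y) A' A'' v (fmap H x y p A' f) = fmap H x y p A'' (fmap (fobj H x) A' A'' v f)"
        if A': "A' \<in> obj A" "A'' \<in> obj A" "v \<in> hom A A' A''" and f: "f \<in> fobj (fobj H x) A'" for A' A'' v f
      proof -
        have fA: "f \<in> hom A (ob x) A'" using f by (simp add: H_simps hom_functor_simps)
        show ?thesis
          using assocA[OF pA fA A'(3) obA[OF y] obA[OF x] A'(1,2)] fA A'
            inA[OF pA fA obA[OF y] obA[OF x] A'(1)] inA[OF fA A'(3) obA[OF x] A'(1,2)]
          by (simp add: H_simps hom_functor_simps)
      qed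
    qed
    fix z q assume z: "z \<in> obj D" and q: "q \<in> hom D y z"
    note qA = homD(1)[OF q]
    show "fmap H x z (cmp D x y z q p) = act ?FC H (fobj H x) y z q (fmap H x y p)"
    proof
      fix A'
      show "fmap H x z (cmp D x y z q p) A' =
        act ?FC H (fobj H x) y z q (fmap H x y p) A'"
      proof (cases "A' \<in> obj A")
        case True
        then show ?thesis
          using assocA[OF qA pA _ obA[OF z] obA[OF y] obA[OF x] True]
            inA[OF pA _ obA[OF y] obA[OF x] True]
          by (auto simp: functor_category_simps H_simps hom_functor_simps D_simps(4) compose_def fun_eq_iff)
      qed (simp add: functor_category_simps H_simps)
    qed
  qed
  define c where "c x = (\<lambda>A' \<in> obj A. \<lambda>f \<in> hom A (ob x) A'.
      act K J X (ob x) A' f (el x))" for x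
  have c_eq: "c x A' f = act K J X (ob x) A' f (el x)"
    if "A' \<in> obj A" "f \<in> hom A (ob x) A'" for x A' f
    using that by (simp add: c_def)
  have c_in: "c x A' f \<in> hom K X (fobj J A')" if "x \<in> obj D" "A' \<in> obj A" "f \<in> hom A (ob x) A'" for x A' f
    unfolding c_eq[OF that(2,3)]
    by (rule inK[OF el[OF that(1)] fmap_in[OF J that(3) obA[OF that(1)] that(2)] X
          JO[OF obA[OF that(1)]] JO[OF that(2)]])
  have c_push: "c x A'' (cmp A (ob x) A' A'' v f) = act K J X A' A'' v (c x A' f)"
    if x: "x \<in> obj D" and A': "A' \<in> obj A" "A'' \<in> obj A" and f: "f \<in> hom A (ob x) A'" and v: "v \<in> hom A A' A''"
    for x A' A'' v f
    unfolding c_eq[OF A'(1) f] c_eq[OF A'(2) inA[OF f v obA[OF x] A']]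
    using fmap_cmp[OF J f v obA[OF x] A'] assocK[OF el[OF x] fmap_in[OF J f obA[OF x] A'(1)]
        fmap_in[OF J v A'] X JO[OF obA[OF x]] JO[OF A'(1)] JO[OF A'(2)]] by simp
  have c_arrow: "c y A' (cmp A (ob y) (ob x) A' f p) = c x A' f"
    if x: "x \<in> obj D" and y: "y \<in> obj D" and p: "p \<in> hom D x y" and A': "A' \<in> obj A" and f: "f \<in> hom A (ob x) A'"
    for x y p A' f
    using c_push[OF y obA[OF x] A' homD(1)[OF p] f] c_eq[OF obA[OF x] homD(1)[OF p]] homD(2)[OF p] c_eq[OF A' f]
    by simp
  have c_nat: "c x \<in> hom ?FC (fobj H x) ?F0" if x: "x \<in> obj D" for x
  proof (rule set_nat_transI)
    show "c x A' \<in> fobj (fobj H x) A' \<rightarrow>\<^sub>E fobj ?F0 A'" if A': "A' \<in> obj A" for A'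
      unfolding restricted_hom_simps(1) H_simps hom_functor_simps(1)
      using c_in[OF x A'] A' by (auto simp: c_def)
    show "c x \<in> extensional (obj A)" by (simp add: c_def)
    show "fmap ?F0 A' A'' v (c x A' f) = c x A'' (fmap (fobj H x) A' A'' v f)"
      if A': "A' \<in> obj A" "A'' \<in> obj A" "v \<in> hom A A' A''" and f: "f \<in> fobj (fobj H x) A'" for A' A'' v f
    proof -
      have fA: "f \<in> hom A (ob x) A'" using f by (simp add: H_simps hom_functor_simps)
      show ?thesis
        using restricted_hom_simps(2)[OF c_in[OF x A'(1) fA]] c_push[OF x A'(1,2) fA A'(3)] fA
        by (simp add: H_simps hom_functor_simps)
    qed
  qed
  have F0: "is_functor A Set ?F0" by (rule is_functor_restricted_hom[OF X])
  have cocone: "is_cocone D ?FC H ?F0 c"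
    unfolding is_cocone_def
  proof (intro conjI ballI)
    show "?F0 \<in> obj ?FC" using F0 by (simp only: functor_category_simps)
    show "c x \<in> hom ?FC (fobj H x) ?F0" if "x \<in> obj D" for x by (rule c_nat[OF that])
    fix x y p assume x: "x \<in> obj D" and y: "y \<in> obj D" and p: "p \<in> hom D x y"
    show "cmp ?FC (fobj H x) (fobj H y) ?F0 (c y) (fmap H x y p) = c x"
    proof
      fix A'
      show "cmp ?FC (fobj H x) (fobj H y) ?F0 (c y) (fmap H x y p) A' = c x A'"
      proof (cases "A' \<in> obj A")
        case True
        have "compose (hom A (ob x) A') (c y A') (fmap H x y p A') f = c x A' f" for f
        proof (cases "f \<in> hom A (ob x) A'")
          case f: True
          then show ?thesis using c_arrow[OF x y p True f] True by (simp add: compose_def H_simps)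
        next
          case False
          then show ?thesis using True by (simp add: compose_def c_def)
        qed
        then show ?thesis using True
          by (simp add: functor_category_simps H_simps(1) hom_functor_simps fun_eq_iff)
      next
        case False
        then show ?thesis by (simp add: functor_category_simps c_def)
      qed
    qed
  qed
  have factor: "\<exists>x f. x \<in> obj D \<and> f \<in> hom A (ob x) A' \<and> c x A' f = k"
    if A': "A' \<in> obj A" and k: "k \<in> hom K X (fobj J A')" for A' k
  proof -
    obtain B h f where Bh: "(B, h) \<in> S" and h: "h \<in> hom K X (fobj J B)" and f: "f \<in> hom A B A'"
      and fh: "act K J X B A' f h = k"
      by (rule covers_factor[OF presentsD(5)[OF S] A' k])
    have B: "B \<in> Q" using presentsD(4)[OF S] Bh by force
    show ?thesis
      using D_in[OF B h] ob_e[OF B h] el_e[OF B h] c_eq[OF A', of f "e (B, h)"] f fh by metis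
  qed
  have "\<exists>!u. u \<in> hom ?FC ?F0 W \<and> (\<forall>x \<in> obj D. cmp ?FC (fobj H x) ?F0 W u (c x) = \<epsilon> x)"
    if \<epsilon>: "is_cocone D ?FC H W \<epsilon>" for W \<epsilon>
  proof -
    have W: "is_functor A Set W" using \<epsilon> by (simp add: is_cocone_def functor_category_simps)
    have \<epsilon>_nat: "\<epsilon> x \<in> hom ?FC (hom_functor A (ob x)) W" if "x \<in> obj D" for x
      using cocone_inD[OF \<epsilon> that] by (simp add: H_simps)
    have \<epsilon>_in: "\<epsilon> x A' f \<in> fobj W A'" if "x \<in> obj D" "A' \<in> obj A" "f \<in> hom A (ob x) A'" for x A' f
      using set_nat_trans_in[OF \<epsilon>_nat[OF that(1)] that(2)] that(3) by (simp add: hom_functor_simps)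
    have \<epsilon>_push: "fmap W A' A'' v (\<epsilon> x A' f) = \<epsilon> x A'' (cmp A (ob x) A' A'' v f)"
      if "x \<in> obj D" "A' \<in> obj A" "A'' \<in> obj A" "v \<in> hom A A' A''" "f \<in> hom A (ob x) A'" for x A' A'' v f
      using set_nat_transD(3)[OF \<epsilon>_nat[OF that(1)] that(2-4)] that(5) by (simp add: hom_functor_simps)
    have \<epsilon>_arrow: "\<epsilon> y A' (cmp A (ob y) (ob x) A' f p) = \<epsilon> x A' f"
      if "x \<in> obj D" "y \<in> obj D" "p \<in> hom D x y" "A' \<in> obj A" "f \<in> hom A (ob x) A'" for x y p A' f
    proof -
      have "f \<in> fobj (fobj H x) A'" using that(5) by (simp add: H_simps hom_functor_simps)
      from set_nat_trans_cmp[OF that(4) this, of "fobj H y" W "\<epsilon> y" "fmap H x y p"]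
      show ?thesis using cocone_natD[OF \<epsilon> that(3,1,2)] that(4,5) by (simp add: H_simps)
    qed
    \<comment> \<open>Objects of \<open>D\<close> range over all elements above \<open>Q\<close>,
      while the relations speak of generators only. A generator covering \<open>el x\<close> is
      joined to \<open>x\<close> by an arrow of \<open>D\<close>, and \<epsilon> does not change
      along it.\<close>
    have reduce: "\<exists>B h f'. (B, h) \<in> S \<and> B \<in> obj A \<and> h \<in> hom K X (fobj J B) \<and> f' \<in> hom A B A' \<and>
        act K J X B A' f' h = c x A' f \<and> \<epsilon> (e (B, h)) A' f' = \<epsilon> x A' f"
      if x: "x \<in> obj D" and A': "A' \<in> obj A" and f: "f \<in> hom A (ob x) A'" for x A' f
    proof -
      obtain B h p where Bh: "(B, h) \<in> S" and B: "B \<in> obj A" and h: "h \<in> hom K X (fobj J B)"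
        and p: "p \<in> hom A B (ob x)" and ph: "act K J X B (ob x) p h = el x"
        by (rule covers_factor[OF presentsD(5)[OF S] obA[OF x] el[OF x]])
      have BQ: "B \<in> Q" using presentsD(4)[OF S] Bh by force
      note yD = D_in[OF BQ h] and oe = ob_e[OF BQ h] el_e[OF BQ h]
      have pD: "p \<in> hom D x (e (B, h))" using p ph by (simp add: D_simps(2) oe)
      let ?f = "cmp A B (ob x) A' f p"
      have fA: "?f \<in> hom A B A'" by (rule inA[OF p f B obA[OF x] A'])
      have "c (e (B, h)) A' ?f = c x A' f" using c_arrow[OF x yD pD A' f] by (simp add: oe)
      then have "act K J X B A' ?f h = c x A' f"
        using c_eq[OF A', of ?f "e (B, h)"] fA by (simp add: oe)
      moreover have "\<epsilon> (e (B, h)) A' ?f = \<epsilon> x A' f" using \<epsilon>_arrow[OF x yD pD A' f] by (simp add: oe)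
      ultimately show ?thesis using Bh B h fA by blast
    qed
    have wd: "\<epsilon> x A' f = \<epsilon> y A' f'"
      if x: "x \<in> obj D" and y: "y \<in> obj D" and A': "A' \<in> obj A" and f: "f \<in> hom A (ob x) A'"
        and f': "f' \<in> hom A (ob y) A'" and eq: "c x A' f = c y A' f'" for x y A' f f'
    proof -
      obtain B h g where Bh: "(B, h) \<in> S" and B: "B \<in> obj A" and h: "h \<in> hom K X (fobj J B)" and g: "g \<in> hom A B A'"
        and gh: "act K J X B A' g h = c x A' f" and \<epsilon>g: "\<epsilon> (e (B, h)) A' g = \<epsilon> x A' f"
        using reduce[OF x A' f] by blast
      obtain B' h' g' where Bh': "(B', h') \<in> S" and B': "B' \<in> obj A" and h': "h' \<in> hom K X (fobj J B')"
        and g': "g' \<in> hom A B' A'" and gh': "act K J X B' A' g' h' = c y A' f'"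
        and \<epsilon>g': "\<epsilon> (e (B', h')) A' g' = \<epsilon> y A' f'"
        using reduce[OF y A' f'] by blast
      have BQ: "B \<in> Q" "B' \<in> Q" using presentsD(4)[OF S] Bh Bh' by force+
      have "act K J X B A' g h = act K J X B' A' g' h'"
        using gh gh' eq by simp
      then have "kernel_factors X Q B h B' h' A' g g'"
        using presentsD(6)[OF S] Bh Bh' A' g g' unfolding kernel_covers_def by blast
      then obtain C p p' v where C: "C \<in> Q" and p: "p \<in> hom A B C" "p' \<in> hom A B' C" and v: "v \<in> hom A C A'"
        and gv: "g = cmp A B C A' v p" "g' = cmp A B' C A' v p'"
        and ph: "act K J X B C p h = act K J X B' C p' h'"
        by blast
      \<comment> \<open>The common value \<open>k\<close> makes \<open>(C, k)\<close> an object of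
        \<open>D\<close> with arrows to \<open>(B, h)\<close> and to \<open>(B', h')\<close>. Both
        values of \<epsilon> are therefore its value at \<open>(C, k)\<close> on
        \<open>v\<close>.\<close>
      define k where "k = act K J X B C p h"
      have kk: "act K J X B C p h = k"
        "act K J X B' C p' h' = k"
        using ph by (simp_all add: k_def)
      have k: "k \<in> hom K X (fobj J C)"
        unfolding k_def by (rule inK[OF h fmap_in[OF J p(1) B QA[OF C]] X JO[OF B] JO[OF QA[OF C]]])
      note w = D_in[OF C k] and we = ob_e[OF C k] el_e[OF C k]
      note oe = ob_e[OF BQ(1) h] el_e[OF BQ(1) h] ob_e[OF BQ(2) h'] el_e[OF BQ(2) h']
      have pD: "p \<in> hom D (e (C, k)) (e (B, h))" "p' \<in> hom D (e (C, k)) (e (B', h'))"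
        using p kk by (simp_all add: D_simps(2) we oe)
      have "\<epsilon> (e (B, h)) A' g = \<epsilon> (e (C, k)) A' v"
        using \<epsilon>_arrow[OF w D_in[OF BQ(1) h] pD(1) A', of v] v by (simp add: we oe gv(1))
      moreover have "\<epsilon> (e (B', h')) A' g' = \<epsilon> (e (C, k)) A' v"
        using \<epsilon>_arrow[OF w D_in[OF BQ(2) h'] pD(2) A', of v] v by (simp add: we oe gv(2))
      ultimately show ?thesis using \<epsilon>g \<epsilon>g' by simp
    qed
    \<comment> \<open>A chosen preimage of \<open>k\<close> under the cocone \<open>c\<close>. It
      exists by \<open>factor\<close>, and \<open>wd\<close> makes the value of \<epsilon> on it
      independent of the choice.\<close>
    define sel where "sel A' k = (SOME xf. fst xf \<in> obj D \<and> snd xf \<in> hom A (ob (fst xf)) A' \<and>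
        c (fst xf) A' (snd xf) = k)" for A' k
    define u where "u = (\<lambda>A' \<in> obj A. \<lambda>k \<in> hom K X (fobj J A'). \<epsilon> (fst (sel A' k)) A' (snd (sel A' k)))"
    have u_c: "u A' (c x A' f) = \<epsilon> x A' f" if x: "x \<in> obj D" and A': "A' \<in> obj A" and f: "f \<in> hom A (ob x) A'" for x A' f
    proof -
      define s where "s = sel A' (c x A' f)"
      have "fst s \<in> obj D \<and> snd s \<in> hom A (ob (fst s)) A' \<and> c (fst s) A' (snd s) = c x A' f"
        unfolding s_def sel_def by (rule someI[of _ "(x, f)"]) (use that in simp)
      then have "\<epsilon> (fst s) A' (snd s) = \<epsilon> x A' f" using wd[OF _ x A' _ f] by blast
      then show ?thesis using A' c_in[OF x A' f] by (simp add: u_def s_def)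
    qed
    have u_nat: "u \<in> hom ?FC ?F0 W"
    proof (rule set_nat_transI)
      show "u A' \<in> fobj ?F0 A' \<rightarrow>\<^sub>E fobj W A'" if A': "A' \<in> obj A" for A'
        unfolding restricted_hom_simps(1)
      proof (rule PiE_I)
        fix k assume "k \<in> hom K X (fobj J A')"
        then obtain x f where "x \<in> obj D" "f \<in> hom A (ob x) A'" "c x A' f = k" using factor[OF A'] by blast
        then show "u A' k \<in> fobj W A'" using u_c A' \<epsilon>_in by metis
      next
        fix k assume "k \<notin> hom K X (fobj J A')"
        then show "u A' k = undefined" using A' by (simp add: u_def)
      qed
      show "u \<in> extensional (obj A)" by (simp add: u_def)
      fix A' A'' v k assume A': "A' \<in> obj A" "A'' \<in> obj A" "v \<in> hom A A' A''" and k0: "k \<in> fobj ?F0 A'"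
      have k: "k \<in> hom K X (fobj J A')" using k0 by (simp only: restricted_hom_simps)
      then obtain x f where x: "x \<in> obj D" and f: "f \<in> hom A (ob x) A'" and cf: "c x A' f = k"
        using factor[OF A'(1)] by blast
      have "fmap W A' A'' v (u A' k) = \<epsilon> x A'' (cmp A (ob x) A' A'' v f)"
        using u_c[OF x A'(1) f] cf \<epsilon>_push[OF x A' f] by simp
      also have "\<dots> = u A'' (act K J X A' A'' v k)"
        using u_c[OF x A'(2) inA[OF f A'(3) obA[OF x] A'(1,2)]] c_push[OF x A'(1,2) f A'(3)] cf by simp
      finally show "fmap W A' A'' v (u A' k) = u A'' (fmap ?F0 A' A'' v k)"
        using restricted_hom_simps(2)[OF k] by simp
    qed
    have uc: "cmp ?FC (fobj H x) ?F0 W u (c x) = \<epsilon> x" if x: "x \<in> obj D" for x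
    proof (rule extensionalityI[of _ "obj A"])
      show "cmp ?FC (fobj H x) ?F0 W u (c x) \<in> extensional (obj A)" by (simp add: functor_category_simps)
      show "\<epsilon> x \<in> extensional (obj A)" by (rule set_nat_transD(2)[OF \<epsilon>_nat[OF x]])
      fix A' assume A': "A' \<in> obj A"
      have "cmp ?FC (fobj H x) ?F0 W u (c x) A' = compose (hom A (ob x) A') (u A') (c x A')"
        using A' by (simp add: functor_category_simps H_simps hom_functor_simps)
      also have "\<dots> = \<epsilon> x A'"
      proof
        fix f
        have "\<epsilon> x A' \<in> extensional (hom A (ob x) A')"
          using set_nat_transD(1)[OF \<epsilon>_nat[OF x] A'] by (simp add: hom_functor_simps PiE_def)
        then show "compose (hom A (ob x) A') (u A') (c x A') f = \<epsilon> x A' f"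
          using u_c[OF x A'] by (cases "f \<in> hom A (ob x) A'") (simp_all add: compose_def extensional_def)
      qed
      finally show "cmp ?FC (fobj H x) ?F0 W u (c x) A' = \<epsilon> x A'" .
    qed
    have uniq: "v = u" if v: "v \<in> hom ?FC ?F0 W" and vc: "\<forall>x \<in> obj D. cmp ?FC (fobj H x) ?F0 W v (c x) = \<epsilon> x" for v
    proof (rule set_nat_trans_eqI[OF v u_nat])
      fix A' k assume A': "A' \<in> obj A" and "k \<in> fobj ?F0 A'"
      then have "k \<in> hom K X (fobj J A')" by (simp only: restricted_hom_simps)
      then obtain x f where x: "x \<in> obj D" and f: "f \<in> hom A (ob x) A'" and cf: "c x A' f = k"
        using factor[OF A'] by blast
      have "f \<in> fobj (fobj H x) A'" using f by (simp add: H_simps hom_functor_simps)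
      from set_nat_trans_cmp[OF A' this, of ?F0 W v "c x"] vc x cf
      have "v A' k = \<epsilon> x A' f" by simp
      then show "v A' k = u A' k" using u_c[OF x A' f] cf by simp
    qed
    show ?thesis
    proof (rule ex1I[of _ u])
      show "u \<in> hom ?FC ?F0 W \<and> (\<forall>x \<in> obj D. cmp ?FC (fobj H x) ?F0 W u (c x) = \<epsilon> x)"
        using u_nat uc by blast
      show "v = u" if "v \<in> hom ?FC ?F0 W \<and> (\<forall>x \<in> obj D. cmp ?FC (fobj H x) ?F0 W v (c x) = \<epsilon> x)" for v
        using uniq that by blast
    qed
  qed
  then have "is_colimit D ?FC H ?F0 c"
    unfolding is_colimit_def using cocone by blast
  moreover have "\<forall>x \<in> obj D. representable A (fobj H x)"
    using representable_hom_functor[OF obA] by (simp add: H_simps)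
  ultimately show ?thesis
    using smD H unfolding small_functor_def by blast
qed

end

theorem corollary4p46:
  fixes A :: "('a, 'u) category"
    and K :: "('k, 'u) category"
    and J :: "('a, 'u, 'k, 'u) funct"
  assumes "universe TYPE('u)"
    and "accessible A"
    and "accessible K"
    and "is_functor A K J"
    and "fully_faithful A K J"
  shows "(accessibly_embedded A K J \<longleftrightarrow> cone_reflective A K J) \<and>
         (cone_reflective A K J \<longleftrightarrow> virtually_reflective A K J)"
proof -
  interpret accessible_embedding "TYPE('u)" A K J
    using assms by unfold_locales
  have "virtually_reflective A K J" if "cone_reflective A K J"
    unfolding virtually_reflective_def
    using cone_reflective_imp_presents[OF that] presents_imp_small_functor by blast
  then show ?thesis
    using accessibly_embedded_imp_cone_reflective cone_reflective_imp_accessibly_embedded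
      virtually_reflective_imp_cone_reflective by blast
qed

end
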